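(* Let $d\ge 1$ and $s>d$. If $\{f_n\}_{n=1}^\infty$ is a Riesz basis for $L^2(\mathbb{R}^d)$, then $$\sup_{n\in\mathbb{N}}\Big(\inf_{a\in\mathbb{R}^d}\int_{\mathbb{R}^d}|x-a|^{2s}|f_n(x)|^2\,dx+\inf_{b\in\mathbb{R}^d}\int_{\mathbb{R}^d}|\xi-b|^{2s}|\widehat{f_n}(\xi)|^2\,d\xi\Big)=\infty.$$
   Context: $\widehat{f}(\xi)=\int_{\mathbb{R}^d} f(x)e^{-2\pi i x\cdot\xi}\,dx$ denotes the Fourier transform and $|\cdot|$ the Euclidean norm. A Riesz basis of a Hilbert space is the image of an orthonormal basis under a bounded invertible operator. *)

theory Defs
  imports "HOL-Analysis.Analysis"
begin

text \<open>Functions on R^d are modelled as complex-valued functions on a Euclidean space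
  'a (with d = DIM('a)), with Lebesgue (Borel) measure lborel.  Elements of L^2 are
  represented by Borel measurable square-integrable functions; equality in L^2 is
  equality almost everywhere.\<close>

definition sq_int :: "('a::euclidean_space \<Rightarrow> complex) \<Rightarrow> bool" where
  "sq_int f \<longleftrightarrow> f \<in> borel_measurable lborel \<and> integrable lborel (\<lambda>x. (cmod (f x))\<^sup>2)"

definition L2norm :: "('a::euclidean_space \<Rightarrow> complex) \<Rightarrow> real" where
  "L2norm f = sqrt (integral\<^sup>L lborel (\<lambda>x. (cmod (f x))\<^sup>2))"

definition L2inner :: "('a::euclidean_space \<Rightarrow> complex) \<Rightarrow> ('a \<Rightarrow> complex) \<Rightarrow> complex" where
  "L2inner f g = integral\<^sup>L lborel (\<lambda>x. f x * cnj (g x))"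

definition L2_orthonormal_basis :: "(nat \<Rightarrow> 'a::euclidean_space \<Rightarrow> complex) \<Rightarrow> bool" where
  "L2_orthonormal_basis e \<longleftrightarrow>
     (\<forall>n. sq_int (e n)) \<and>
     (\<forall>m n. L2inner (e m) (e n) = (if m = n then 1 else 0)) \<and>
     (\<forall>f. sq_int f \<longrightarrow> (\<forall>\<epsilon>>0. \<exists>N c. L2norm (\<lambda>x. f x - (\<Sum>n<N. c n * e n x)) < \<epsilon>))"

definition L2_bounded_op :: "(('a::euclidean_space \<Rightarrow> complex) \<Rightarrow> ('a \<Rightarrow> complex)) \<Rightarrow> bool" where
  "L2_bounded_op T \<longleftrightarrow>
     (\<forall>f. sq_int f \<longrightarrow> sq_int (T f)) \<and>
     (\<forall>f g. sq_int f \<longrightarrow> sq_int g \<longrightarrow> (AE x in lborel. f x = g x) \<longrightarrow>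
        (AE x in lborel. T f x = T g x)) \<and>
     (\<forall>f g (c::complex). sq_int f \<longrightarrow> sq_int g \<longrightarrow>
        (AE x in lborel. T (\<lambda>y. f y + c * g y) x = T f x + c * T g x)) \<and>
     (\<exists>C. \<forall>f. sq_int f \<longrightarrow> L2norm (T f) \<le> C * L2norm f)"

definition L2_riesz_basis :: "(nat \<Rightarrow> 'a::euclidean_space \<Rightarrow> complex) \<Rightarrow> bool" where
  "L2_riesz_basis f \<longleftrightarrow>
     (\<forall>n. sq_int (f n)) \<and>
     (\<exists>e T S. L2_orthonormal_basis e \<and> L2_bounded_op T \<and> L2_bounded_op S \<and>
        (\<forall>g. sq_int g \<longrightarrow> (AE x in lborel. S (T g) x = g x)) \<and>
        (\<forall>g. sq_int g \<longrightarrow> (AE x in lborel. T (S g) x = g x)) \<and>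
        (\<forall>n. AE x in lborel. f n x = T (e n) x))"

definition fourier_trunc :: "('a::euclidean_space \<Rightarrow> complex) \<Rightarrow> real \<Rightarrow> 'a \<Rightarrow> complex" where
  "fourier_trunc f R \<xi> =
     integral\<^sup>L lborel (\<lambda>x. indicator (ball 0 R) x * f x * cis (- 2 * pi * (x \<bullet> \<xi>)))"

definition is_fourier_L2 :: "('a::euclidean_space \<Rightarrow> complex) \<Rightarrow> ('a \<Rightarrow> complex) \<Rightarrow> bool" where
  "is_fourier_L2 f g \<longleftrightarrow> sq_int g \<and>
     ((\<lambda>R. L2norm (\<lambda>\<xi>. g \<xi> - fourier_trunc f R \<xi>)) \<longlongrightarrow> 0) at_top"

definition fourier_L2 :: "('a::euclidean_space \<Rightarrow> complex) \<Rightarrow> ('a \<Rightarrow> complex)" where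
  "fourier_L2 f = (SOME g. is_fourier_L2 f g)"

end

(*
Suppose all moments are bounded, so that every f n is concentrated, uniformly in n, near a point
(a n, b n) of phase space.  A Plancherel and Bessel argument shows that a ball of radius R in phase
space contains O(R^(2d)) of these points.  As the inner products of f n and f k decay like the s-th
power of the distance of their points and 2 s > 2 d, the tails of the Gram matrix are square
summable, uniformly in n.

For a finite set I of indices let V be the span of the f n with n in I, Q the projection onto V, X
the multiplication by a coordinate and P a difference quotient in that direction.  The compressions
of X and P to V are matrices, so their commutator has trace zero, although [X,P] is close to a
multiple of the identity.  Hence card I is bounded by the product of the Hilbert-Schmidt norms of
(1-Q)XQ and (1-Q)PQ.  Both are computed, up to constants, in the Riesz basis: (1-Q)X f n =
(1-Q)(X - a n) f n is always bounded, likewise for P, and it is small if I contains all indices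
near n, because (X - a n) f n is close to combinations of modulated copies of f n and so is again
localized.  Taking for I a phase space ball whose boundary layer is negligible, which exists by
polynomial growth, contradicts this bound.
*)

theory Submission
  imports Defs "HOL-Probability.Probability"
begin

subsection \<open>Riesz families in a real Hilbert space\<close>

text \<open>Working over the reals loses nothing: with P a translation difference quotient, the
  relation [X,P] = 1 has no factor i, X is symmetric and P is antisymmetric up to the sign of the
  increment. A difference quotient is used because it is bounded, unlike the derivative. Its
  increment is chosen after the finite index set, because the commutator error gets multiplied by
  the square of the number of indices. Two obstacles shape the rest. The dual basis is not known to
  be localized, so local approximation comes from finitely many steps of the frame algorithm, which
  uses only the family itself. Multiplication by X - a costs decay that s > d does not leave to
  spare, so it is replaced by sin(\<eta> (X - a)) / \<eta>, which keeps the weight s in position and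
  in frequency. No rate survives the limit \<eta> \<rightarrow> 0, and therefore decay is a
  qualitative notion: tails that are uniformly small. Finally, 2 s > d makes each \<open>f n\<close>
  integrable, so Plancherel is needed only for integrable square integrable functions.\<close>

definition orthonormal_set :: "'h::real_inner set \<Rightarrow> bool" where
  "orthonormal_set U \<longleftrightarrow> finite U \<and> (\<forall>u\<in>U. \<forall>w\<in>U. u \<bullet> w = (if u = w then 1 else 0))"

lemma orthonormal_basis_exists:
  fixes S :: "'h::real_inner set"
  assumes "finite S"
  obtains U where "orthonormal_set U" "span U = span S"
proof -
  obtain C where C: "finite C" "span C = span S" "pairwise orthogonal C"
    using basis_orthogonal[OF assms] by blast
  define U where "U = (\<lambda>x. x /\<^sub>R norm x) ` (C - {0})"
  have "span U = span (C - {0})"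
    unfolding U_def by (rule span_image_scale) (use C in auto)
  then have "span U = span S" using C by (simp add: span_delete_0)
  moreover have "orthonormal_set U"
    unfolding orthonormal_set_def
  proof (intro conjI ballI)
    show "finite U" using C by (simp add: U_def)
    fix u w assume "u \<in> U" "w \<in> U"
    then obtain x y where x: "x \<in> C" "x \<noteq> 0" "u = x /\<^sub>R norm x" and y: "y \<in> C" "y \<noteq> 0" "w = y /\<^sub>R norm y"
      by (auto simp: U_def)
    show "u \<bullet> w = (if u = w then 1 else 0)"
    proof (cases "x = y")
      case True
      then show ?thesis using x y by (simp add: dot_square_norm power2_eq_square)
    next
      case False
      then have "u \<bullet> w = 0" using C(3) x y by (auto simp: pairwise_def orthogonal_def)
      moreover have "u \<noteq> w"
      proof
        assume "u = w"
        with \<open>u \<bullet> w = 0\<close> have "u = 0" by simp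
        then show False using x by simp
      qed
      ultimately show ?thesis by simp
    qed
  qed
  ultimately show ?thesis using that by blast
qed

lemma orthonormal_expansion:
  assumes U: "orthonormal_set U" and x: "x \<in> span U"
  shows "x = (\<Sum>u\<in>U. (x \<bullet> u) *\<^sub>R u)"
  using x
proof (induction rule: span_induct_alt)
  case base
  show ?case by simp
next
  case (step c x y)
  have "(\<Sum>u\<in>U. ((c *\<^sub>R x + y) \<bullet> u) *\<^sub>R u) = c *\<^sub>R (\<Sum>u\<in>U. (x \<bullet> u) *\<^sub>R u) + (\<Sum>u\<in>U. (y \<bullet> u) *\<^sub>R u)"
    by (simp add: inner_add_left scaleR_add_left sum.distrib scaleR_sum_right)
  moreover have "(\<Sum>u\<in>U. (x \<bullet> u) *\<^sub>R u) = (\<Sum>u\<in>U. if u = x then x else 0)"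
    using U step(1) by (intro sum.cong) (auto simp: orthonormal_set_def)
  ultimately show ?case using step U by (simp add: orthonormal_set_def)
qed

lemma orthonormal_inner:
  assumes U: "orthonormal_set U" and x: "x \<in> span U"
  shows "x \<bullet> y = (\<Sum>u\<in>U. (x \<bullet> u) * (y \<bullet> u))"
proof -
  have "x \<bullet> y = (\<Sum>u\<in>U. (x \<bullet> u) *\<^sub>R u) \<bullet> y" using orthonormal_expansion[OF U x] by simp
  then show ?thesis by (simp only: inner_sum_left inner_scaleR_left inner_commute[of y])
qed

text \<open>For an orthonormal \<open>U\<close> this is the orthogonal projection onto the span. The
  finite sum makes it available without completeness of the space.\<close>

definition oproj :: "'h::real_inner set \<Rightarrow> 'h \<Rightarrow> 'h" where
  "oproj U x = (\<Sum>u\<in>U. (x \<bullet> u) *\<^sub>R u)"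

lemma oproj_in_span: "oproj U x \<in> span U"
  unfolding oproj_def by (intro span_sum span_scale span_base)

lemma oproj_orthogonal:
  assumes U: "orthonormal_set U" and v: "v \<in> span U"
  shows "(x - oproj U x) \<bullet> v = 0"
  using v
proof (induction rule: span_induct_alt)
  case (step c w y)
  have "oproj U x \<bullet> w = (\<Sum>u\<in>U. if u = w then x \<bullet> w else 0)"
    unfolding oproj_def inner_sum_left using U step(1)
    by (intro sum.cong) (auto simp: orthonormal_set_def)
  also have "\<dots> = x \<bullet> w" using U step(1) by (simp add: orthonormal_set_def)
  finally show ?case using step by (simp add: inner_diff_left inner_add_right)
qed simp

lemma oproj_linear:
  "oproj U (\<Sum>i\<in>I. c i *\<^sub>R x i) = (\<Sum>i\<in>I. c i *\<^sub>R oproj U (x i))"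
  unfolding oproj_def inner_sum_left scaleR_sum_left scaleR_sum_right
  by (subst sum.swap) simp

text \<open>Because the projection is the best approximation, later hypotheses may name any
  approximant \<open>v\<close> in the span instead of the projection itself.\<close>

lemma oproj_dist:
  assumes U: "orthonormal_set U" and v: "v \<in> span U"
  shows "(norm (x - oproj U x))\<^sup>2 \<le> (norm (x - v))\<^sup>2"
proof -
  have "oproj U x - v \<in> span U" by (intro span_diff oproj_in_span v)
  then have "orthogonal (x - oproj U x) (oproj U x - v)"
    using oproj_orthogonal[OF U] by (simp add: orthogonal_def)
  from norm_add_Pythagorean[OF this] show ?thesis by simp
qed

text \<open>The sum is the contribution of the compressions, which will cancel in a trace; the last
  term is all that survives.\<close>

lemma oproj_inner:
  assumes U: "orthonormal_set U"
  shows "x \<bullet> y = (\<Sum>u\<in>U. (x \<bullet> u) * (y \<bullet> u)) + (x - oproj U x) \<bullet> (y - oproj U y)"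
proof -
  have "x \<bullet> y = oproj U x \<bullet> y + (x - oproj U x) \<bullet> y" by (simp add: inner_diff_left)
  moreover have "oproj U x \<bullet> y = (\<Sum>u\<in>U. (x \<bullet> u) * (y \<bullet> u))"
    by (simp only: oproj_def inner_sum_left inner_scaleR_left inner_commute[of y])
  moreover have "(x - oproj U x) \<bullet> (y - oproj U y) = (x - oproj U x) \<bullet> y"
    using oproj_orthogonal[OF U oproj_in_span] by (simp add: inner_diff_right)
  ultimately show ?thesis by simp
qed

text \<open>Coefficients are indexed by \<open>I\<close> and not by the image, so that they can
  serve as rows of a matrix.\<close>

lemma span_family_coeffs:
  fixes F :: "'i \<Rightarrow> 'h::real_vector"
  assumes I: "finite I" and v: "v \<in> span (F ` I)"
  shows "\<exists>c. v = (\<Sum>i\<in>I. c i *\<^sub>R F i)"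
  using v
proof (induction rule: span_induct_alt)
  case base
  show ?case by (rule exI[of _ "\<lambda>_. 0"]) simp
next
  case (step r x y)
  then obtain i c where i: "i \<in> I" "x = F i" and c: "y = (\<Sum>i\<in>I. c i *\<^sub>R F i)" by blast
  have "r *\<^sub>R x + y = (\<Sum>j\<in>I. ((if j = i then r else 0) + c j) *\<^sub>R F j)"
    using i I by (simp add: c scaleR_add_left sum.distrib if_distrib[of "\<lambda>r. r *\<^sub>R _"] cong: if_cong)
  then show ?case by (rule exI[of _ "\<lambda>j. (if j = i then r else 0) + c j"])
qed

lemma sum_mult_le_sqrt:
  fixes f g :: "'i \<Rightarrow> real"
  shows "(\<Sum>i\<in>I. f i * g i) \<le> sqrt (\<Sum>i\<in>I. (f i)\<^sup>2) * sqrt (\<Sum>i\<in>I. (g i)\<^sup>2)"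
proof -
  have "(\<Sum>i\<in>I. f i * g i)\<^sup>2 \<le> (\<Sum>i\<in>I. (f i)\<^sup>2) * (\<Sum>i\<in>I. (g i)\<^sup>2)"
    by (rule Cauchy_Schwarz_ineq_sum)
  then show ?thesis by (simp add: real_le_rsqrt flip: real_sqrt_mult)
qed

text \<open>Closes estimates in which a sum of squares appears on both sides, including the case
  where that sum vanishes and cannot be divided by.\<close>

lemma le_of_square_le:
  fixes x c :: real
  assumes "x * x \<le> c * x" "0 \<le> c"
  shows "x \<le> c"
proof (cases "0 < x")
  case True
  with assms(1) show ?thesis by (rule mult_right_le_imp_le)
qed (use assms(2) in simp)

locale riesz_family =
  fixes F :: "'i \<Rightarrow> 'h::real_inner" and A B :: real
  assumes A: "0 < A"
    and upper: "finite G \<Longrightarrow> (norm (\<Sum>i\<in>G. c i *\<^sub>R F i))\<^sup>2 \<le> B * (\<Sum>i\<in>G. (c i)\<^sup>2)"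
    and lower: "finite G \<Longrightarrow> A * (\<Sum>i\<in>G. (c i)\<^sup>2) \<le> (norm (\<Sum>i\<in>G. c i *\<^sub>R F i))\<^sup>2"
    and frame: "0 < e \<Longrightarrow> \<exists>G. finite G \<and> A * (norm h)\<^sup>2 - e \<le> (\<Sum>i\<in>G. (h \<bullet> F i)\<^sup>2)"
begin

lemma norm_bounds: "A \<le> (norm (F i))\<^sup>2" "(norm (F i))\<^sup>2 \<le> B"
  using lower[of "{i}" "\<lambda>_. 1"] upper[of "{i}" "\<lambda>_. 1"] by auto

text \<open>Types are inhabited, so some index exists. This also yields that \<open>B\<close> is
  positive.\<close>

lemma A_le_B: "A \<le> B"
  using norm_bounds[of undefined] by linarith

text \<open>Duality: the sum \<open>?S\<close> is the inner product of \<open>h\<close> with the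
  vector synthesised from its own coefficients, and \<open>upper\<close> bounds that vector by
  \<open>?S\<close> again.\<close>

lemma bessel:
  assumes G: "finite G"
  shows "(\<Sum>i\<in>G. (h \<bullet> F i)\<^sup>2) \<le> B * (norm h)\<^sup>2"
proof -
  let ?S = "\<Sum>i\<in>G. (h \<bullet> F i)\<^sup>2" and ?x = "\<Sum>i\<in>G. (h \<bullet> F i) *\<^sub>R F i"
  have "?S = h \<bullet> ?x" by (simp add: inner_sum_right power2_eq_square)
  then have "?S \<le> norm h * norm ?x" using norm_cauchy_schwarz[of h ?x] by linarith
  then have "?S\<^sup>2 \<le> (norm h * norm ?x)\<^sup>2" by (rule power_mono) (intro sum_nonneg, simp)
  also have "\<dots> \<le> (norm h)\<^sup>2 * (B * ?S)"
    unfolding power_mult_distrib using upper[OF G] by (intro mult_left_mono) auto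
  finally have "?S * ?S \<le> (B * (norm h)\<^sup>2) * ?S" by (simp add: power2_eq_square mult_ac)
  moreover have "0 \<le> B * (norm h)\<^sup>2" using A A_le_B by simp
  ultimately show ?thesis by (rule le_of_square_le)
qed

lemma independent_F: "finite I \<Longrightarrow> inj_on F I \<and> independent (F ` I)"
proof -
  assume I: "finite I"
  have inj: "inj_on F I"
  proof (rule inj_onI, rule ccontr)
    fix i j assume ij: "i \<in> I" "j \<in> I" "F i = F j" "i \<noteq> j"
    \<comment> \<open>The coefficients 1 and -1 would give the zero vector if
      \<open>F i = F j\<close>, against the lower bound.\<close>
    have "A * (\<Sum>k\<in>{i,j}. (if k = i then 1 else -1)\<^sup>2) \<le> (norm (\<Sum>k\<in>{i,j}. (if k = i then 1 else -1) *\<^sub>R F k))\<^sup>2"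
      by (rule lower) simp
    with ij A show False by simp
  qed
  moreover have "independent (F ` I)"
  proof
    assume "dependent (F ` I)"
    then obtain u where u: "\<exists>v\<in>F ` I. u v \<noteq> 0" "(\<Sum>v\<in>F ` I. u v *\<^sub>R v) = 0"
      using I by (auto simp: dependent_finite)
    have "A * (\<Sum>i\<in>I. (u (F i))\<^sup>2) \<le> (norm (\<Sum>i\<in>I. u (F i) *\<^sub>R F i))\<^sup>2"
      by (rule lower[OF I])
    also have "(\<Sum>i\<in>I. u (F i) *\<^sub>R F i) = 0" using u(2) inj by (simp add: sum.reindex)
    finally have "(\<Sum>i\<in>I. (u (F i))\<^sup>2) \<le> 0" using A by (simp add: mult_le_0_iff)
    then have "(\<Sum>i\<in>I. (u (F i))\<^sup>2) = 0" by (intro antisym sum_nonneg) auto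
    then have "\<forall>i\<in>I. (u (F i))\<^sup>2 = 0" using I by (subst (asm) sum_nonneg_eq_0_iff) auto
    with u(1) show False by auto
  qed
  ultimately show ?thesis by simp
qed

text \<open>The matrix of coefficients is bounded because its transpose is, by the lower Riesz bound.\<close>

lemma coeff_bound:
  assumes I: "finite I" and U: "orthonormal_set U" and t: "\<And>u. u \<in> U \<Longrightarrow> u = (\<Sum>i\<in>I. t u i *\<^sub>R F i)"
  shows "(\<Sum>u\<in>U. (\<Sum>i\<in>I. t u i * v i)\<^sup>2) \<le> (1 / A) * (\<Sum>i\<in>I. (v i)\<^sup>2)"
proof -
  define d where "d u = (\<Sum>i\<in>I. t u i * v i)" for u
  define e where "e i = (\<Sum>u\<in>U. d u * t u i)" for i
  let ?D = "\<Sum>u\<in>U. (d u)\<^sup>2" and ?E = "\<Sum>i\<in>I. (e i)\<^sup>2" and ?V = "\<Sum>i\<in>I. (v i)\<^sup>2"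
  have fU: "finite U" using U by (simp add: orthonormal_set_def)
  \<comment> \<open>One vector in two coordinate systems: its coordinates are \<open>d\<close> in
    \<open>U\<close> and \<open>e\<close> in \<open>F\<close>. Orthonormality computes its norm, and
    \<open>lower\<close> then bounds \<open>?E\<close>.\<close>
  have "(\<Sum>u\<in>U. d u *\<^sub>R u) = (\<Sum>u\<in>U. d u *\<^sub>R (\<Sum>i\<in>I. t u i *\<^sub>R F i))"
    using t by (intro sum.cong) auto
  also have "\<dots> = (\<Sum>i\<in>I. e i *\<^sub>R F i)"
    unfolding e_def scaleR_sum_right scaleR_sum_left by (subst sum.swap) simp
  finally have "A * ?E \<le> (norm (\<Sum>u\<in>U. d u *\<^sub>R u))\<^sup>2" using lower[OF I, of e] by simp
  also have "\<dots> = (\<Sum>u\<in>U. d u * (\<Sum>w\<in>U. d w * (w \<bullet> u)))"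
    unfolding power2_norm_eq_inner by (simp add: inner_sum_left inner_sum_right)
  also have "\<dots> = (\<Sum>u\<in>U. d u * (\<Sum>w\<in>U. if w = u then d u else 0))"
    using U by (intro sum.cong refl arg_cong2[of _ _ _ _ "(*)"]) (auto simp: orthonormal_set_def)
  also have "\<dots> = ?D" using fU by (simp add: power2_eq_square)
  finally have E: "?E \<le> ?D / A" using A by (simp add: field_simps)
  have "?D = (\<Sum>u\<in>U. d u * (\<Sum>i\<in>I. t u i * v i))" by (simp add: power2_eq_square d_def)
  also have "\<dots> = (\<Sum>i\<in>I. e i * v i)"
    unfolding e_def sum_distrib_left sum_distrib_right by (subst sum.swap) (simp add: mult_ac)
  finally have "?D\<^sup>2 \<le> ?E * ?V" using Cauchy_Schwarz_ineq_sum[of e v I] by simp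
  also have "\<dots> \<le> (?D / A) * ?V" by (intro mult_right_mono E sum_nonneg) auto
  finally have "?D * ?D \<le> ((1 / A) * ?V) * ?D" by (simp add: power2_eq_square mult_ac)
  moreover have "0 \<le> (1 / A) * ?V" using A by (auto intro!: sum_nonneg divide_nonneg_pos)
  ultimately have "?D \<le> (1 / A) * ?V" by (rule le_of_square_le)
  then show ?thesis by (simp add: d_def)
qed

text \<open>The scalar bound is applied to each coordinate in an orthonormal basis of the span of
  the \<open>z i\<close>. It bounds a Hilbert-Schmidt norm, computed in \<open>U\<close>, by the
  same sum over the Riesz family.\<close>

lemma coeff_bound_vec:
  fixes z :: "'i \<Rightarrow> 'h"
  assumes I: "finite I" and U: "orthonormal_set U" and t: "\<And>u. u \<in> U \<Longrightarrow> u = (\<Sum>i\<in>I. t u i *\<^sub>R F i)"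
  shows "(\<Sum>u\<in>U. (norm (\<Sum>i\<in>I. t u i *\<^sub>R z i))\<^sup>2) \<le> (1 / A) * (\<Sum>i\<in>I. (norm (z i))\<^sup>2)"
proof -
  obtain W where W: "orthonormal_set W" "span W = span (z ` I)"
    using orthonormal_basis_exists[of "z ` I"] I by blast
  have nrm: "(norm x)\<^sup>2 = (\<Sum>w\<in>W. (x \<bullet> w)\<^sup>2)" if "x \<in> span (z ` I)" for x
    using orthonormal_inner[OF W(1), of x x] that W(2)
    by (simp add: power2_eq_square flip: power2_norm_eq_inner)
  have "(\<Sum>u\<in>U. (norm (\<Sum>i\<in>I. t u i *\<^sub>R z i))\<^sup>2) = (\<Sum>u\<in>U. \<Sum>w\<in>W. (\<Sum>i\<in>I. t u i * (z i \<bullet> w))\<^sup>2)"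
    by (intro sum.cong refl, subst nrm) (auto intro!: span_sum span_scale intro: span_base simp: inner_sum_left)
  also have "\<dots> = (\<Sum>w\<in>W. \<Sum>u\<in>U. (\<Sum>i\<in>I. t u i * (z i \<bullet> w))\<^sup>2)" by (rule sum.swap)
  also have "\<dots> \<le> (\<Sum>w\<in>W. (1 / A) * (\<Sum>i\<in>I. (z i \<bullet> w)\<^sup>2))"
    by (intro sum_mono coeff_bound[OF I U t])
  also have "\<dots> = (1 / A) * (\<Sum>i\<in>I. \<Sum>w\<in>W. (z i \<bullet> w)\<^sup>2)"
    by (subst sum.swap) (simp add: sum_distrib_left)
  also have "(\<Sum>i\<in>I. \<Sum>w\<in>W. (z i \<bullet> w)\<^sup>2) = (\<Sum>i\<in>I. (norm (z i))\<^sup>2)"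
    by (intro sum.cong refl nrm[symmetric] span_base) auto
  finally show ?thesis .
qed

text \<open>Here \<open>y i = X F\<^sub>i\<close>, and \<open>p i\<close>, \<open>p' i\<close> are difference quotients of \<open>F\<^sub>i\<close> for opposite increments,
  which makes them formally anti-adjoint.  The compressions to the span cancel in the trace, so only the
  components orthogonal to the span contribute.\<close>

lemma trace_bound:
  fixes y p p' :: "'i \<Rightarrow> 'h"
  assumes I: "finite I" and eta: "0 \<le> \<eta>"
    and sym: "\<And>i j. i \<in> I \<Longrightarrow> j \<in> I \<Longrightarrow> y i \<bullet> F j = F i \<bullet> y j"
    and adj: "\<And>i j. i \<in> I \<Longrightarrow> j \<in> I \<Longrightarrow> p i \<bullet> F j = - (F i \<bullet> p' j)"
    and comm: "\<And>i j. i \<in> I \<Longrightarrow> j \<in> I \<Longrightarrow> \<bar>p i \<bullet> y j + y i \<bullet> p' j - F i \<bullet> F j\<bar> \<le> \<eta>"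
    and dy: "\<And>i. i \<in> I \<Longrightarrow> \<exists>v\<in>span (F ` I). (norm (y i - v))\<^sup>2 \<le> dy i"
    and dp: "\<And>i. i \<in> I \<Longrightarrow> \<exists>v\<in>span (F ` I). (norm (p i - v))\<^sup>2 \<le> dp"
    and dp': "\<And>i. i \<in> I \<Longrightarrow> \<exists>v\<in>span (F ` I). (norm (p' i - v))\<^sup>2 \<le> dp"
  shows "real (card I) - \<eta> * (real (card I))\<^sup>2 / A \<le> 2 / A * sqrt (\<Sum>i\<in>I. dy i) * sqrt (real (card I) * dp)"
proof -
  obtain U where U: "orthonormal_set U" "span U = span (F ` I)"
    using orthonormal_basis_exists[of "F ` I"] I by blast
  have fU: "finite U" using U(1) by (simp add: orthonormal_set_def)
  have "\<exists>c. u = (\<Sum>i\<in>I. c i *\<^sub>R F i)" if "u \<in> U" for u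
    by (rule span_family_coeffs[OF I]) (use that U(2) span_base in blast)
  then have "\<exists>t. \<forall>u\<in>U. u = (\<Sum>i\<in>I. t u i *\<^sub>R F i)" by (intro bchoice ballI)
  then obtain t where t: "\<And>u. u \<in> U \<Longrightarrow> u = (\<Sum>i\<in>I. t u i *\<^sub>R F i)" by blast
  note cb = coeff_bound[OF I U(1) t] and cbv = coeff_bound_vec[OF I U(1) t]
  \<comment> \<open>Only this inequality is needed: the trace of the identity on the span is
    \<open>card U\<close>, and it has to be at least \<open>card I\<close>.\<close>
  have "card (F ` I) \<le> card U"
  proof -
    have "F ` I \<subseteq> span U" unfolding U(2) by (rule span_superset)
    from independent_span_bound[OF fU _ this] independent_F[OF I] show ?thesis by simp
  qed
  then have cardU: "card I \<le> card U" using independent_F[OF I] by (simp add: card_image)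
  \<comment> \<open>\<open>L z\<close> is the linear extension of \<open>F i \<mapsto> z i\<close>
    to the basis \<open>U\<close>, and \<open>R z\<close> is its component orthogonal to the
    span.\<close>
  define L where "L z u = (\<Sum>i\<in>I. t u i *\<^sub>R z i)" for z :: "'i \<Rightarrow> 'h" and u
  define R where "R z u = L z u - oproj U (L z u)" for z u
  have LF: "L F u = u" if "u \<in> U" for u using t[OF that] by (simp add: L_def)
  have bil: "L z u \<bullet> L z' u' = (\<Sum>i\<in>I. \<Sum>j\<in>I. t u i * (t u' j * (z i \<bullet> z' j)))" for z z' u u'
    unfolding L_def by (simp only: inner_sum_left inner_scaleR_left)
      (simp only: inner_sum_right inner_scaleR_right sum_distrib_left)
  have symU: "L y u \<bullet> w = u \<bullet> L y w" if "u \<in> U" "w \<in> U" for u w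
  proof -
    have "L y u \<bullet> L F w = L F u \<bullet> L y w" unfolding bil using sym by (intro sum.cong) auto
    then show ?thesis using LF that by simp
  qed
  have adjU: "L p u \<bullet> w = - (u \<bullet> L p' w)" if "u \<in> U" "w \<in> U" for u w
  proof -
    have "L p u \<bullet> L F w = - (L F u \<bullet> L p' w)" unfolding bil sum_negf[symmetric] using adj by (intro sum.cong) auto
    then show ?thesis using LF that by simp
  qed
  have Rle: "(\<Sum>u\<in>U. (norm (R z u))\<^sup>2) \<le> (1 / A) * (\<Sum>i\<in>I. dz i)"
    if dz: "\<And>i. i \<in> I \<Longrightarrow> \<exists>v\<in>span (F ` I). (norm (z i - v))\<^sup>2 \<le> dz i" for z and dz :: "'i \<Rightarrow> real"
  proof -
    have "R z u = (\<Sum>i\<in>I. t u i *\<^sub>R (z i - oproj U (z i)))" for u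
      unfolding R_def L_def oproj_linear by (simp add: scaleR_diff_right sum_subtractf)
    then have "(\<Sum>u\<in>U. (norm (R z u))\<^sup>2) \<le> (1 / A) * (\<Sum>i\<in>I. (norm (z i - oproj U (z i)))\<^sup>2)"
      using cbv by simp
    also have "\<dots> \<le> (1 / A) * (\<Sum>i\<in>I. dz i)"
    proof (intro mult_left_mono sum_mono)
      fix i assume "i \<in> I"
      then obtain v where "v \<in> span U" "(norm (z i - v))\<^sup>2 \<le> dz i" using dz U(2) by blast
      then show "(norm (z i - oproj U (z i)))\<^sup>2 \<le> dz i"
        using oproj_dist[OF U(1)] order.trans by blast
    qed (use A in auto)
    finally show ?thesis .
  qed
  \<comment> \<open>The trace of a commutator of matrices vanishes: symmetry of \<open>y\<close> and
    antisymmetry between \<open>p\<close> and \<open>p'\<close> turn the second double sum, after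
    exchanging \<open>u\<close> and \<open>w\<close>, into minus the first.\<close>
  have split: "(\<Sum>u\<in>U. L p u \<bullet> L y u + L y u \<bullet> L p' u) = (\<Sum>u\<in>U. R p u \<bullet> R y u + R y u \<bullet> R p' u)"
  proof -
    have "(\<Sum>u\<in>U. L p u \<bullet> L y u + L y u \<bullet> L p' u) =
      (\<Sum>u\<in>U. \<Sum>w\<in>U. (L p u \<bullet> w) * (L y u \<bullet> w)) + (\<Sum>u\<in>U. \<Sum>w\<in>U. (L y u \<bullet> w) * (L p' u \<bullet> w))
      + (\<Sum>u\<in>U. R p u \<bullet> R y u + R y u \<bullet> R p' u)"
    proof -
      have "L a u \<bullet> L b u = (\<Sum>w\<in>U. (L a u \<bullet> w) * (L b u \<bullet> w)) + R a u \<bullet> R b u" for a b u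
        unfolding R_def by (rule oproj_inner[OF U(1)])
      then have "(\<Sum>u\<in>U. L p u \<bullet> L y u + L y u \<bullet> L p' u) =
        (\<Sum>u\<in>U. ((\<Sum>w\<in>U. (L p u \<bullet> w) * (L y u \<bullet> w)) + R p u \<bullet> R y u) +
          ((\<Sum>w\<in>U. (L y u \<bullet> w) * (L p' u \<bullet> w)) + R y u \<bullet> R p' u))"
        by (intro sum.cong refl arg_cong2[of _ _ _ _ "(+)"])
      then show ?thesis by (simp add: sum.distrib)
    qed
    moreover have "(\<Sum>u\<in>U. \<Sum>w\<in>U. (L y u \<bullet> w) * (L p' u \<bullet> w)) = (\<Sum>w\<in>U. \<Sum>u\<in>U. (L y u \<bullet> w) * (L p' u \<bullet> w))"
      by (rule sum.swap)
    moreover have "\<dots> = (\<Sum>w\<in>U. \<Sum>u\<in>U. - ((L p w \<bullet> u) * (L y w \<bullet> u)))"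
      using symU adjU by (intro sum.cong refl) (simp add: inner_commute)
    ultimately show ?thesis by (simp add: sum_negf)
  qed
  let ?N = "\<lambda>z. \<Sum>u\<in>U. (norm (R z u))\<^sup>2"
  have "real (card I) - \<eta> * (real (card I))\<^sup>2 / A \<le> (\<Sum>u\<in>U. L p u \<bullet> L y u + L y u \<bullet> L p' u)"
  proof -
    \<comment> \<open>\<open>coeff_bound\<close> at a unit vector bounds each column of the
      coefficient matrix. Summing over all pairs of indices produces the factor
      \<open>(card I)^2 / A\<close> in front of \<open>\<eta>\<close>.\<close>
    have "(\<Sum>u\<in>U. \<bar>t u i\<bar> * \<bar>t u j\<bar>) \<le> 1 / A" if "i \<in> I" "j \<in> I" for i j
    proof -
      have s: "(\<Sum>u\<in>U. (t u i)\<^sup>2) \<le> 1 / A" if "i \<in> I" for i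
      proof -
        have "(\<Sum>k\<in>I. t u k * (if k = i then 1 else 0)) = t u i" for u
          using I that by (simp add: if_distrib cong: if_cong)
        moreover have "(\<Sum>k\<in>I. (if k = i then 1 else 0 :: real)\<^sup>2) = 1"
          using I that by (simp add: if_distrib[of "\<lambda>x. x^2"] cong: if_cong)
        ultimately show ?thesis using cb[of "\<lambda>k. if k = i then 1 else 0"] by simp
      qed
      have "(\<Sum>u\<in>U. \<bar>t u i\<bar> * \<bar>t u j\<bar>) \<le> (\<Sum>u\<in>U. ((t u i)\<^sup>2 + (t u j)\<^sup>2) / 2)"
      proof (rule sum_mono)
        fix u show "\<bar>t u i\<bar> * \<bar>t u j\<bar> \<le> ((t u i)\<^sup>2 + (t u j)\<^sup>2) / 2"
          using sum_squares_bound[of "\<bar>t u i\<bar>" "\<bar>t u j\<bar>"] by simp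
      qed
      also have "\<dots> \<le> 1 / A"
        using s[OF that(1)] s[OF that(2)] by (simp add: sum.distrib flip: sum_divide_distrib)
      finally show ?thesis .
    qed
    then have "(\<Sum>i\<in>I. \<Sum>j\<in>I. \<Sum>u\<in>U. \<bar>t u i\<bar> * \<bar>t u j\<bar>) \<le> (\<Sum>i\<in>I. \<Sum>j\<in>I. 1 / A)"
      by (intro sum_mono) auto
    then have tt: "(\<Sum>i\<in>I. \<Sum>j\<in>I. \<Sum>u\<in>U. \<bar>t u i\<bar> * \<bar>t u j\<bar>) \<le> (real (card I))\<^sup>2 / A"
      by (simp add: power2_eq_square)
    have "(\<Sum>u\<in>U. L F u \<bullet> L F u - (L p u \<bullet> L y u + L y u \<bullet> L p' u)) \<le>
      (\<Sum>u\<in>U. \<Sum>i\<in>I. \<Sum>j\<in>I. \<eta> * (\<bar>t u i\<bar> * \<bar>t u j\<bar>))"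
    proof (rule sum_mono)
      fix u
      have "L F u \<bullet> L F u - (L p u \<bullet> L y u + L y u \<bullet> L p' u) =
        (\<Sum>i\<in>I. \<Sum>j\<in>I. - (t u i * t u j * (p i \<bullet> y j + y i \<bullet> p' j - F i \<bullet> F j)))"
        unfolding bil by (simp add: algebra_simps sum.distrib sum_subtractf sum_negf)
      also have "\<dots> \<le> (\<Sum>i\<in>I. \<Sum>j\<in>I. \<eta> * (\<bar>t u i\<bar> * \<bar>t u j\<bar>))"
      proof (intro sum_mono)
        fix i j assume ij: "i \<in> I" "j \<in> I"
        have "- (t u i * t u j * (p i \<bullet> y j + y i \<bullet> p' j - F i \<bullet> F j)) \<le> \<bar>t u i * t u j\<bar> * \<bar>p i \<bullet> y j + y i \<bullet> p' j - F i \<bullet> F j\<bar>"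
          unfolding abs_mult[symmetric] by simp
        also have "\<dots> \<le> \<bar>t u i * t u j\<bar> * \<eta>" by (intro mult_left_mono comm ij) simp
        finally show "- (t u i * t u j * (p i \<bullet> y j + y i \<bullet> p' j - F i \<bullet> F j)) \<le> \<eta> * (\<bar>t u i\<bar> * \<bar>t u j\<bar>)"
          by (simp add: abs_mult mult_ac)
      qed
      finally show "L F u \<bullet> L F u - (L p u \<bullet> L y u + L y u \<bullet> L p' u) \<le> (\<Sum>i\<in>I. \<Sum>j\<in>I. \<eta> * (\<bar>t u i\<bar> * \<bar>t u j\<bar>))" .
    qed
    also have "\<dots> = \<eta> * (\<Sum>i\<in>I. \<Sum>j\<in>I. \<Sum>u\<in>U. \<bar>t u i\<bar> * \<bar>t u j\<bar>)"
      by (subst sum.swap, subst sum.swap[of _ I U]) (simp add: sum_distrib_left)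
    also have "\<dots> \<le> \<eta> * ((real (card I))\<^sup>2 / A)" by (intro mult_left_mono tt eta)
    finally have "(\<Sum>u\<in>U. L F u \<bullet> L F u) - (\<Sum>u\<in>U. L p u \<bullet> L y u + L y u \<bullet> L p' u) \<le> \<eta> * ((real (card I))\<^sup>2 / A)"
      by (simp add: sum_subtractf)
    moreover have "(\<Sum>u\<in>U. L F u \<bullet> L F u) = real (card U)"
      using U(1) by (simp add: LF orthonormal_set_def)
    ultimately show ?thesis using cardU by simp
  qed
  also have "\<dots> \<le> (\<Sum>u\<in>U. norm (R p u) * norm (R y u)) + (\<Sum>u\<in>U. norm (R y u) * norm (R p' u))"
    unfolding split sum.distrib[symmetric] by (intro sum_mono add_mono norm_cauchy_schwarz)
  also have "\<dots> \<le> sqrt (?N p) * sqrt (?N y) + sqrt (?N y) * sqrt (?N p')"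
    by (intro add_mono sum_mult_le_sqrt)
  also have "\<dots> \<le> sqrt ((1 / A) * (\<Sum>i\<in>I. dp)) * sqrt ((1 / A) * (\<Sum>i\<in>I. dy i)) + sqrt ((1 / A) * (\<Sum>i\<in>I. dy i)) * sqrt ((1 / A) * (\<Sum>i\<in>I. dp))"
  proof -
    have "0 \<le> ?N z" for z by (intro sum_nonneg) simp
    then have nn: "0 \<le> sqrt (?N z)" for z by simp
    have s: "sqrt (?N p) \<le> sqrt ((1 / A) * (\<Sum>i\<in>I. dp))" "sqrt (?N p') \<le> sqrt ((1 / A) * (\<Sum>i\<in>I. dp))"
      "sqrt (?N y) \<le> sqrt ((1 / A) * (\<Sum>i\<in>I. dy i))"
      using Rle[OF dp] Rle[OF dp'] Rle[OF dy] by (auto intro: real_sqrt_le_mono)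
    show ?thesis
      by (intro add_mono mult_mono s nn order.trans[OF nn s(1)] order.trans[OF nn s(3)])
  qed
  also have "\<dots> = 2 / A * sqrt (\<Sum>i\<in>I. dy i) * sqrt (real (card I) * dp)"
    using A by (simp add: real_sqrt_mult real_sqrt_divide)
  finally show ?thesis .
qed

end

section \<open>Dyadic scales and polynomial growth\<close>

lemma dyadic_interval:
  fixes t :: real
  assumes "1 < t"
  obtains k :: nat where "2 ^ k < t" "t \<le> 2 ^ Suc k"
proof -
  obtain m where m: "t < 2 ^ m" using real_arch_pow[of 2 t] by auto
  define n where "n = (LEAST n. t \<le> 2 ^ n)"
  have n: "t \<le> 2 ^ n" unfolding n_def by (rule LeastI[of "\<lambda>n. t \<le> 2 ^ n" m]) (use m in simp)
  have "n \<noteq> 0" using n assms by (cases n) auto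
  then obtain k where k: "n = Suc k" by (cases n) auto
  have "\<not> t \<le> 2 ^ k" using not_less_Least[of k "\<lambda>n. t \<le> 2 ^ n"] k by (simp add: n_def)
  then show ?thesis using that[of k] n k by simp
qed

lemma powr_sq: "0 \<le> x \<Longrightarrow> (x powr s)\<^sup>2 = x powr (2 * s)" for x :: real
  by (cases "x = 0") (auto simp: powr_power mult.commute)

text \<open>Polynomial growth rules out that every enlargement by a fixed radius multiplies the count.\<close>

lemma Folner_radius:
  fixes N :: "real \<Rightarrow> nat"
  assumes mono: "mono N" and R0: "0 < N R0" and C: "\<And>R. 0 \<le> R \<Longrightarrow> real (N R) \<le> C * (1 + R) ^ D"
    and D: "0 < D" and e: "0 < \<epsilon>"
  shows "\<exists>R. 0 < N R \<and> real (N (R + K)) \<le> (1 + \<epsilon>) * real (N R)"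
proof (rule ccontr)
  assume "\<not> ?thesis"
  then have grow: "0 < N R \<Longrightarrow> (1 + \<epsilon>) * real (N R) < real (N (R + K))" for R
    by (meson not_le)
  \<comment> \<open>For negative \<open>K\<close> the enlargement shrinks the set, so growth fails
    at once by monotonicity.\<close>
  have K: "0 \<le> K"
  proof (rule ccontr)
    assume "\<not> 0 \<le> K"
    then have "N (R0 + K) \<le> N R0" by (intro monoD[OF mono]) simp
    moreover have "real (N R0) \<le> (1 + \<epsilon>) * real (N R0)" using e by (simp add: algebra_simps)
    ultimately show False using grow[OF R0] by linarith
  qed
  \<comment> \<open>A nonnegative starting radius, so that the polynomial bound applies to every
    \<open>a + n K\<close>.\<close>
  define a where "a = max R0 0"
  have a: "0 \<le> a" "0 < N a" using R0 monoD[OF mono, of R0 a] by (auto simp: a_def)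
  have ind: "0 < N (a + real n * K) \<and> (1 + \<epsilon>) ^ n * real (N a) \<le> real (N (a + real n * K))" for n
  proof (induction n)
    case (Suc n)
    have "(1 + \<epsilon>) ^ Suc n * real (N a) \<le> (1 + \<epsilon>) * real (N (a + real n * K))"
      using Suc e by simp
    also have "\<dots> < real (N (a + real n * K + K))" using Suc by (intro grow) simp
    finally have 1: "(1 + \<epsilon>) ^ Suc n * real (N a) < real (N (a + real (Suc n) * K))" by (simp add: algebra_simps)
    moreover have "0 < (1 + \<epsilon>) ^ Suc n * real (N a)" using a e by simp
    ultimately have "0 < real (N (a + real (Suc n) * K))" by linarith
    with 1 show ?case by simp
  qed (use a in simp)
  have "1 \<le> C * (1 + (a + K)) ^ D * (real (Suc n) ^ D / (1 + \<epsilon>) ^ n)" for n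
  proof -
    have "(1 + \<epsilon>) ^ n * 1 \<le> (1 + \<epsilon>) ^ n * real (N a)"
      using a e by (intro mult_left_mono) auto
    also have "\<dots> \<le> real (N (a + real n * K))" using ind by blast
    also have "\<dots> \<le> C * (1 + (a + real n * K)) ^ D" using a K by (intro C) simp
    also have "\<dots> \<le> C * ((1 + (a + K)) * real (Suc n)) ^ D"
    proof (intro mult_left_mono power_mono)
      have "0 \<le> real (N 0)" by simp
      also have "\<dots> \<le> C * (1 + 0) ^ D" by (rule C) simp
      finally show "0 \<le> C" by simp
      show "1 + (a + real n * K) \<le> (1 + (a + K)) * real (Suc n)"
        using a K by (simp add: algebra_simps add_increasing2)
    qed (use a K in simp)
    finally have "(1 + \<epsilon>) ^ n * 1 \<le> C * ((1 + (a + K)) ^ D * real (Suc n) ^ D)"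
      unfolding power_mult_distrib .
    moreover have "0 < (1 + \<epsilon>) ^ n" using e by simp
    ultimately show ?thesis by (simp add: pos_le_divide_eq mult.assoc del: of_nat_Suc)
  qed
  moreover have "(\<lambda>n. C * (1 + (a + K)) ^ D * (real (Suc n) ^ D / (1 + \<epsilon>) ^ n)) \<longlonglongrightarrow> C * (1 + (a + K)) ^ D * 0"
  proof (intro tendsto_mult tendsto_const)
    \<comment> \<open>With the D-th root of \<open>1 + \<epsilon>\<close> the quotient becomes, up
      to the constant r, the D-th power of n / r^n, whose limit is known.\<close>
    define r where "r = root D (1 + \<epsilon>)"
    have r: "1 < r" "r ^ D = 1 + \<epsilon>" using e D by (auto simp: r_def)
    have "(\<lambda>n. real (Suc n) / r ^ Suc n) \<longlonglongrightarrow> 0"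
      using lim_n_over_pown[of r] r(1) by (intro LIMSEQ_Suc) simp
    then have "(\<lambda>n. (r * (real (Suc n) / r ^ Suc n)) ^ D) \<longlonglongrightarrow> (r * 0) ^ D"
      by (intro tendsto_intros)
    moreover have "(r * (real (Suc n) / r ^ Suc n)) ^ D = real (Suc n) ^ D / (1 + \<epsilon>) ^ n" for n
      using r(1) unfolding r(2)[symmetric] by (simp add: power_divide power_commutes flip: power_mult)
    ultimately have "(\<lambda>n. real (Suc n) ^ D / (1 + \<epsilon>) ^ n) \<longlonglongrightarrow> (r * 0) ^ D"
      by (simp only:)
    then show "(\<lambda>n. real (Suc n) ^ D / (1 + \<epsilon>) ^ n) \<longlonglongrightarrow> 0" using D by (simp only: mult_zero_right zero_power)
  qed
  ultimately have "1 \<le> C * (1 + (a + K)) ^ D * 0"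
    by (intro tendsto_lowerbound) (auto intro!: always_eventually)
  then show False by simp
qed

section \<open>Localized Riesz families: decay, local approximation, contradiction\<close>

lemma sum_sq_mult_le:
  fixes a b :: "'i \<Rightarrow> real"
  assumes "(\<Sum>i\<in>I. (a i)\<^sup>2) \<le> C"
  shows "(\<Sum>i\<in>I. a i * b i)\<^sup>2 \<le> C * (\<Sum>i\<in>I. (b i)\<^sup>2)"
  by (rule order.trans[OF Cauchy_Schwarz_ineq_sum]) (intro mult_right_mono assms sum_nonneg, simp)

text \<open>\<open>\<delta>\<close> stands for the distance in phase space. The bound in
  \<open>card_near\<close> is uniform in the centre; the polynomial count of indices enters
  separately, only where it is used.\<close>

locale localized_riesz = riesz_family F A B
  for F :: "'i \<Rightarrow> 'h::real_inner" and A B +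
  fixes \<delta> :: "'i \<Rightarrow> 'i \<Rightarrow> real"
  assumes tri: "\<delta> i k \<le> \<delta> i j + \<delta> j k"
    and card_near: "\<exists>M. \<forall>i. finite {j. \<delta> i j \<le> K} \<and> card {j. \<delta> i j \<le> K} \<le> M"
begin

text \<open>Decay is measured against \<open>F\<close> itself and not against a dual family, because
  inner products with \<open>F\<close> are what localization controls. No rate is recorded, so that
  the notion is stable under uniform limits; the radius \<open>K\<close> must serve all
  \<open>i\<close>.\<close>

definition decaying :: "('i \<Rightarrow> 'h) \<Rightarrow> bool" where
  "decaying h \<longleftrightarrow> (\<forall>\<epsilon>>0. \<exists>K. \<forall>i G. finite G \<and> (\<forall>j\<in>G. K < \<delta> i j) \<longrightarrow> (\<Sum>j\<in>G. (h i \<bullet> F j)\<^sup>2) \<le> \<epsilon>)"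

lemma decayingE:
  assumes "decaying h" "0 < \<epsilon>"
  obtains K where "\<And>i G. finite G \<Longrightarrow> (\<And>j. j \<in> G \<Longrightarrow> K < \<delta> i j) \<Longrightarrow> (\<Sum>j\<in>G. (h i \<bullet> F j)\<^sup>2) \<le> \<epsilon>"
proof -
  have "\<exists>K. \<forall>i G. finite G \<and> (\<forall>j\<in>G. K < \<delta> i j) \<longrightarrow> (\<Sum>j\<in>G. (h i \<bullet> F j)\<^sup>2) \<le> \<epsilon>"
    using assms unfolding decaying_def by simp
  then obtain K where K: "\<forall>i G. finite G \<and> (\<forall>j\<in>G. K < \<delta> i j) \<longrightarrow> (\<Sum>j\<in>G. (h i \<bullet> F j)\<^sup>2) \<le> \<epsilon>" ..
  show thesis
  proof (rule that)
    fix i G assume "finite G" "\<And>j. j \<in> G \<Longrightarrow> K < \<delta> i j"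
    then show "(\<Sum>j\<in>G. (h i \<bullet> F j)\<^sup>2) \<le> \<epsilon>" using K by simp
  qed
qed

definition near :: "real \<Rightarrow> 'i \<Rightarrow> 'i set" where "near K i = {j. \<delta> i j \<le> K}"

lemma finite_near [simp]: "finite (near K i)"
  using card_near[of K] by (auto simp: near_def)

definition frame_step :: "real \<Rightarrow> ('i \<Rightarrow> 'h) \<Rightarrow> 'i \<Rightarrow> 'h" where
  "frame_step K h i = (\<Sum>j\<in>near K i. (h i \<bullet> F j) *\<^sub>R F j)"

text \<open>The truncated frame operator combines boundedly many \<open>F j\<close> with
  \<open>j\<close> near \<open>i\<close>. Each decays away from its own centre, and the triangle
  inequality moves that centre to \<open>i\<close> at the cost of enlarging the radius by
  \<open>K\<close>.\<close>

lemma decaying_frame_step: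
  assumes F: "decaying F" and h: "decaying h" and b: "\<And>i. (norm (h i))\<^sup>2 \<le> M"
  shows "decaying (\<lambda>i. h i - c *\<^sub>R frame_step K h i)"
  unfolding decaying_def
proof (intro allI impI)
  fix \<epsilon> :: real assume e: "0 < \<epsilon>"
  obtain N where N: "\<And>i. card (near K i) \<le> N"
    using card_near[of K] by (auto simp: near_def)
  have M: "0 \<le> M" using order.trans[OF zero_le_power2 b] .
  \<comment> \<open>Apart from the summand 1, which keeps \<open>D\<close> positive, this is the
    factor by which the far mass \<open>\<epsilon>'\<close> of a single \<open>F j\<close> enters
    the estimate.\<close>
  define D where "D = 1 + 2 * c\<^sup>2 * (B * M) * real N"
  have BM: "0 \<le> B * M" using A A_le_B M by simp
  have D: "0 < D" using BM by (auto simp: D_def intro!: add_pos_nonneg)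
  define \<epsilon>' where "\<epsilon>' = \<epsilon> / (2 * D)"
  have e': "0 < \<epsilon>'" using e D by (simp add: \<epsilon>'_def)
  obtain K1 where K1: "\<And>i G. finite G \<Longrightarrow> (\<And>j. j \<in> G \<Longrightarrow> K1 < \<delta> i j) \<Longrightarrow> (\<Sum>j\<in>G. (h i \<bullet> F j)\<^sup>2) \<le> \<epsilon> / 4"
    by (rule decayingE[OF h, of "\<epsilon> / 4"]) (use e in simp, blast)
  obtain K2 where K2: "\<And>i G. finite G \<Longrightarrow> (\<And>j. j \<in> G \<Longrightarrow> K2 < \<delta> i j) \<Longrightarrow> (\<Sum>j\<in>G. (F i \<bullet> F j)\<^sup>2) \<le> \<epsilon>'"
    using decayingE[OF F e'] by blast
  show "\<exists>K'. \<forall>i G. finite G \<and> (\<forall>j\<in>G. K' < \<delta> i j) \<longrightarrow> (\<Sum>j\<in>G. ((h i - c *\<^sub>R frame_step K h i) \<bullet> F j)\<^sup>2) \<le> \<epsilon>"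
  proof (intro exI[of _ "max K1 (K + K2)"] allI impI, elim conjE)
    fix i G assume G: "finite G" and far: "\<forall>j\<in>G. max K1 (K + K2) < \<delta> i j"
    have s: "(frame_step K h i \<bullet> F l)\<^sup>2 \<le> B * M * (\<Sum>j\<in>near K i. (F j \<bullet> F l)\<^sup>2)" for l
    proof -
      have "frame_step K h i \<bullet> F l = (\<Sum>j\<in>near K i. (h i \<bullet> F j) * (F j \<bullet> F l))"
        unfolding frame_step_def by (simp add: inner_sum_left)
      moreover have "(\<Sum>j\<in>near K i. (h i \<bullet> F j)\<^sup>2) \<le> B * M"
        using bessel[of "near K i" "h i"] b[of i] A A_le_B
        by (auto intro: order.trans mult_left_mono)
      ultimately show ?thesis by (simp add: sum_sq_mult_le)
    qed
    have far2: "(\<Sum>l\<in>G. (F j \<bullet> F l)\<^sup>2) \<le> \<epsilon>'" if j: "j \<in> near K i" for j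
    proof (rule K2[OF G])
      fix l assume "l \<in> G"
      with far have "K + K2 < \<delta> i l" by auto
      moreover have "\<delta> i l \<le> K + \<delta> j l" using tri[of i l j] j by (simp add: near_def)
      ultimately show "K2 < \<delta> j l" by simp
    qed
    have "(\<Sum>l\<in>G. (frame_step K h i \<bullet> F l)\<^sup>2) \<le> (\<Sum>l\<in>G. B * M * (\<Sum>j\<in>near K i. (F j \<bullet> F l)\<^sup>2))"
      by (intro sum_mono s)
    also have "\<dots> = B * M * (\<Sum>j\<in>near K i. \<Sum>l\<in>G. (F j \<bullet> F l)\<^sup>2)"
      by (subst sum.swap) (simp add: sum_distrib_left)
    also have "\<dots> \<le> B * M * (\<Sum>j\<in>near K i. \<epsilon>')"
      by (intro mult_left_mono sum_mono far2 BM)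
    also have "\<dots> \<le> B * M * (real N * \<epsilon>')"
      using N[of i] e' BM by (auto intro!: mult_left_mono mult_right_mono)
    finally have 1: "(\<Sum>l\<in>G. (frame_step K h i \<bullet> F l)\<^sup>2) \<le> B * M * (real N * \<epsilon>')" .
    have "(\<Sum>j\<in>G. ((h i - c *\<^sub>R frame_step K h i) \<bullet> F j)\<^sup>2) \<le> (\<Sum>j\<in>G. 2 * (h i \<bullet> F j)\<^sup>2 + 2 * c\<^sup>2 * (frame_step K h i \<bullet> F j)\<^sup>2)"
    proof (rule sum_mono)
      fix j
      have "(x - c * y)\<^sup>2 \<le> 2 * x\<^sup>2 + 2 * c\<^sup>2 * y\<^sup>2" for x y :: real
        using zero_le_power2[of "x + c * y"] by (simp add: power2_eq_square algebra_simps)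
      then show "((h i - c *\<^sub>R frame_step K h i) \<bullet> F j)\<^sup>2 \<le> 2 * (h i \<bullet> F j)\<^sup>2 + 2 * c\<^sup>2 * (frame_step K h i \<bullet> F j)\<^sup>2"
        by (simp add: inner_diff_left)
    qed
    also have "\<dots> = 2 * (\<Sum>j\<in>G. (h i \<bullet> F j)\<^sup>2) + 2 * c\<^sup>2 * (\<Sum>j\<in>G. (frame_step K h i \<bullet> F j)\<^sup>2)"
      by (simp add: sum.distrib sum_distrib_left)
    also have "\<dots> \<le> 2 * (\<epsilon> / 4) + 2 * c\<^sup>2 * (B * M * (real N * \<epsilon>'))"
      using far by (intro add_mono mult_left_mono K1 G 1) auto
    also have "\<dots> \<le> \<epsilon> / 2 + D * \<epsilon>'"
      using e' by (simp add: D_def algebra_simps)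
    also have "\<dots> = \<epsilon>" using D by (simp add: \<epsilon>'_def)
    finally show "(\<Sum>j\<in>G. ((h i - c *\<^sub>R frame_step K h i) \<bullet> F j)\<^sup>2) \<le> \<epsilon>" .
  qed
qed

text \<open>One step of the frame algorithm with a truncated frame operator: the limit would be the dual expansion,
  but the iteration only involves the family itself, so no decay of the dual basis is needed.\<close>

lemma frame_step_contracts:
  assumes tail: "\<And>G. finite G \<Longrightarrow> (\<And>j. j \<in> G \<Longrightarrow> K < \<delta> i j) \<Longrightarrow> (\<Sum>j\<in>G. (h i \<bullet> F j)\<^sup>2) \<le> \<epsilon>"
  shows "(norm (h i - (1 / B) *\<^sub>R frame_step K h i))\<^sup>2 \<le> (1 - A / B) * (norm (h i))\<^sup>2 + \<epsilon> / B"
proof -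
  let ?N = "near K i" and ?S = "frame_step K h i"
  let ?s = "\<Sum>j\<in>?N. (h i \<bullet> F j)\<^sup>2"
  have B: "0 < B" using A A_le_B by simp
  have "A * (norm (h i))\<^sup>2 \<le> ?s + \<epsilon> + e" if e: "0 < e" for e
  proof -
    \<comment> \<open>The frame bound sees almost the whole norm on some finite \<open>G\<close>;
      the part of \<open>G\<close> far from \<open>i\<close> carries at most
      \<open>\<epsilon>\<close>, so the near indices carry the rest.\<close>
    obtain G where G: "finite G" "A * (norm (h i))\<^sup>2 - e \<le> (\<Sum>j\<in>G. (h i \<bullet> F j)\<^sup>2)"
      using frame[OF e] by blast
    have "(\<Sum>j\<in>G. (h i \<bullet> F j)\<^sup>2) = (\<Sum>j\<in>G \<inter> ?N. (h i \<bullet> F j)\<^sup>2) + (\<Sum>j\<in>G - ?N. (h i \<bullet> F j)\<^sup>2)"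
      using sum.Int_Diff[OF G(1)] by blast
    also have "\<dots> \<le> ?s + \<epsilon>"
      using G(1) by (intro add_mono tail sum_mono2) (auto, auto simp: near_def)
    finally show ?thesis using G(2) by simp
  qed
  then have low: "A * (norm (h i))\<^sup>2 \<le> ?s + \<epsilon>" by (rule field_le_epsilon)
  have S1: "h i \<bullet> ?S = ?s"
    unfolding frame_step_def by (simp add: inner_sum_right power2_eq_square)
  have S2: "(norm ?S)\<^sup>2 \<le> B * ?s"
    unfolding frame_step_def by (rule upper) simp
  \<comment> \<open>With step size \<open>1 / B\<close> the quadratic term costs at most half of the
    cross term, by the upper Riesz bound, so the net gain is \<open>?s / B\<close>.\<close>
  have "(norm (h i - (1 / B) *\<^sub>R ?S))\<^sup>2 = (norm (h i))\<^sup>2 - 2 * (1 / B) * (h i \<bullet> ?S) + (1 / B)\<^sup>2 * (norm ?S)\<^sup>2"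
  proof -
    have "(x - c *\<^sub>R y) \<bullet> (x - c *\<^sub>R y) = x \<bullet> x - 2 * c * (x \<bullet> y) + c\<^sup>2 * (y \<bullet> y)" for x y :: 'h and c
      by (simp add: inner_diff_left inner_diff_right inner_commute[of y x] power2_eq_square algebra_simps)
    then show ?thesis unfolding power2_norm_eq_inner .
  qed
  also have "\<dots> \<le> (norm (h i))\<^sup>2 - 2 * (1 / B) * ?s + (1 / B)\<^sup>2 * (B * ?s)"
    unfolding S1 by (intro add_left_mono mult_left_mono S2) simp
  also have "\<dots> = (norm (h i))\<^sup>2 - ?s / B"
    using B by (simp add: power2_eq_square field_simps)
  also have "\<dots> \<le> (norm (h i))\<^sup>2 - (A * (norm (h i))\<^sup>2 - \<epsilon>) / B"
    using low B by (intro diff_left_mono divide_right_mono) auto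
  also have "\<dots> = (1 - A / B) * (norm (h i))\<^sup>2 + \<epsilon> / B"
    by (simp add: algebra_simps diff_divide_distrib)
  finally show ?thesis .
qed

text \<open>The induction passes to the residual of one frame step, with its contracted norm bound
  in place of \<open>M\<close>. Half of \<open>\<epsilon>\<close> pays for the tail cut off in this
  step and half for the remaining steps; earlier errors do not grow because the contraction factor
  is at most 1.\<close>

lemma approx_iterate:
  assumes F: "decaying F"
  shows "decaying h \<Longrightarrow> (\<And>i. (norm (h i))\<^sup>2 \<le> M) \<Longrightarrow> 0 < \<epsilon> \<Longrightarrow>
    \<exists>K. \<forall>i. \<exists>v\<in>span (F ` near K i). (norm (h i - v))\<^sup>2 \<le> (1 - A / B) ^ n * M + \<epsilon>"
proof (induction n arbitrary: h M \<epsilon>)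
  case 0
  show ?case
    by (intro exI[of _ 0] allI bexI[of _ 0]) (use 0 in \<open>auto intro: order.trans add_increasing2 span_zero\<close>)
next
  case (Suc n)
  let ?q = "1 - A / B"
  have B: "0 < B" using A A_le_B by simp
  have q: "0 \<le> ?q" "?q \<le> 1" using A_le_B A B by (auto simp: field_simps)
  obtain K where K: "\<And>i G. finite G \<Longrightarrow> (\<And>j. j \<in> G \<Longrightarrow> K < \<delta> i j) \<Longrightarrow> (\<Sum>j\<in>G. (h i \<bullet> F j)\<^sup>2) \<le> B * (\<epsilon> / 2)"
    by (rule decayingE[OF Suc.prems(1), of "B * (\<epsilon> / 2)"]) (use Suc.prems(3) B in simp, blast)
  let ?h = "\<lambda>i. h i - (1 / B) *\<^sub>R frame_step K h i"
  have "(norm (?h i))\<^sup>2 \<le> ?q * M + \<epsilon> / 2" for i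
  proof -
    have "(norm (?h i))\<^sup>2 \<le> ?q * (norm (h i))\<^sup>2 + B * (\<epsilon> / 2) / B"
      by (rule frame_step_contracts) (rule K)
    also have "\<dots> \<le> ?q * M + \<epsilon> / 2"
      using B q Suc.prems(2) by (intro add_mono mult_left_mono) auto
    finally show ?thesis .
  qed
  from Suc.IH[OF decaying_frame_step[OF F Suc.prems(1,2)] this, of "\<epsilon> / 2"] Suc.prems(3)
  obtain K' where K': "\<And>i. \<exists>v\<in>span (F ` near K' i). (norm (?h i - v))\<^sup>2 \<le> ?q ^ n * (?q * M + \<epsilon> / 2) + \<epsilon> / 2"
    by auto
  show ?case
  proof (intro exI[of _ "max K K'"] allI)
    fix i
    obtain v where v: "v \<in> span (F ` near K' i)" "(norm (?h i - v))\<^sup>2 \<le> ?q ^ n * (?q * M + \<epsilon> / 2) + \<epsilon> / 2"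
      using K' by blast
    have near: "F ` near K i \<subseteq> F ` near (max K K') i" "F ` near K' i \<subseteq> F ` near (max K K') i"
      by (auto simp: near_def)
    have "frame_step K h i \<in> span (F ` near K i)"
      unfolding frame_step_def by (intro span_sum span_scale) (auto intro: span_base)
    then have "(1 / B) *\<^sub>R frame_step K h i + v \<in> span (F ` near (max K K') i)"
      using v(1) span_mono[OF near(1)] span_mono[OF near(2)] by (intro span_add span_scale) auto
    moreover have "?q ^ n * (?q * M + \<epsilon> / 2) + \<epsilon> / 2 \<le> ?q ^ Suc n * M + \<epsilon>"
    proof -
      have "?q ^ n * (\<epsilon> / 2) \<le> 1 * (\<epsilon> / 2)"
        by (intro mult_right_mono power_le_one q) (use Suc.prems(3) in simp)
      moreover have "?q ^ n * (?q * M + \<epsilon> / 2) = ?q ^ Suc n * M + ?q ^ n * (\<epsilon> / 2)"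
        by (simp only: distrib_left power_Suc mult_ac)
      ultimately show ?thesis by linarith
    qed
    ultimately show "\<exists>v\<in>span (F ` near (max K K') i). (norm (h i - v))\<^sup>2 \<le> ?q ^ Suc n * M + \<epsilon>"
      using v(2) by (intro bexI[of _ "(1 / B) *\<^sub>R frame_step K h i + v"]) (auto simp: algebra_simps)
  qed
qed

text \<open>The number of steps is fixed by the contraction factor before any tail is cut off. Hence
  finitely many truncations suffice, and their radius does not depend on \<open>i\<close>.\<close>

lemma decaying_imp_approx:
  assumes F: "decaying F" and h: "decaying h" and b: "\<And>i. (norm (h i))\<^sup>2 \<le> M" and e: "0 < \<epsilon>"
  shows "\<exists>K. \<forall>i. \<exists>v\<in>span (F ` near K i). (norm (h i - v))\<^sup>2 \<le> \<epsilon>"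
proof -
  have B: "0 < B" using A A_le_B by simp
  have "(\<lambda>n. (1 - A / B) ^ n * M) \<longlonglongrightarrow> 0 * M"
    using A_le_B A B by (intro tendsto_intros LIMSEQ_power_zero) (auto simp: field_simps abs_if)
  then have "eventually (\<lambda>n. (1 - A / B) ^ n * M < \<epsilon> / 2) sequentially"
    by (rule order_tendstoD(2)) (use e in simp)
  then obtain n where n: "(1 - A / B) ^ n * M < \<epsilon> / 2" by (auto simp: eventually_sequentially)
  obtain K where K: "\<And>i. \<exists>v\<in>span (F ` near K i). (norm (h i - v))\<^sup>2 \<le> (1 - A / B) ^ n * M + \<epsilon> / 2"
    using approx_iterate[OF F h b, of "\<epsilon> / 2" n] e by auto
  show ?thesis
  proof (intro exI[of _ K] allI)
    fix i
    obtain v where v: "v \<in> span (F ` near K i)" "(norm (h i - v))\<^sup>2 \<le> (1 - A / B) ^ n * M + \<epsilon> / 2"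
      using K by blast
    show "\<exists>v\<in>span (F ` near K i). (norm (h i - v))\<^sup>2 \<le> \<epsilon>"
      by (rule bexI[OF _ v(1)]) (use v(2) n in linarith)
  qed
qed

text \<open>Sum over dyadic shells: shell k has O(2^(k D)) indices and each term is O(2^(-2 k
  \<sigma>)), so the shells are dominated by a geometric series with ratio
  \<open>2 powr (D - 2 \<sigma>)\<close>. This is where the dimension of phase space meets the
  exponent of the weight.\<close>

lemma decaying_powr:
  assumes card: "\<And>K i. 0 \<le> K \<Longrightarrow> real (card (near K i)) \<le> C * (1 + K) ^ D" and C: "0 \<le> C"
    and \<sigma>: "real D < 2 * \<sigma>" and b: "\<And>i j. \<delta> i j powr \<sigma> * \<bar>h i \<bullet> F j\<bar> \<le> c"
  shows "decaying h"
  unfolding decaying_def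
proof (intro allI impI)
  fix \<epsilon> :: real assume e: "0 < \<epsilon>"
  define \<rho> where "\<rho> = 2 powr (real D - 2 * \<sigma>)"
  \<comment> \<open>Shell k lies within radius \<open>2 q\<close> for \<open>q = 2 ^ k\<close>, and
    \<open>1 + 2 q \<le> 4 q\<close>; hence the power of 4.\<close>
  define M where "M = C * 4 ^ D * c\<^sup>2"
  have s0: "0 < \<sigma>" using \<sigma> by (smt (verit) of_nat_0_le_iff)
  have M: "0 \<le> M" using C by (simp add: M_def)
  have \<rho>: "0 < \<rho>" "\<rho> < 1"
  proof -
    show "0 < \<rho>" by (simp add: \<rho>_def)
    have "\<rho> < 2 powr 0" unfolding \<rho>_def using \<sigma> by (intro powr_less_mono) auto
    then show "\<rho> < 1" by simp
  qed
  have "summable (\<lambda>k. \<rho> ^ k)" using \<rho> by (intro summable_geometric) simp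
  \<comment> \<open>The cutoff makes every later block of the series small. \<open>M + 1\<close>
    replaces \<open>M\<close>, which may be 0.\<close>
  then obtain k0 where k0: "\<And>m n. k0 \<le> m \<Longrightarrow> norm (sum (\<lambda>k. \<rho> ^ k) {m..<n}) < \<epsilon> / (M + 1)"
    using M e unfolding summable_Cauchy by (metis add_nonneg_pos divide_pos_pos zero_less_one)
  show "\<exists>K. \<forall>i G. finite G \<and> (\<forall>j\<in>G. K < \<delta> i j) \<longrightarrow> (\<Sum>j\<in>G. (h i \<bullet> F j)\<^sup>2) \<le> \<epsilon>"
  proof (intro exI[of _ "2 ^ k0"] allI impI, elim conjE)
    fix i G assume G: "finite G" and far: "\<forall>j\<in>G. 2 ^ k0 < \<delta> i j"
    have "\<exists>k. 2 ^ k < \<delta> i j \<and> \<delta> i j \<le> 2 ^ Suc k" if "j \<in> G" for j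
    proof -
      have "1 < \<delta> i j" using far that by (metis le_less_trans one_le_power one_le_numeral)
      then show ?thesis by (rule dyadic_interval) blast
    qed
    then have "\<exists>\<kappa>. \<forall>j\<in>G. 2 ^ \<kappa> j < \<delta> i j \<and> \<delta> i j \<le> 2 ^ Suc (\<kappa> j)" by (intro bchoice ballI)
    then obtain \<kappa> where \<kappa>: "\<forall>j\<in>G. 2 ^ \<kappa> j < \<delta> i j \<and> \<delta> i j \<le> 2 ^ Suc (\<kappa> j)" ..
    have kk: "k0 \<le> \<kappa> j" if "j \<in> G" for j
    proof -
      have "(2::real) ^ k0 < 2 ^ Suc (\<kappa> j)" using far \<kappa> that by (metis less_le_trans)
      then have "k0 < Suc (\<kappa> j)" by (simp only: power_strict_increasing_iff[of "2::real"] one_less_numeral_iff semiring_norm)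
      then show ?thesis by simp
    qed
    have layer: "(\<Sum>j | j \<in> G \<and> \<kappa> j = k. (h i \<bullet> F j)\<^sup>2) \<le> M * \<rho> ^ k" for k
    proof -
      let ?G = "{j \<in> G. \<kappa> j = k}"
      define q where "q = (2::real) ^ k"
      have q: "1 \<le> q" by (simp add: q_def)
      have trm: "(h i \<bullet> F j)\<^sup>2 \<le> c\<^sup>2 / (q powr \<sigma>)\<^sup>2" if j: "j \<in> ?G" for j
      proof -
        have "q powr \<sigma> \<le> \<delta> i j powr \<sigma>" using \<kappa> j s0 q by (intro powr_mono2) (auto simp: q_def)
        then have "q powr \<sigma> * \<bar>h i \<bullet> F j\<bar> \<le> \<delta> i j powr \<sigma> * \<bar>h i \<bullet> F j\<bar>" by (intro mult_right_mono) auto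
        also have "\<dots> \<le> c" by (rule b)
        finally have "(q powr \<sigma> * \<bar>h i \<bullet> F j\<bar>)\<^sup>2 \<le> c\<^sup>2" by (rule power_mono) simp
        moreover have "0 < (q powr \<sigma>)\<^sup>2" using q by simp
        ultimately show ?thesis by (simp add: pos_le_divide_eq power_mult_distrib mult.commute)
      qed
      have "?G \<subseteq> near (2 * q) i" using \<kappa> by (auto simp: near_def q_def)
      then have "real (card ?G) \<le> real (card (near (2 * q) i))" by (simp add: card_mono)
      also have "\<dots> \<le> C * (1 + 2 * q) ^ D" using q by (intro card) simp
      also have "\<dots> \<le> C * (4 * q) ^ D" using q C by (intro mult_left_mono power_mono) auto
      finally have cG: "real (card ?G) \<le> C * (4 * q) ^ D" .
      have "(\<Sum>j\<in>?G. (h i \<bullet> F j)\<^sup>2) \<le> (\<Sum>j\<in>?G. c\<^sup>2 / (q powr \<sigma>)\<^sup>2)"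
        by (intro sum_mono trm)
      also have "\<dots> = real (card ?G) * (c\<^sup>2 / (q powr \<sigma>)\<^sup>2)" by simp
      also have "\<dots> \<le> C * (4 * q) ^ D * (c\<^sup>2 / (q powr \<sigma>)\<^sup>2)"
        by (intro mult_right_mono cG) simp
      also have "\<dots> = M * (q ^ D / (q powr \<sigma>)\<^sup>2)"
        by (simp add: M_def power_mult_distrib mult_ac)
      also have "q ^ D / (q powr \<sigma>)\<^sup>2 = \<rho> ^ k"
      proof -
        have "q ^ D / (q powr \<sigma>)\<^sup>2 = q powr (real D) / q powr (2 * \<sigma>)"
          using q by (simp add: powr_sq powr_realpow)
        also have "\<dots> = q powr (real D - 2 * \<sigma>)" by (simp add: powr_diff)
        also have "\<dots> = (2 powr real k) powr (real D - 2 * \<sigma>)" by (simp add: q_def powr_realpow)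
        also have "\<dots> = \<rho> powr real k" by (simp add: \<rho>_def powr_powr mult.commute)
        also have "\<dots> = \<rho> ^ k" using \<rho> by (simp add: powr_realpow)
        finally show ?thesis .
      qed
      finally show ?thesis .
    qed
    obtain L where L: "\<kappa> ` G \<subseteq> {..<L}"
      using finite_nat_bounded[of "\<kappa> ` G"] G by auto
    have "(\<Sum>j\<in>G. (h i \<bullet> F j)\<^sup>2) = (\<Sum>k\<in>\<kappa> ` G. \<Sum>j | j \<in> G \<and> \<kappa> j = k. (h i \<bullet> F j)\<^sup>2)"
      by (rule sum.image_gen[OF G])
    also have "\<dots> \<le> (\<Sum>k\<in>\<kappa> ` G. M * \<rho> ^ k)" by (intro sum_mono layer)
    also have "\<dots> \<le> (\<Sum>k\<in>{k0..<L}. M * \<rho> ^ k)"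
      using L kk M \<rho>(1) by (intro sum_mono2) (auto simp: subset_iff)
    also have "\<dots> = M * sum (\<lambda>k. \<rho> ^ k) {k0..<L}" by (simp add: sum_distrib_left)
    also have "\<dots> \<le> M * (\<epsilon> / (M + 1))"
      using k0[of k0 L] M by (intro mult_left_mono) auto
    also have "\<dots> \<le> \<epsilon>" using M e by (simp add: field_simps)
    finally show "(\<Sum>j\<in>G. (h i \<bullet> F j)\<^sup>2) \<le> \<epsilon>" .
  qed
qed

text \<open>\<open>bessel\<close> bounds the coefficients of the error \<open>h i - h' i\<close> on
  every finite index set at once, so a uniformly small error perturbs all tails by a small
  amount.\<close>

lemma decaying_limit:
  assumes "\<And>\<epsilon>. 0 < \<epsilon> \<Longrightarrow> \<exists>h'. decaying h' \<and> (\<forall>i. (norm (h i - h' i))\<^sup>2 \<le> \<epsilon>)"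
  shows "decaying h"
  unfolding decaying_def
proof (intro allI impI)
  fix \<epsilon> :: real assume e: "0 < \<epsilon>"
  have B: "0 < B" using A A_le_B by simp
  obtain h' where h': "decaying h'" "\<And>i. (norm (h i - h' i))\<^sup>2 \<le> \<epsilon> / (4 * B)"
    using assms[of "\<epsilon> / (4 * B)"] e B by auto
  have e4: "0 < \<epsilon> / 4" using e by simp
  obtain K where
    K: "\<And>i G. finite G \<Longrightarrow> (\<And>j. j \<in> G \<Longrightarrow> K < \<delta> i j) \<Longrightarrow> (\<Sum>j\<in>G. (h' i \<bullet> F j)\<^sup>2) \<le> \<epsilon> / 4"
    using decayingE[OF h'(1) e4] by blast
  show "\<exists>K. \<forall>i G. finite G \<and> (\<forall>j\<in>G. K < \<delta> i j) \<longrightarrow> (\<Sum>j\<in>G. (h i \<bullet> F j)\<^sup>2) \<le> \<epsilon>"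
  proof (intro exI[of _ K] allI impI, elim conjE)
    fix i G assume G: "finite G" and far: "\<forall>j\<in>G. K < \<delta> i j"
    have "(\<Sum>j\<in>G. (h i \<bullet> F j)\<^sup>2) \<le> (\<Sum>j\<in>G. 2 * ((h i - h' i) \<bullet> F j)\<^sup>2 + 2 * (h' i \<bullet> F j)\<^sup>2)"
    proof (rule sum_mono)
      fix j
      have "x\<^sup>2 \<le> 2 * (x - y)\<^sup>2 + 2 * y\<^sup>2" for x y :: real
        using zero_le_power2[of "x - 2 * y"] by (simp add: power2_eq_square algebra_simps)
      then show "(h i \<bullet> F j)\<^sup>2 \<le> 2 * ((h i - h' i) \<bullet> F j)\<^sup>2 + 2 * (h' i \<bullet> F j)\<^sup>2"
        by (simp add: inner_diff_left)
    qed
    also have "\<dots> = 2 * (\<Sum>j\<in>G. ((h i - h' i) \<bullet> F j)\<^sup>2) + 2 * (\<Sum>j\<in>G. (h' i \<bullet> F j)\<^sup>2)"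
      by (simp add: sum.distrib sum_distrib_left)
    also have "\<dots> \<le> 2 * (B * (\<epsilon> / (4 * B))) + 2 * (\<epsilon> / 4)"
      using far B by (intro add_mono mult_left_mono K G order.trans[OF bessel[OF G]] h') auto
    also have "\<dots> = \<epsilon>" using B by simp
    finally show "(\<Sum>j\<in>G. (h i \<bullet> F j)\<^sup>2) \<le> \<epsilon>" .
  qed
qed

text \<open>In the application \<open>y i\<close> is a coordinate times \<open>F i\<close>,
  \<open>h i\<close> is the same with the coordinate centred at \<open>i\<close>, and
  \<open>p\<close>, \<open>p'\<close> are difference quotients with opposite increments. The
  difference \<open>y i - h i\<close> lies in the span of elements at distance 0. Since
  \<open>p\<close> and \<open>p'\<close> may depend on \<open>\<eta>\<close> and \<open>R\<close>,
  the increment can be chosen after the finite set.\<close>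

theorem no_localized_commutation:
  fixes h y :: "'i \<Rightarrow> 'h" and Ball :: "real \<Rightarrow> 'i set"
  assumes ball_mono: "\<And>R R'. R \<le> R' \<Longrightarrow> Ball R \<subseteq> Ball R'"
    and ball_finite: "\<And>R. finite (Ball R)"
    and ball_nonempty: "Ball R0 \<noteq> {}"
    and ball_card: "\<And>R. 0 \<le> R \<Longrightarrow> real (card (Ball R)) \<le> C * (1 + R) ^ D" and D: "0 < D"
    and ball_near: "\<And>i R K. i \<in> Ball R \<Longrightarrow> near K i \<subseteq> Ball (R + K)"
    and decF: "decaying F" and dech: "decaying h" and bh: "\<And>i. (norm (h i))\<^sup>2 \<le> M"
    and yh: "\<And>i. y i - h i \<in> span (F ` near 0 i)"
    and sym: "\<And>i j. y i \<bullet> F j = F i \<bullet> y j"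
    and comm: "\<And>\<eta> R. 0 < \<eta> \<Longrightarrow> \<exists>p p'. (\<forall>i j. p i \<bullet> F j = - (F i \<bullet> p' j)) \<and>
       (\<forall>i\<in>Ball R. \<forall>j\<in>Ball R. \<bar>p i \<bullet> y j + y i \<bullet> p' j - F i \<bullet> F j\<bar> \<le> \<eta>) \<and>
       (\<forall>i. \<exists>v\<in>span (F ` near 0 i). (norm (p i - v))\<^sup>2 \<le> M) \<and>
       (\<forall>i. \<exists>v\<in>span (F ` near 0 i). (norm (p' i - v))\<^sup>2 \<le> M)"
  shows False
proof -
  have M: "0 \<le> M" using order.trans[OF zero_le_power2 bh] .
  \<comment> \<open>Chosen so that the right side of the trace bound comes out as at most n / 4,
    against n / 2 on the left.\<close>
  define \<epsilon> where "\<epsilon> = A\<^sup>2 / (64 * (1 + M)\<^sup>2)"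
  have e: "0 < \<epsilon>" using A M by (simp add: \<epsilon>_def)
  obtain K1 where K1: "\<And>i. \<exists>v\<in>span (F ` near K1 i). (norm (h i - v))\<^sup>2 \<le> \<epsilon>"
    using decaying_imp_approx[OF decF dech bh e] by blast
  define K where "K = max K1 0"
  obtain R where R: "0 < card (Ball R)" "real (card (Ball (R + K))) \<le> (1 + \<epsilon>) * real (card (Ball R))"
    using Folner_radius[of "\<lambda>R. card (Ball R)" R0 C D \<epsilon> K] ball_mono ball_finite ball_nonempty ball_card D e
    by (auto simp: mono_def card_mono card_gt_0_iff)
  \<comment> \<open>Every index of \<open>Ball R\<close> has its \<open>K\<close>-neighbours in
    \<open>I\<close>, so there the distance of \<open>y i\<close> to the span is small. On the
    boundary layer only the bound \<open>M\<close> holds, but by the choice of \<open>R\<close> the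
    layer has at most \<open>\<epsilon> n\<close> elements.\<close>
  define I where "I = Ball (R + K)"
  have I: "finite I" by (simp add: I_def ball_finite)
  have sub: "Ball R \<subseteq> I" unfolding I_def by (rule ball_mono) (simp add: K_def)
  define n where "n = real (card I)"
  have nR: "real (card (Ball R)) \<le> n" unfolding n_def using card_mono[OF I sub] by simp
  then have n: "0 < n" using R(1) by simp
  have near0: "span (F ` near 0 i) \<subseteq> span (F ` I)" if "i \<in> I" for i
    using ball_near[of i "R + K" 0] that by (intro span_mono image_mono) (simp add: I_def)
  define dy where "dy i = (if i \<in> Ball R then \<epsilon> else M)" for i
  have dy: "\<exists>v\<in>span (F ` I). (norm (y i - v))\<^sup>2 \<le> dy i" if i: "i \<in> I" for i
  proof (cases "i \<in> Ball R")
    case True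
    obtain v where v: "v \<in> span (F ` near K1 i)" "(norm (h i - v))\<^sup>2 \<le> \<epsilon>" using K1 by blast
    have "near K1 i \<subseteq> near K i" by (auto simp: near_def K_def)
    then have "near K1 i \<subseteq> I" using ball_near[OF True, of K] by (auto simp: I_def)
    then have "span (F ` near K1 i) \<subseteq> span (F ` I)" by (intro span_mono image_mono)
    then have "v \<in> span (F ` I)" using v(1) by (rule set_mp)
    then show ?thesis
      using yh[of i] near0[OF i] v(2) True
      by (intro bexI[of _ "(y i - h i) + v"] span_add) (auto simp: dy_def)
  next
    case False
    then show ?thesis
      using yh[of i] near0[OF i] bh[of i] by (intro bexI[of _ "y i - h i"]) (auto simp: dy_def)
  qed
  \<comment> \<open>With this commutator error the loss on the left of the trace bound is exactly n
    / 2.\<close>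
  have eta: "0 < A / (2 * n)" using A n by simp
  obtain p p' where pp: "(\<forall>i j. p i \<bullet> F j = - (F i \<bullet> p' j)) \<and>
       (\<forall>i\<in>I. \<forall>j\<in>I. \<bar>p i \<bullet> y j + y i \<bullet> p' j - F i \<bullet> F j\<bar> \<le> A / (2 * n)) \<and>
       (\<forall>i. \<exists>v\<in>span (F ` near 0 i). (norm (p i - v))\<^sup>2 \<le> M) \<and>
       (\<forall>i. \<exists>v\<in>span (F ` near 0 i). (norm (p' i - v))\<^sup>2 \<le> M)"
    using comm[OF eta, of "R + K"] unfolding I_def[symmetric] by (elim exE)
  have p: "\<And>i j. p i \<bullet> F j = - (F i \<bullet> p' j)"
      "\<And>i j. i \<in> I \<Longrightarrow> j \<in> I \<Longrightarrow> \<bar>p i \<bullet> y j + y i \<bullet> p' j - F i \<bullet> F j\<bar> \<le> A / (2 * n)"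
      "\<And>i. \<exists>v\<in>span (F ` near 0 i). (norm (p i - v))\<^sup>2 \<le> M"
      "\<And>i. \<exists>v\<in>span (F ` near 0 i). (norm (p' i - v))\<^sup>2 \<le> M"
    using pp by simp_all
  have "real (card I) - A / (2 * n) * (real (card I))\<^sup>2 / A \<le> 2 / A * sqrt (\<Sum>i\<in>I. dy i) * sqrt (real (card I) * M)"
  proof (rule trace_bound[OF I _ sym p(1) p(2) dy])
    show "0 \<le> A / (2 * n)" using eta by simp
    show "\<exists>v\<in>span (F ` I). (norm (p i - v))\<^sup>2 \<le> M" if "i \<in> I" for i
      using p(3)[of i] near0[OF that] by blast
    show "\<exists>v\<in>span (F ` I). (norm (p' i - v))\<^sup>2 \<le> M" if "i \<in> I" for i
      using p(4)[of i] near0[OF that] by blast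
  qed
  also have "real (card I) - A / (2 * n) * (real (card I))\<^sup>2 / A = n / 2"
    using A n by (simp add: n_def[symmetric] power2_eq_square)
  also have "2 / A * sqrt (\<Sum>i\<in>I. dy i) * sqrt (real (card I) * M) \<le> n / 4"
  proof -
    have "(\<Sum>i\<in>I. dy i) = (\<Sum>i\<in>Ball R. dy i) + (\<Sum>i\<in>I - Ball R. dy i)"
      using sum.subset_diff[OF sub I, of dy] by (simp add: add.commute)
    also have "\<dots> = \<epsilon> * real (card (Ball R)) + M * real (card (I - Ball R))"
      by (simp add: dy_def)
    also have "real (card (I - Ball R)) = n - real (card (Ball R))"
      using card_Diff_subset[OF ball_finite sub] card_mono[OF I sub] by (simp add: n_def of_nat_diff)
    also have "\<epsilon> * real (card (Ball R)) + M * (n - real (card (Ball R))) \<le> \<epsilon> * n + M * (\<epsilon> * n)"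
    proof (intro add_mono mult_left_mono)
      have "n - real (card (Ball R)) \<le> \<epsilon> * real (card (Ball R))"
        using R(2) by (simp add: n_def I_def algebra_simps)
      also have "\<dots> \<le> \<epsilon> * n" using nR e by simp
      finally show "n - real (card (Ball R)) \<le> \<epsilon> * n" .
    qed (use nR e M in auto)
    finally have "(\<Sum>i\<in>I. dy i) \<le> \<epsilon> * (1 + M) * n" by (simp add: algebra_simps)
    then have "sqrt (\<Sum>i\<in>I. dy i) * sqrt (real (card I) * M) \<le> sqrt (\<epsilon> * (1 + M) * n) * sqrt (n * (1 + M))"
      using n M e by (intro mult_mono real_sqrt_le_mono) (auto simp: n_def[symmetric])
    also have "\<dots> = sqrt ((A * n / 8)\<^sup>2)"
    proof -
      have "A\<^sup>2 / (64 * q\<^sup>2) * q * n * (n * q) = (A * n / 8)\<^sup>2" if "0 < q" for q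
        using that by (simp add: field_simps power2_eq_square)
      from this[of "1 + M"] M show ?thesis
        unfolding real_sqrt_mult[symmetric] \<epsilon>_def by simp
    qed
    also have "\<dots> = A * n / 8" using A n by simp
    finally have "2 / A * (sqrt (\<Sum>i\<in>I. dy i) * sqrt (real (card I) * M)) \<le> 2 / A * (A * n / 8)"
      using A by (intro mult_left_mono) auto
    then show ?thesis using A by (simp add: mult.assoc)
  qed
  finally show False using n by simp
qed

end

subsection \<open>The space $L^2$ as a real inner product space\<close>

lemma sq_int_measurable [measurable_dest]: "sq_int f \<Longrightarrow> f \<in> borel_measurable lborel"
  by (simp add: sq_int_def)

lemma sq_int_integrable: "sq_int f \<Longrightarrow> integrable lborel (\<lambda>x. (cmod (f x))\<^sup>2)"
  by (simp add: sq_int_def)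

lemma sq_int_bound:
  assumes "f \<in> borel_measurable lborel" "integrable lborel g" "AE x in lborel. (cmod (f x))\<^sup>2 \<le> g x"
  shows "sq_int f"
proof -
  have "integrable lborel (\<lambda>x. (cmod (f x))\<^sup>2)"
    by (rule Bochner_Integration.integrable_bound[OF assms(2)]) (use assms in auto)
  then show ?thesis using assms by (simp add: sq_int_def)
qed

lemma borel_measurable_cnj [measurable (raw)]:
  "f \<in> borel_measurable M \<Longrightarrow> (\<lambda>x. cnj (f x)) \<in> borel_measurable M"
  by (erule measurable_compose) (intro borel_measurable_continuous_onI continuous_intros)

lemma cmod_add_sq: "(cmod (a + b))\<^sup>2 \<le> 2 * (cmod a)\<^sup>2 + 2 * (cmod b)\<^sup>2"
proof -
  have "(cmod (a + b))\<^sup>2 \<le> (cmod a + cmod b)\<^sup>2"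
    by (intro power_mono norm_triangle_ineq) auto
  also have "\<dots> \<le> 2 * (cmod a)\<^sup>2 + 2 * (cmod b)\<^sup>2"
    using sum_squares_bound[of "cmod a" "cmod b"] by (simp add: power2_sum)
  finally show ?thesis .
qed

lemma sq_int_add [intro]:
  assumes "sq_int f" "sq_int g" shows "sq_int (\<lambda>x. f x + g x)"
proof (rule sq_int_bound)
  show "integrable lborel (\<lambda>x. 2 * (cmod (f x))\<^sup>2 + 2 * (cmod (g x))\<^sup>2)"
    using assms by (auto simp: sq_int_def)
qed (use assms cmod_add_sq in \<open>auto simp: sq_int_def\<close>)

lemma sq_int_mult [intro]:
  assumes "sq_int f" shows "sq_int (\<lambda>x. c * f x)"
proof (rule sq_int_bound)
  show "integrable lborel (\<lambda>x. (cmod c)\<^sup>2 * (cmod (f x))\<^sup>2)"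
    using assms by (auto simp: sq_int_def)
qed (use assms in \<open>auto simp: sq_int_def norm_mult power_mult_distrib\<close>)

lemma sq_int_zero [simp, intro]: "sq_int (\<lambda>x. 0)"
  by (simp add: sq_int_def)

lemma sq_int_diff [intro]:
  assumes "sq_int f" "sq_int g" shows "sq_int (\<lambda>x. f x - g x)"
  using sq_int_add[OF assms(1) sq_int_mult[OF assms(2), of "-1"]] by simp

lemma sq_int_uminus [intro]: "sq_int f \<Longrightarrow> sq_int (\<lambda>x. - f x)"
  using sq_int_mult[of f "-1"] by simp

lemma sq_int_scaleR [intro]: "sq_int f \<Longrightarrow> sq_int (\<lambda>x. r *\<^sub>R f x)"
  using sq_int_mult[of f "of_real r"] by (simp add: scaleR_conv_of_real)

lemma sq_int_sum [intro]: "(\<And>i. i \<in> I \<Longrightarrow> sq_int (f i)) \<Longrightarrow> sq_int (\<lambda>x. \<Sum>i\<in>I. f i x)"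
  by (induction I rule: infinite_finite_induct) auto

lemma sq_int_mult_bounded:
  assumes "sq_int f" and [measurable]: "h \<in> borel_measurable lborel" and "\<And>x. cmod (h x) \<le> C"
  shows "sq_int (\<lambda>x. h x * f x)"
proof (rule sq_int_bound)
  show "integrable lborel (\<lambda>x. C\<^sup>2 * (cmod (f x))\<^sup>2)"
    using assms by (auto simp: sq_int_def)
qed (use assms in \<open>auto simp: sq_int_def norm_mult power_mult_distrib intro!: mult_right_mono power_mono\<close>)

lemma integrable_sq_int_mult:
  assumes "sq_int f" "sq_int g" shows "integrable lborel (\<lambda>x. f x * cnj (g x))"
proof (rule Bochner_Integration.integrable_bound)
  show "integrable lborel (\<lambda>x. (cmod (f x))\<^sup>2 + (cmod (g x))\<^sup>2)"
    using assms by (auto simp: sq_int_def)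
  have "cmod a * cmod b \<le> (cmod a)\<^sup>2 + (cmod b)\<^sup>2" for a b
    using sum_squares_bound[of "cmod a" "cmod b"] mult_nonneg_nonneg[OF norm_ge_zero norm_ge_zero, of a b]
    by linarith
  then show "AE x in lborel. norm (f x * cnj (g x)) \<le> norm ((cmod (f x))\<^sup>2 + (cmod (g x))\<^sup>2)"
    by (simp add: norm_mult)
qed (use assms in \<open>auto simp: sq_int_def intro!: borel_measurable_times borel_measurable_cnj\<close>)

text \<open>A partial equivalence: only square integrable functions are related to themselves, so
  the quotient consists of genuine classes and nothing else.\<close>

definition l2rel :: "('a::euclidean_space \<Rightarrow> complex) \<Rightarrow> ('a \<Rightarrow> complex) \<Rightarrow> bool" where
  "l2rel f g \<longleftrightarrow> sq_int f \<and> sq_int g \<and> (AE x in lborel. f x = g x)"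

quotient_type (overloaded) 'a l2 = "'a::euclidean_space \<Rightarrow> complex" / partial: l2rel
proof (rule part_equivpI)
  show "\<exists>x. l2rel x x" by (rule exI[of _ "\<lambda>x. 0"]) (simp add: l2rel_def)
  show "symp l2rel"
    by (intro sympI) (auto simp: l2rel_def elim: eventually_mono)
  show "transp l2rel"
    by (rule transpI) (auto simp: l2rel_def elim: eventually_elim2)
qed

text \<open>Functions that are not square integrable are sent to \<open>0\<close>.\<close>

lift_definition l2_of :: "('a::euclidean_space \<Rightarrow> complex) \<Rightarrow> 'a l2"
  is "\<lambda>f. if sq_int f then f else (\<lambda>x. 0)"
  by (auto simp: l2rel_def)

instantiation l2 :: (euclidean_space) real_inner
begin

lift_definition zero_l2 :: "'a l2" is "\<lambda>x. 0" by (simp add: l2rel_def)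
lift_definition plus_l2 :: "'a l2 \<Rightarrow> 'a l2 \<Rightarrow> 'a l2" is "\<lambda>f g x. f x + g x"
  unfolding l2rel_def by (auto elim: eventually_elim2)
lift_definition minus_l2 :: "'a l2 \<Rightarrow> 'a l2 \<Rightarrow> 'a l2" is "\<lambda>f g x. f x - g x"
  unfolding l2rel_def by (auto elim: eventually_elim2)
lift_definition uminus_l2 :: "'a l2 \<Rightarrow> 'a l2" is "\<lambda>f x. - f x"
  unfolding l2rel_def by (auto elim: eventually_mono)
lift_definition scaleR_l2 :: "real \<Rightarrow> 'a l2 \<Rightarrow> 'a l2" is "\<lambda>r f x. r *\<^sub>R f x"
  unfolding l2rel_def by (auto elim: eventually_mono)
text \<open>Taking the real part makes this a real inner product space with the usual norm;
  multiplication by \<open>\<i>\<close> survives only as an isometry.\<close>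

lift_definition inner_l2 :: "'a l2 \<Rightarrow> 'a l2 \<Rightarrow> real" is "\<lambda>f g. Re (\<integral>x. f x * cnj (g x) \<partial>lborel)"
proof -
  fix f f' g g' :: "'a \<Rightarrow> complex" assume a: "l2rel f f'" "l2rel g g'"
  then have "AE x in lborel. f x * cnj (g x) = f' x * cnj (g' x)"
    unfolding l2rel_def by (auto elim: eventually_elim2)
  then show "Re (\<integral>x. f x * cnj (g x) \<partial>lborel) = Re (\<integral>x. f' x * cnj (g' x) \<partial>lborel)"
    using a by (intro arg_cong[where f=Re] integral_cong_AE)
      (auto simp: l2rel_def sq_int_def intro!: borel_measurable_times borel_measurable_cnj)
qed

definition norm_l2 :: "'a l2 \<Rightarrow> real" where "norm_l2 x = sqrt (inner x x)"
definition sgn_l2 :: "'a l2 \<Rightarrow> 'a l2" where "sgn_l2 x = scaleR (inverse (norm x)) x"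
definition dist_l2 :: "'a l2 \<Rightarrow> 'a l2 \<Rightarrow> real" where "dist_l2 x y = norm (x - y)"
definition uniformity_l2 :: "('a l2 \<times> 'a l2) filter"
  where "uniformity_l2 = (INF e\<in>{0<..}. principal {(x, y). dist x y < e})"
definition open_l2 :: "'a l2 set \<Rightarrow> bool"
  where "open_l2 S = (\<forall>x\<in>S. \<forall>\<^sub>F (x', y) in uniformity. x' = x \<longrightarrow> y \<in> S)"

instance
proof
  fix x y z :: "'a l2" and a b :: real
  show "x + y + z = x + (y + z)" by transfer (auto simp: l2rel_def add.assoc)
  show "x + y = y + x" by transfer (auto simp: l2rel_def add.commute)
  show "0 + x = x" by transfer (auto simp: l2rel_def)
  show "- x + x = 0" by transfer (auto simp: l2rel_def)
  show "x - y = x + - y" by transfer (auto simp: l2rel_def)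
  show "a *\<^sub>R (x + y) = a *\<^sub>R x + a *\<^sub>R y" by transfer (auto simp: l2rel_def scaleR_add_right)
  show "(a + b) *\<^sub>R x = a *\<^sub>R x + b *\<^sub>R x" by transfer (auto simp: l2rel_def scaleR_add_left)
  show "a *\<^sub>R b *\<^sub>R x = (a * b) *\<^sub>R x" by transfer (auto simp: l2rel_def)
  show "1 *\<^sub>R x = x" by transfer (auto simp: l2rel_def)
  show "dist x y = norm (x - y)" by (rule dist_l2_def)
  show "sgn x = scaleR (inverse (norm x)) x" by (rule sgn_l2_def)
  show "uniformity = (INF e\<in>{0<..}. principal {(x, y :: 'a l2). dist x y < e})"
    by (rule uniformity_l2_def)
  show "open U = (\<forall>x\<in>U. \<forall>\<^sub>F (x', y) in uniformity. x' = x \<longrightarrow> y \<in> U)" for U :: "'a l2 set"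
    by (rule open_l2_def)
  show "norm x = sqrt (inner x x)" by (rule norm_l2_def)
  show "inner x y = inner y x"
  proof transfer
    fix f g :: "'a \<Rightarrow> complex"
    have "(\<integral>x. g x * cnj (f x) \<partial>lborel) = (\<integral>x. cnj (f x * cnj (g x)) \<partial>lborel)"
      by (simp add: mult.commute)
    also have "\<dots> = cnj (\<integral>x. f x * cnj (g x) \<partial>lborel)"
      by (rule Bochner_Integration.integral_cnj)
    finally show "Re (\<integral>x. f x * cnj (g x) \<partial>lborel) = Re (\<integral>x. g x * cnj (f x) \<partial>lborel)" by simp
  qed
  show "inner (x + y) z = inner x z + inner y z"
    by transfer (auto simp: l2rel_def distrib_right integrable_sq_int_mult)
  show "inner (a *\<^sub>R x) y = a * inner x y"
    by transfer (auto simp: l2rel_def)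
  have *: "Re (\<integral>x. f x * cnj (f x) \<partial>lborel) = (\<integral>x. (cmod (f x))\<^sup>2 \<partial>lborel)" for f :: "'a \<Rightarrow> complex"
    by (simp only: complex_norm_square[symmetric] integral_complex_of_real Re_complex_of_real)
  show "0 \<le> inner x x" by transfer (simp add: *)
  show "(inner x x = 0) = (x = 0)"
    by transfer (subst *, auto simp: l2rel_def sq_int_integrable integral_nonneg_eq_0_iff_AE)
qed

end

lemma l2_of_inner: "sq_int f \<Longrightarrow> sq_int g \<Longrightarrow> l2_of f \<bullet> l2_of g = Re (\<integral>x. f x * cnj (g x) \<partial>lborel)"
  by transfer (simp add: l2rel_def)

lemma l2_of_eq_iff: "sq_int f \<Longrightarrow> sq_int g \<Longrightarrow> l2_of f = l2_of g \<longleftrightarrow> (AE x in lborel. f x = g x)"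
  by transfer (simp add: l2rel_def)

lemma l2_of_zero: "l2_of (\<lambda>x. 0) = 0" by transfer (simp add: l2rel_def)
lemma l2_of_add: "sq_int f \<Longrightarrow> sq_int g \<Longrightarrow> l2_of (\<lambda>x. f x + g x) = l2_of f + l2_of g"
  by transfer (auto simp: l2rel_def)
lemma l2_of_diff: "sq_int f \<Longrightarrow> sq_int g \<Longrightarrow> l2_of (\<lambda>x. f x - g x) = l2_of f - l2_of g"
  by transfer (auto simp: l2rel_def)
lemma l2_of_scaleR: "sq_int f \<Longrightarrow> l2_of (\<lambda>x. r *\<^sub>R f x) = r *\<^sub>R l2_of f"
  by transfer (auto simp: l2rel_def)
lemma l2_of_sum: "(\<And>i. i \<in> I \<Longrightarrow> sq_int (f i)) \<Longrightarrow> l2_of (\<lambda>x. \<Sum>i\<in>I. f i x) = (\<Sum>i\<in>I. l2_of (f i))"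
  by (induction I rule: infinite_finite_induct) (auto simp: l2_of_zero l2_of_add sq_int_sum)
lemma l2_of_surj: "\<exists>f. sq_int f \<and> h = l2_of f"
  by transfer (force simp: l2rel_def)

lemma l2_of_norm_sq: "sq_int f \<Longrightarrow> (norm (l2_of f))\<^sup>2 = (\<integral>x. (cmod (f x))\<^sup>2 \<partial>lborel)"
  by (simp only: power2_norm_eq_inner l2_of_inner complex_norm_square[symmetric] integral_complex_of_real
      Re_complex_of_real)

lemma l2_of_norm: "sq_int f \<Longrightarrow> norm (l2_of f) = L2norm f"
  by (simp add: L2norm_def flip: l2_of_norm_sq)

text \<open>The inequality of the inner product space is applied to the moduli, regarded as complex
  functions.\<close>

lemma Cauchy_Schwarz_integral_cmod:
  assumes "sq_int f" "sq_int g"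
  shows "(\<integral>x. cmod (f x) * cmod (g x) \<partial>lborel) \<le> L2norm f * L2norm g"
proof -
  have sq: "sq_int (\<lambda>x. complex_of_real (cmod (h x)))" if "sq_int h" for h :: "'a \<Rightarrow> complex"
    using that by (auto simp: sq_int_def)
  have n: "L2norm (\<lambda>x. complex_of_real (cmod (h x))) = L2norm h" for h :: "'a \<Rightarrow> complex"
    by (simp add: L2norm_def)
  have "(\<integral>x. cmod (f x) * cmod (g x) \<partial>lborel) =
      Re (\<integral>x. complex_of_real (cmod (f x)) * cnj (complex_of_real (cmod (g x))) \<partial>lborel)"
    by (simp flip: of_real_mult)
  also have "\<dots> = l2_of (\<lambda>x. complex_of_real (cmod (f x))) \<bullet> l2_of (\<lambda>x. complex_of_real (cmod (g x)))"
    by (rule l2_of_inner[symmetric]) (use assms sq in auto)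
  also have "\<dots> \<le> norm (l2_of (\<lambda>x. complex_of_real (cmod (f x)))) * norm (l2_of (\<lambda>x. complex_of_real (cmod (g x))))"
    by (rule norm_cauchy_schwarz)
  finally show ?thesis using assms sq by (simp add: l2_of_norm n)
qed

lemma L2inner_le: 
  assumes "sq_int f" "sq_int g"
  shows "cmod (\<integral>x. f x * cnj (g x) \<partial>lborel) \<le> L2norm f * L2norm g"
proof -
  have "cmod (\<integral>x. f x * cnj (g x) \<partial>lborel) \<le> (\<integral>x. cmod (f x * cnj (g x)) \<partial>lborel)"
    by (rule integral_norm_bound)
  then show ?thesis using Cauchy_Schwarz_integral_cmod[OF assms] by (simp add: norm_mult)
qed

subsection \<open>The Plancherel theorem\<close>

text \<open>The literal integral, meaningful for integrable functions and 0 by convention where the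
  integral diverges. All analysis is done with it; its agreement with \<open>fourier_L2\<close> is
  proved for integrable square integrable functions.\<close>

definition FT :: "('a::euclidean_space \<Rightarrow> complex) \<Rightarrow> 'a \<Rightarrow> complex" where
  "FT f \<xi> = (\<integral>x. f x * cis (- 2 * pi * (x \<bullet> \<xi>)) \<partial>lborel)"

lemma borel_measurable_cis [measurable (raw)]:
  "f \<in> borel_measurable M \<Longrightarrow> (\<lambda>x. cis (f x)) \<in> borel_measurable M"
  by (erule measurable_compose) (intro borel_measurable_continuous_onI continuous_intros)

lemma integrable_mult_cis:
  assumes "integrable lborel f" and [measurable]: "\<theta> \<in> borel_measurable lborel"
  shows "integrable lborel (\<lambda>x. f x * cis (\<theta> x))"
  by (rule Bochner_Integration.integrable_bound[OF assms(1)])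
     (use borel_measurable_integrable[OF assms(1)] in \<open>auto simp: norm_mult\<close>)

lemma FT_measurable [measurable]:
  assumes [measurable]: "f \<in> borel_measurable lborel"
  shows "FT f \<in> borel_measurable lborel"
  unfolding FT_def by measurable

lemma FT_bound: "cmod (FT f \<xi>) \<le> (\<integral>x. cmod (f x) \<partial>lborel)"
  unfolding FT_def by (rule order.trans[OF integral_norm_bound]) (simp add: norm_mult)

lemma FT_mult: "FT (\<lambda>x. c * f x) \<xi> = c * FT f \<xi>"
  unfolding FT_def by (simp add: mult.assoc)

lemma FT_diff:
  assumes "integrable lborel f" "integrable lborel g"
  shows "FT (\<lambda>x. f x - g x) \<xi> = FT f \<xi> - FT g \<xi>"
  unfolding FT_def using assms by (simp add: left_diff_distrib integrable_mult_cis)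

lemma FT_sum:
  assumes "\<And>i. i \<in> I \<Longrightarrow> integrable lborel (f i)"
  shows "FT (\<lambda>x. \<Sum>i\<in>I. f i x) \<xi> = (\<Sum>i\<in>I. FT (f i) \<xi>)"
  unfolding FT_def using assms by (simp add: sum_distrib_right integrable_mult_cis)

lemma integrable_lborel_tensor:
  fixes f g :: "'a::euclidean_space \<Rightarrow> complex"
  assumes f: "integrable lborel f" and g: "integrable lborel g"
    and [measurable]: "\<theta> \<in> borel_measurable (lborel \<Otimes>\<^sub>M lborel)"
  shows "integrable (lborel \<Otimes>\<^sub>M lborel) (\<lambda>(x,y). f x * g y * cis (\<theta> (x, y)))"
proof (rule lborel_pair.Fubini_integrable)
  note [measurable] = borel_measurable_integrable[OF f] borel_measurable_integrable[OF g]
  show "(\<lambda>(x,y). f x * g y * cis (\<theta> (x, y))) \<in> borel_measurable (lborel \<Otimes>\<^sub>M lborel)"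
    by measurable
  show "integrable lborel (\<lambda>x. LBINT y. cmod (case (x, y) of (x, y) \<Rightarrow> f x * g y * cis (\<theta> (x, y))))"
    using f g by (simp add: norm_mult)
  show "AE x in lborel. integrable lborel (\<lambda>y. case (x, y) of (x, y) \<Rightarrow> f x * g y * cis (\<theta> (x, y)))"
  proof (rule AE_I2)
    fix x
    have "integrable lborel (\<lambda>y. f x * (g y * cis (\<theta> (x, y))))"
      by (intro integrable_mult_right integrable_mult_cis g) measurable
    then show "integrable lborel (\<lambda>y. case (x, y) of (x, y) \<Rightarrow> f x * g y * cis (\<theta> (x, y)))"
      by (simp add: mult.assoc)
  qed
qed

text \<open>Fubini, together with the symmetry of the kernel in \<open>x\<close> and
  \<open>\<xi>\<close>.\<close>

lemma FT_multiplication: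
  fixes f g :: "'a::euclidean_space \<Rightarrow> complex"
  assumes f: "integrable lborel f" and g: "integrable lborel g"
  shows "(\<integral>\<xi>. FT f \<xi> * g \<xi> \<partial>lborel) = (\<integral>x. f x * FT g x \<partial>lborel)"
proof -
  have "(\<integral>\<xi>. FT f \<xi> * g \<xi> \<partial>lborel) =
      (\<integral>\<xi>. (\<integral>x. f x * g \<xi> * cis (- 2 * pi * (x \<bullet> \<xi>)) \<partial>lborel) \<partial>lborel)"
    unfolding FT_def by (subst integral_mult_left_zero[symmetric]) (simp add: mult_ac)
  also have "\<dots> = (\<integral>x. (\<integral>\<xi>. f x * g \<xi> * cis (- 2 * pi * (x \<bullet> \<xi>)) \<partial>lborel) \<partial>lborel)"
    using integrable_lborel_tensor[OF f g, of "\<lambda>(x,\<xi>). - 2 * pi * (x \<bullet> \<xi>)"]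
    by (intro lborel_pair.Fubini_integral) (simp add: case_prod_beta)
  also have "\<dots> = (\<integral>x. f x * FT g x \<partial>lborel)"
    unfolding FT_def by (simp add: mult.assoc inner_commute)
  finally show ?thesis .
qed

section \<open>The Gaussian, normalised to be its own Fourier transform\<close>

definition gauss :: "'a::euclidean_space \<Rightarrow> real" where
  "gauss x = exp (- pi * (norm x)\<^sup>2)"

lemma gauss_measurable [measurable]: "gauss \<in> borel_measurable borel"
  unfolding gauss_def by measurable

lemma gauss_pos: "0 < gauss x" and gauss_nonneg [simp]: "0 \<le> gauss x"
  by (simp_all add: gauss_def)

text \<open>The characteristic function of the standard normal distribution after a linear change of
  variable.\<close>

lemma gauss_FT_real:
  fixes u :: real
  shows "(\<integral>t. complex_of_real (exp (- pi * t\<^sup>2)) * cis (- 2 * pi * (t * u)) \<partial>lborel) =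
      complex_of_real (exp (- pi * u\<^sup>2))"
    and "integrable lborel (\<lambda>t. complex_of_real (exp (- pi * t\<^sup>2)) * cis (- 2 * pi * (t * u)))"
proof -
  define s where "s = sqrt (2 * pi)"
  have s: "s > 0" "s * s = 2 * pi" by (auto simp: s_def)
  \<comment> \<open>The frequency for which the substitution x = s t produces the phase -2 pi t
    u.\<close>
  define t0 where "t0 = - s * u"
  let ?g = "\<lambda>x. std_normal_density x *\<^sub>R iexp (t0 * x)"
  have "(\<integral>x. ?g x \<partial>lborel) = char std_normal_distribution t0"
    unfolding char_def by (subst integral_density) auto
  also have "\<dots> = complex_of_real (exp (- (t0^2) / 2))"
    by (simp add: char_std_normal_distribution)
  also have "t0^2 = 2 * pi * u^2" using s(2) by (simp add: t0_def power2_eq_square algebra_simps)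
  finally have 1: "(\<integral>x. ?g x \<partial>lborel) = complex_of_real (exp (- pi * u\<^sup>2))" by simp
  have g: "?g (0 + s * t) = (1 / s) *\<^sub>R (complex_of_real (exp (- pi * t\<^sup>2)) * cis (- 2 * pi * (t * u)))" for t
  proof -
    have "t0 * (s * t) = - (s * s) * (t * u)" by (simp add: t0_def)
    then have "iexp (t0 * (s * t)) = cis (- 2 * pi * (t * u))"
      unfolding cis_conv_exp s(2) by simp
    moreover have "(s * t)\<^sup>2 = 2 * pi * t\<^sup>2" by (simp add: power_mult_distrib power2_eq_square s)
    ultimately show ?thesis
      by (simp add: std_normal_density_def s_def[symmetric] scaleR_conv_of_real)
  qed
  have "integrable std_normal_distribution (\<lambda>x. iexp (t0 * x))"
    by (intro finite_measure.integrable_const_bound[where B=1] prob_space.finite_measure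
        prob_space_normal_density) auto
  then have i: "integrable lborel ?g"
    by (subst (asm) integrable_density) auto
  have "integrable lborel (\<lambda>t. ?g (0 + s * t))"
    by (rule lborel_integrable_real_affine[OF i]) (use s in auto)
  then have "integrable lborel (\<lambda>t. s *\<^sub>R ?g (0 + s * t))" by (rule integrable_scaleR_right)
  then show "integrable lborel (\<lambda>t. complex_of_real (exp (- pi * t\<^sup>2)) * cis (- 2 * pi * (t * u)))"
    unfolding g using s by simp
  have "(\<integral>x. ?g x \<partial>lborel) = \<bar>s\<bar> *\<^sub>R (\<integral>t. ?g (0 + s * t) \<partial>lborel)"
    by (rule lborel_integral_real_affine) (use s in auto)
  also have "\<dots> = (\<integral>t. complex_of_real (exp (- pi * t\<^sup>2)) * cis (- 2 * pi * (t * u)) \<partial>lborel)"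
    unfolding g using s by simp
  finally show "(\<integral>t. complex_of_real (exp (- pi * t\<^sup>2)) * cis (- 2 * pi * (t * u)) \<partial>lborel) =
      complex_of_real (exp (- pi * u\<^sup>2))" using 1 by simp
qed

lemma cis_sum: "finite A \<Longrightarrow> cis (\<Sum>i\<in>A. f i) = (\<Prod>i\<in>A. cis (f i))"
  by (induction A rule: finite_induct) (auto simp flip: cis_mult)

lemma norm_sq_Basis: "(norm (x::'a::euclidean_space))\<^sup>2 = (\<Sum>b\<in>Basis. (x \<bullet> b)\<^sup>2)"
  by (subst power2_norm_eq_inner, subst euclidean_inner) (simp add: power2_eq_square)

lemma gauss_FT_aux:
  fixes u :: "'a::euclidean_space"
  defines "g \<equiv> \<lambda>b (t::real). complex_of_real (exp (- pi * t\<^sup>2)) * cis (- 2 * pi * (t * (u \<bullet> b)))"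
  shows "complex_of_real (gauss x) * cis (- 2 * pi * (x \<bullet> u)) = (\<Prod>b\<in>Basis. g b (x \<bullet> b))"
proof -
  have "x \<bullet> u = (\<Sum>b\<in>Basis. (x \<bullet> b) * (u \<bullet> b))" by (rule euclidean_inner)
  then have "cis (- 2 * pi * (x \<bullet> u)) = (\<Prod>b\<in>Basis. cis (- 2 * pi * ((x \<bullet> b) * (u \<bullet> b))))"
    by (simp add: sum_distrib_left cis_sum flip: sum_negf)
  moreover have "gauss x = (\<Prod>b\<in>Basis. exp (- pi * (x \<bullet> b)\<^sup>2))"
    unfolding gauss_def norm_sq_Basis by (simp add: sum_distrib_left exp_sum flip: sum_negf)
  ultimately show ?thesis by (simp add: g_def prod.distrib)
qed

text \<open>Lebesgue measure is the image of the product of one-dimensional Lebesgue measures, on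
  which the integrand splits into one-dimensional factors.\<close>

lemma
  fixes u :: "'a::euclidean_space"
  shows gauss_FT: "FT (\<lambda>x. complex_of_real (gauss x)) u = complex_of_real (gauss u)"
    and gauss_integrable_complex: "integrable lborel (\<lambda>x::'a. complex_of_real (gauss x))"
proof -
  interpret product_sigma_finite "\<lambda>_::'a. lborel :: real measure" ..
  let ?g = "\<lambda>u b (t::real). complex_of_real (exp (- pi * t\<^sup>2)) * cis (- 2 * pi * (t * ((u::'a) \<bullet> b)))"
  let ?S = "\<lambda>f. \<Sum>b\<in>Basis. f b *\<^sub>R b :: 'a"
  let ?P = "\<Pi>\<^sub>M b\<in>(Basis::'a set). (lborel :: real measure)"
  have S[simp]: "?S f \<bullet> b = f b" if "b \<in> Basis" for f b
    using that by simp
  have meas: "?S \<in> measurable ?P borel" by measurable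
  have eq: "complex_of_real (gauss (?S f)) * cis (- 2 * pi * (?S f \<bullet> u)) = (\<Prod>b\<in>Basis. ?g u b (f b))" for u f
    unfolding gauss_FT_aux by (intro prod.cong) auto
  have int: "integrable lborel (\<lambda>x. complex_of_real (gauss x) * cis (- 2 * pi * (x \<bullet> u)))" for u :: 'a
    unfolding lborel_eq[where 'a='a]
    by (subst integrable_distr_eq[OF meas]) 
       (auto simp only: eq intro!: product_integrable_prod gauss_FT_real(2) finite_Basis, measurable)
  from int[of 0] show "integrable lborel (\<lambda>x::'a. complex_of_real (gauss x))" by simp
  have "FT (\<lambda>x. complex_of_real (gauss x)) u = (\<integral>f. (\<Prod>b\<in>Basis. ?g u b (f b)) \<partial>?P)"
    unfolding FT_def lborel_eq[where 'a='a]
    by (subst integral_distr[OF meas]) (auto simp only: eq, measurable)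
  also have "\<dots> = (\<Prod>b\<in>Basis. complex_of_real (exp (- pi * (u \<bullet> b)\<^sup>2)))"
    by (subst product_integral_prod) (auto intro!: gauss_FT_real(2) simp only: gauss_FT_real(1) finite_Basis)
  also have "\<dots> = complex_of_real (gauss u)"
    unfolding gauss_def norm_sq_Basis by (simp add: sum_distrib_left exp_sum flip: sum_negf)
  finally show "FT (\<lambda>x. complex_of_real (gauss x)) u = complex_of_real (gauss u)" .
qed

lemma gauss_integrable: "integrable lborel (gauss :: 'a::euclidean_space \<Rightarrow> real)"
  using integrable_Re[OF gauss_integrable_complex] by simp

lemma gauss_integral: "(\<integral>x. gauss x \<partial>(lborel :: 'a::euclidean_space measure)) = 1"
proof -
  have "complex_of_real (\<integral>x. gauss x \<partial>(lborel :: 'a measure)) = FT (\<lambda>x. complex_of_real (gauss x)) (0::'a)"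
    unfolding FT_def by simp
  then show ?thesis by (simp add: gauss_FT) (simp add: gauss_def)
qed

lemma nn_integral_translate:
  fixes h :: "'a::euclidean_space"
  assumes [measurable]: "f \<in> borel_measurable borel"
  shows "(\<integral>\<^sup>+x. f (h + x) \<partial>lborel) = (\<integral>\<^sup>+x. f x \<partial>lborel)"
  by (subst (2) lborel_distr_plus[of h, symmetric]) (simp add: nn_integral_distr)

lemma integral_translate:
  fixes h :: "'a::euclidean_space" and f :: "'a \<Rightarrow> 'b::{banach, second_countable_topology}"
  assumes [measurable]: "f \<in> borel_measurable borel"
  shows "(\<integral>x. f (h + x) \<partial>lborel) = (\<integral>x. f x \<partial>lborel)"
  by (subst (2) lborel_distr_plus[of h, symmetric]) (simp add: integral_distr)

lemma integrable_translate:
  fixes h :: "'a::euclidean_space" and f :: "'a \<Rightarrow> 'b::{banach, second_countable_topology}"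
  assumes [measurable]: "f \<in> borel_measurable borel"
  shows "integrable lborel (\<lambda>x. f (h + x)) \<longleftrightarrow> integrable lborel f"
  by (subst (2) lborel_distr_plus[of h, symmetric]) (simp add: integrable_distr_eq)

lemma integral_affine:
  fixes t :: "'a::euclidean_space" and f :: "'a \<Rightarrow> complex"
  assumes c: "c > 0" and [measurable]: "f \<in> borel_measurable borel"
  shows "(\<integral>x. f x \<partial>lborel) = c ^ DIM('a) *\<^sub>R (\<integral>x. f (t + c *\<^sub>R x) \<partial>lborel)"
proof -
  have "(\<integral>x. f x \<partial>lborel) =
    (\<integral>x. f x \<partial>density (distr lborel borel (\<lambda>x. t + c *\<^sub>R x)) (\<lambda>_. ennreal (\<bar>c\<bar>^DIM('a))))"
    using lborel_affine[of c t] c by (simp add: ennreal_power)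
  also have "\<dots> = c ^ DIM('a) *\<^sub>R (\<integral>x. f (t + c *\<^sub>R x) \<partial>lborel)"
    using c by (subst integral_density) (auto simp: integral_distr)
  finally show ?thesis .
qed

text \<open>Convolution of \<open>g\<close> with a Gaussian of width \<open>1 / k\<close>, after a
  substitution that leaves the kernel fixed and moves \<open>k\<close> into the argument of
  \<open>g\<close>. Dominated convergence as \<open>k\<close> grows then has the majorant
  \<open>gauss\<close>.\<close>

definition gauss_mean :: "real \<Rightarrow> ('a::euclidean_space \<Rightarrow> complex) \<Rightarrow> 'a \<Rightarrow> complex" where
  "gauss_mean k g x = (\<integral>z. g (x + (1 / k) *\<^sub>R z) * complex_of_real (gauss z) \<partial>lborel)"

lemma gauss_scaled_FT:
  fixes u :: "'a::euclidean_space"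
  assumes k: "k > 0"
  shows "FT (\<lambda>x. complex_of_real (gauss ((1 / k) *\<^sub>R x))) u = k ^ DIM('a) *\<^sub>R complex_of_real (gauss (k *\<^sub>R u))"
proof -
  have "FT (\<lambda>x. complex_of_real (gauss ((1 / k) *\<^sub>R x))) u =
     k ^ DIM('a) *\<^sub>R (\<integral>x. complex_of_real (gauss ((1 / k) *\<^sub>R (0 + k *\<^sub>R x))) * cis (- 2 * pi * ((0 + k *\<^sub>R x) \<bullet> u)) \<partial>lborel)"
    unfolding FT_def by (rule integral_affine[OF k]) measurable
  also have "(\<lambda>x. complex_of_real (gauss ((1 / k) *\<^sub>R (0 + k *\<^sub>R x))) * cis (- 2 * pi * ((0 + k *\<^sub>R x) \<bullet> u))) =
      (\<lambda>x. complex_of_real (gauss x) * cis (- 2 * pi * (x \<bullet> (k *\<^sub>R u))))"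
    using k by (auto simp: mult_ac)
  also have "(\<integral>x. complex_of_real (gauss x) * cis (- 2 * pi * (x \<bullet> (k *\<^sub>R u))) \<partial>lborel) = complex_of_real (gauss (k *\<^sub>R u))"
    using gauss_FT[of "k *\<^sub>R u"] unfolding FT_def .
  finally show ?thesis .
qed

text \<open>A divergent integral would make the transform at 0 vanish by convention, while the
  scaling formula gives a positive value there.\<close>

lemma gauss_scaled_integrable:
  assumes k: "k > 0"
  shows "integrable lborel (\<lambda>x::'a::euclidean_space. complex_of_real (gauss ((1 / k) *\<^sub>R x)))"
proof -
  have "integrable (lborel::'a measure) (\<lambda>x. gauss ((1 / k) *\<^sub>R x))"
  proof (rule ccontr)
    assume *: "\<not> ?thesis"
    have "FT (\<lambda>x. complex_of_real (gauss ((1 / k) *\<^sub>R x))) (0::'a) = 0"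
      unfolding FT_def using * by (simp add: not_integrable_integral_eq)
    with gauss_scaled_FT[OF k, of "0::'a"] k gauss_pos[of "0::'a"] show False
      by simp
  qed
  then show ?thesis by simp
qed

text \<open>Parseval's identity with a Gaussian convergence factor, which makes all integrals
  absolutely convergent. On the other side the factor turns into a Gaussian mean of
  \<open>g\<close>.\<close>

lemma FT_gauss_pairing:
  fixes f g :: "'a::euclidean_space \<Rightarrow> complex"
  assumes k: "k > 0" and f: "integrable lborel f" and g: "integrable lborel g"
  shows "(\<integral>\<xi>. FT f \<xi> * cnj (FT g \<xi>) * complex_of_real (gauss ((1 / k) *\<^sub>R \<xi>)) \<partial>lborel) =
    (\<integral>x. f x * cnj (gauss_mean k g x) \<partial>lborel)"
proof -
  note [measurable] = borel_measurable_integrable[OF f] borel_measurable_integrable[OF g]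
  let ?G = "\<lambda>\<xi>::'a. complex_of_real (gauss ((1 / k) *\<^sub>R \<xi>))"
  let ?\<phi> = "\<lambda>\<xi>. cnj (FT g \<xi>) * ?G \<xi>"
  have \<phi>: "integrable lborel ?\<phi>"
  proof (rule Bochner_Integration.integrable_bound)
    show "integrable lborel (\<lambda>\<xi>. complex_of_real (\<integral>x. cmod (g x) \<partial>lborel) * ?G \<xi>)"
      using gauss_scaled_integrable[OF k] by (rule integrable_mult_right)
    show "AE x in lborel. norm (?\<phi> x) \<le> norm (complex_of_real (\<integral>x. cmod (g x) \<partial>lborel) * ?G x)"
      using FT_bound[of g] gauss_pos
      by (auto simp: norm_mult intro!: mult_right_mono)
  qed measurable
  have "FT ?\<phi> x = cnj (gauss_mean k g x)" for x
  proof -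
    let ?h = "\<lambda>\<xi>. ?G \<xi> * cis (2 * pi * (\<xi> \<bullet> x))"
    have h: "integrable lborel ?h"
      by (intro integrable_mult_cis gauss_scaled_integrable k) measurable
    have "FT ?\<phi> x = cnj (\<integral>\<xi>. FT g \<xi> * ?h \<xi> \<partial>lborel)"
      unfolding FT_def[of ?\<phi>] Bochner_Integration.integral_cnj[symmetric] by (simp add: cis_cnj mult_ac)
    \<comment> \<open>A second use of the multiplication formula, now against a modulated Gaussian:
      modulation by \<open>x\<close> recentres its transform at \<open>x\<close>.\<close>
    moreover have "(\<integral>\<xi>. FT g \<xi> * ?h \<xi> \<partial>lborel) = gauss_mean k g x"
    proof -
      have ft: "FT ?h y = k ^ DIM('a) *\<^sub>R complex_of_real (gauss (k *\<^sub>R (y - x)))" for y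
      proof -
        have "FT ?h y = FT ?G (y - x)"
          unfolding FT_def by (simp add: mult.assoc cis_mult inner_diff_right algebra_simps)
        then show ?thesis by (simp only: gauss_scaled_FT[OF k])
      qed
      have "(\<integral>\<xi>. FT g \<xi> * ?h \<xi> \<partial>lborel) = (\<integral>y. g y * FT ?h y \<partial>lborel)"
        by (rule FT_multiplication[OF g h])
      also have "\<dots> = (\<integral>y. g y * (k ^ DIM('a) *\<^sub>R complex_of_real (gauss (k *\<^sub>R (y - x)))) \<partial>lborel)"
        by (simp only: ft)
      also have "\<dots> =
         (1 / k) ^ DIM('a) *\<^sub>R (\<integral>z. g (x + (1 / k) *\<^sub>R z) *
             (k ^ DIM('a) *\<^sub>R complex_of_real (gauss (k *\<^sub>R ((x + (1 / k) *\<^sub>R z) - x)))) \<partial>lborel)"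
        by (rule integral_affine) (use k in auto)
      also have "\<dots> = gauss_mean k g x"
        unfolding gauss_mean_def using k by (simp add: power_one_over)
      finally show ?thesis .
    qed
    ultimately show ?thesis by simp
  qed
  then show ?thesis
    using FT_multiplication[OF f \<phi>] by (simp add: mult.assoc)
qed

text \<open>Tonelli reduces this to a fixed shift \<open>z / k\<close>. There the product is at most
  half the sum of the squares, both squares integrate to the same value by translation invariance,
  and the Gaussian has mass 1. Nonnegative integrals avoid any question of integrability.\<close>

lemma gauss_mean_pairing_le:
  fixes f :: "'a::euclidean_space \<Rightarrow> complex"
  assumes f: "sq_int f"
  shows "(\<integral>\<^sup>+x. cmod (f x * cnj (gauss_mean k f x)) \<partial>lborel) \<le> (\<integral>\<^sup>+x. (cmod (f x))\<^sup>2 \<partial>lborel)"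
proof -
  note [measurable] = sq_int_measurable[OF f]
  let ?N = "\<integral>\<^sup>+x. (cmod (f x))\<^sup>2 \<partial>lborel"
  have "(\<integral>\<^sup>+x. cmod (f x * cnj (gauss_mean k f x)) \<partial>lborel) \<le>
      (\<integral>\<^sup>+x. (\<integral>\<^sup>+z. ennreal (cmod (f x) * (cmod (f (x + (1 / k) *\<^sub>R z)) * gauss z)) \<partial>lborel) \<partial>lborel)"
  proof (rule nn_integral_mono)
    fix x
    have "ennreal (cmod (gauss_mean k f x)) \<le> (\<integral>\<^sup>+z. ennreal (cmod (f (x + (1 / k) *\<^sub>R z)) * gauss z) \<partial>lborel)"
    proof (cases "integrable lborel (\<lambda>z. f (x + (1 / k) *\<^sub>R z) * complex_of_real (gauss z))")
      case True
      have "ennreal (cmod (gauss_mean k f x)) \<le> (\<integral>\<^sup>+z. norm (f (x + (1 / k) *\<^sub>R z) * complex_of_real (gauss z)) \<partial>lborel)"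
        unfolding gauss_mean_def by (rule integral_norm_bound_ennreal[OF True])
      then show ?thesis using gauss_pos by (simp add: norm_mult less_imp_le abs_of_pos)
    next
      case False
      then show ?thesis by (simp add: gauss_mean_def not_integrable_integral_eq)
    qed
    then have "ennreal (cmod (f x)) * ennreal (cmod (gauss_mean k f x)) \<le>
      ennreal (cmod (f x)) * (\<integral>\<^sup>+z. ennreal (cmod (f (x + (1 / k) *\<^sub>R z)) * gauss z) \<partial>lborel)"
      by (intro mult_left_mono) auto
    then show "ennreal (cmod (f x * cnj (gauss_mean k f x))) \<le>
      (\<integral>\<^sup>+z. ennreal (cmod (f x) * (cmod (f (x + (1 / k) *\<^sub>R z)) * gauss z)) \<partial>lborel)"
      by (simp add: norm_mult ennreal_mult nn_integral_cmult gauss_pos less_imp_le)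
  qed
  also have "\<dots> = (\<integral>\<^sup>+z. (\<integral>\<^sup>+x. ennreal (cmod (f x) * (cmod (f (x + (1 / k) *\<^sub>R z)) * gauss z)) \<partial>lborel) \<partial>lborel)"
    by (rule lborel_pair.Fubini') measurable
  also have "\<dots> \<le> (\<integral>\<^sup>+z. ennreal (gauss z) * ?N \<partial>(lborel :: 'a measure))"
  proof (rule nn_integral_mono)
    fix z :: 'a
    define h where "h = (1 / k) *\<^sub>R z"
    \<comment> \<open>The factor one half under a name: in the extended reals,
      \<open>c + c = 1\<close> is all that recombines the two halves.\<close>
    obtain c :: real where c: "c \<ge> 0" "c + c = 1" "c = 1/2" by (rule that[of "1/2"]) auto
    have le: "cmod a * cmod b \<le> c * (cmod a)\<^sup>2 + c * (cmod b)\<^sup>2" for a b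
      using sum_squares_bound[of "cmod a" "cmod b"] by (simp add: c(3))
    have "(\<integral>\<^sup>+x. ennreal (cmod (f x) * (cmod (f (x + h)) * gauss z)) \<partial>lborel) \<le>
       (\<integral>\<^sup>+x. ennreal (gauss z) * (ennreal c * ennreal ((cmod (f x))\<^sup>2) + ennreal c * ennreal ((cmod (f (h + x)))\<^sup>2)) \<partial>lborel)"
    proof (rule nn_integral_mono)
      fix x
      have "cmod (f x) * (cmod (f (x + h)) * gauss z) \<le> gauss z * (c * (cmod (f x))\<^sup>2 + c * (cmod (f (h + x)))\<^sup>2)"
        using mult_left_mono[OF le[of "f x" "f (h + x)"], of "gauss z"] gauss_pos[of z]
        by (simp add: add.commute mult_ac)
      then show "ennreal (cmod (f x) * (cmod (f (x + h)) * gauss z)) \<le>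
         ennreal (gauss z) * (ennreal c * ennreal ((cmod (f x))\<^sup>2) + ennreal c * ennreal ((cmod (f (h + x)))\<^sup>2))"
        using c(1) by (simp flip: ennreal_mult ennreal_plus)
    qed
    also have "\<dots> = ennreal (gauss z) * (ennreal c * ?N + ennreal c * (\<integral>\<^sup>+x. (cmod (f (h + x)))\<^sup>2 \<partial>lborel))"
      by (simp add: nn_integral_cmult nn_integral_add)
    also have "(\<integral>\<^sup>+x. (cmod (f (h + x)))\<^sup>2 \<partial>lborel) = ?N"
      by (rule nn_integral_translate) measurable
    also have "ennreal c * ?N + ennreal c * ?N = ?N"
      using c(1,2) by (metis distrib_right ennreal_1 ennreal_plus mult_1)
    finally show "(\<integral>\<^sup>+x. ennreal (cmod (f x) * (cmod (f (x + (1 / k) *\<^sub>R z)) * gauss z)) \<partial>lborel) \<le> ennreal (gauss z) * ?N"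
      unfolding h_def .
  qed
  also have "\<dots> = (\<integral>\<^sup>+z. ennreal (gauss (z::'a)) \<partial>lborel) * ?N"
    by (rule nn_integral_multc) measurable
  also have "(\<integral>\<^sup>+z. ennreal (gauss (z::'a)) \<partial>lborel) = 1"
    using gauss_integrable[where 'a='a] gauss_pos gauss_integral[where 'a='a]
    by (subst nn_integral_eq_integral) (auto simp: less_imp_le)
  finally show ?thesis by simp
qed

lemma gauss_scaled_tendsto: "(\<lambda>k. gauss ((1 / real (Suc k)) *\<^sub>R (x::'a::euclidean_space))) \<longlonglongrightarrow> 1"
proof -
  have "(\<lambda>k. 1 / real (Suc k)) \<longlonglongrightarrow> 0" by (rule LIMSEQ_Suc[OF lim_1_over_n])
  then have "(\<lambda>k. gauss ((1 / real (Suc k)) *\<^sub>R x)) \<longlonglongrightarrow> exp (- pi * (norm (0 *\<^sub>R x))\<^sup>2)"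
    unfolding gauss_def by (intro tendsto_intros)
  then show ?thesis by simp
qed

text \<open>Fatou's lemma as the Gaussian factor tends to 1. This gives only an inequality, but it
  makes the transform continuous in the square norm, which is what the proof of equality
  needs.\<close>

lemma FT_L2_bound:
  fixes f :: "'a::euclidean_space \<Rightarrow> complex"
  assumes i: "integrable lborel f" and f: "sq_int f"
  shows "sq_int (FT f)" and "L2norm (FT f) \<le> L2norm f"
proof -
  note [measurable] = sq_int_measurable[OF f]
  let ?N = "\<integral>\<^sup>+x. (cmod (f x))\<^sup>2 \<partial>lborel"
  let ?G = "\<lambda>n \<xi>. gauss ((1 / real (Suc n)) *\<^sub>R \<xi> :: 'a)"
  have N: "?N = ennreal (\<integral>x. (cmod (f x))\<^sup>2 \<partial>lborel)"
    using f by (intro nn_integral_eq_integral) (auto simp: sq_int_def)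
  have b: "(\<integral>\<^sup>+\<xi>. ennreal ((cmod (FT f \<xi>))\<^sup>2 * ?G n \<xi>) \<partial>lborel) \<le> ?N" for n
  proof -
    have int: "integrable lborel (\<lambda>\<xi>. (cmod (FT f \<xi>))\<^sup>2 * ?G n \<xi>)"
    proof (rule Bochner_Integration.integrable_bound)
      show "integrable lborel (\<lambda>\<xi>. (\<integral>x. cmod (f x) \<partial>lborel)\<^sup>2 * ?G n \<xi>)"
        using integrable_Re[OF gauss_scaled_integrable[of "real (Suc n)"]]
        by (intro integrable_mult_right) simp
      show "AE x in lborel. norm ((cmod (FT f x))\<^sup>2 * ?G n x) \<le> norm ((\<integral>x. cmod (f x) \<partial>lborel)\<^sup>2 * ?G n x)"
        using FT_bound[of f] gauss_pos
        by (auto simp: abs_mult less_imp_le abs_of_pos intro!: mult_right_mono power_mono)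
    qed measurable
    have "(\<integral>\<^sup>+\<xi>. ennreal ((cmod (FT f \<xi>))\<^sup>2 * ?G n \<xi>) \<partial>lborel) = ennreal (\<integral>\<xi>. (cmod (FT f \<xi>))\<^sup>2 * ?G n \<xi> \<partial>lborel)"
      using gauss_pos by (intro nn_integral_eq_integral int) (auto simp: less_imp_le)
    also have "(\<integral>\<xi>. (cmod (FT f \<xi>))\<^sup>2 * ?G n \<xi> \<partial>lborel) \<le> cmod (\<integral>\<xi>. complex_of_real ((cmod (FT f \<xi>))\<^sup>2 * ?G n \<xi>) \<partial>lborel)"
      by (simp only: integral_complex_of_real norm_of_real abs_ge_self)
    also have "(\<integral>\<xi>. complex_of_real ((cmod (FT f \<xi>))\<^sup>2 * ?G n \<xi>) \<partial>lborel) =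
       (\<integral>\<xi>. FT f \<xi> * cnj (FT f \<xi>) * complex_of_real (?G n \<xi>) \<partial>lborel)"
      by (simp only: complex_norm_square of_real_mult)
    also have "\<dots> = (\<integral>x. f x * cnj (gauss_mean (real (Suc n)) f x) \<partial>lborel)"
      by (rule FT_gauss_pairing[OF _ i i]) simp
    also have "ennreal (cmod \<dots>) \<le> ?N"
    proof (cases "integrable lborel (\<lambda>x. f x * cnj (gauss_mean (real (Suc n)) f x))")
      case True
      from integral_norm_bound_ennreal[OF this] gauss_mean_pairing_le[OF f] show ?thesis by (rule order.trans)
    qed (simp add: not_integrable_integral_eq)
    finally show ?thesis by (simp add: ennreal_leI)
  qed
  have "(\<integral>\<^sup>+\<xi>. ennreal ((cmod (FT f \<xi>))\<^sup>2) \<partial>lborel) =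
     (\<integral>\<^sup>+\<xi>. liminf (\<lambda>n. ennreal ((cmod (FT f \<xi>))\<^sup>2 * ?G n \<xi>)) \<partial>lborel)"
  proof (rule nn_integral_cong)
    fix \<xi> :: 'a
    have "(\<lambda>n. ennreal ((cmod (FT f \<xi>))\<^sup>2 * ?G n \<xi>)) \<longlonglongrightarrow> ennreal ((cmod (FT f \<xi>))\<^sup>2 * 1)"
      (is "_ \<longlonglongrightarrow> ?l")
      by (intro tendsto_ennrealI tendsto_intros gauss_scaled_tendsto)
    then show "ennreal ((cmod (FT f \<xi>))\<^sup>2) = liminf (\<lambda>n. ennreal ((cmod (FT f \<xi>))\<^sup>2 * ?G n \<xi>))"
      using lim_imp_Liminf[OF trivial_limit_sequentially, of _ ?l] by (simp only: mult_1_right)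
  qed
  also have "\<dots> \<le> liminf (\<lambda>n. \<integral>\<^sup>+\<xi>. ennreal ((cmod (FT f \<xi>))\<^sup>2 * ?G n \<xi>) \<partial>lborel)"
    by (rule nn_integral_liminf) measurable
  also have "\<dots> \<le> ?N"
    by (rule Liminf_le) (simp, intro always_eventually allI b)
  finally have le: "(\<integral>\<^sup>+\<xi>. ennreal ((cmod (FT f \<xi>))\<^sup>2) \<partial>lborel) \<le> ?N" .
  have int: "integrable lborel (\<lambda>\<xi>. (cmod (FT f \<xi>))\<^sup>2)"
    by (rule integrableI_nonneg) (use le N in \<open>auto simp: top_unique less_top intro: le_less_trans\<close>)
  then show "sq_int (FT f)" by (simp add: sq_int_def)
  have "ennreal (\<integral>\<xi>. (cmod (FT f \<xi>))\<^sup>2 \<partial>lborel) = (\<integral>\<^sup>+\<xi>. ennreal ((cmod (FT f \<xi>))\<^sup>2) \<partial>lborel)"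
    by (rule nn_integral_eq_integral[OF int, symmetric]) simp
  also have "\<dots> \<le> ennreal (\<integral>x. (cmod (f x))\<^sup>2 \<partial>lborel)" using le unfolding N .
  finally show "L2norm (FT f) \<le> L2norm f"
    unfolding L2norm_def by (simp add: ennreal_le_iff)
qed

text \<open>Convergence is claimed only at continuity points; for the indicator of a box these are
  almost all points.\<close>

lemma gauss_mean_tendsto:
  fixes g :: "'a::euclidean_space \<Rightarrow> complex"
  assumes [measurable]: "g \<in> borel_measurable borel" and b: "\<And>x. cmod (g x) \<le> 1" and c: "isCont g x"
  shows "(\<lambda>n. gauss_mean (real (Suc n)) g x) \<longlonglongrightarrow> g x"
proof -
  have "(\<lambda>n. \<integral>z. g (x + (1 / real (Suc n)) *\<^sub>R z) * complex_of_real (gauss z) \<partial>lborel)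
      \<longlonglongrightarrow> (\<integral>z. g x * complex_of_real (gauss (z::'a)) \<partial>lborel)"
  proof (rule integral_dominated_convergence)
    show "integrable (lborel :: 'a measure) gauss" by (rule gauss_integrable)
    show "AE z in lborel. (\<lambda>n. g (x + (1 / real (Suc n)) *\<^sub>R z) * complex_of_real (gauss z)) \<longlonglongrightarrow> g x * complex_of_real (gauss z)"
    proof (rule AE_I2)
      fix z :: 'a
      have "(\<lambda>n. x + (1 / real (Suc n)) *\<^sub>R z) \<longlonglongrightarrow> x + 0 *\<^sub>R z"
        by (intro tendsto_intros LIMSEQ_Suc[OF lim_1_over_n])
      then have "(\<lambda>n. g (x + (1 / real (Suc n)) *\<^sub>R z)) \<longlonglongrightarrow> g x"
        using c by (intro isCont_tendsto_compose[of _ g]) auto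
      then show "(\<lambda>n. g (x + (1 / real (Suc n)) *\<^sub>R z) * complex_of_real (gauss z)) \<longlonglongrightarrow> g x * complex_of_real (gauss z)"
        by (intro tendsto_intros)
    qed
    show "AE z in lborel. norm (g (x + (1 / real (Suc n)) *\<^sub>R z) * complex_of_real (gauss z)) \<le> gauss z" for n
      using b by (auto simp: norm_mult intro!: mult_left_le_one_le)
  qed measurable
  then show ?thesis
    unfolding gauss_mean_def by (simp add: gauss_integral)
qed

lemma gauss_mean_bound:
  fixes g :: "'a::euclidean_space \<Rightarrow> complex"
  assumes [measurable]: "g \<in> borel_measurable borel" and b: "\<And>x. cmod (g x) \<le> 1"
  shows "cmod (gauss_mean k g x) \<le> 1"
proof -
  have "cmod (gauss_mean k g x) \<le> (\<integral>z. cmod (g (x + (1 / k) *\<^sub>R z) * complex_of_real (gauss z)) \<partial>lborel)"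
    unfolding gauss_mean_def by (rule integral_norm_bound)
  also have "\<dots> \<le> (\<integral>z. gauss (z::'a) \<partial>lborel)"
    by (rule integral_mono_AE') (auto simp: norm_mult gauss_integrable intro!: mult_left_le_one_le b)
  finally show ?thesis by (simp add: gauss_integral)
qed

section \<open>Parseval's identity: from boxes to integrable square integrable functions\<close>

definition parseval_defect :: "('a::euclidean_space \<Rightarrow> complex) \<Rightarrow> ('a \<Rightarrow> complex) \<Rightarrow> complex" where
  "parseval_defect f g = L2inner (FT f) (FT g) - L2inner f g"

text \<open>Continuity of the defect in its second argument. Together with additivity it carries
  vanishing on boxes to measurable sets, simple functions and limits.\<close>

lemma parseval_defect_bound:
  fixes f g :: "'a::euclidean_space \<Rightarrow> complex"
  assumes "integrable lborel f" "sq_int f" "integrable lborel g" "sq_int g"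
  shows "cmod (parseval_defect f g) \<le> 2 * L2norm f * L2norm g"
proof -
  have nn: "0 \<le> L2norm h" for h :: "'a \<Rightarrow> complex" by (simp add: L2norm_def)
  have "cmod (parseval_defect f g) \<le> cmod (L2inner (FT f) (FT g)) + cmod (L2inner f g)"
    unfolding parseval_defect_def by (rule norm_triangle_ineq4)
  also have "\<dots> \<le> L2norm (FT f) * L2norm (FT g) + L2norm f * L2norm g"
    unfolding L2inner_def by (intro add_mono L2inner_le FT_L2_bound assms)
  also have "L2norm (FT f) * L2norm (FT g) \<le> L2norm f * L2norm g"
    by (intro mult_mono FT_L2_bound assms nn)
  finally show ?thesis by simp
qed

lemma parseval_defect_diff:
  fixes f g :: "'a::euclidean_space \<Rightarrow> complex"
  assumes "integrable lborel f" "sq_int f" "integrable lborel g" "sq_int g" "integrable lborel h" "sq_int h"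
  shows "parseval_defect f (\<lambda>x. g x - h x) = parseval_defect f g - parseval_defect f h"
proof -
  have "L2inner f (\<lambda>x. g x - h x) = L2inner f g - L2inner f h" if "sq_int f" "sq_int g" "sq_int h"
    for f g h :: "'a \<Rightarrow> complex"
    unfolding L2inner_def using that by (simp add: right_diff_distrib integrable_sq_int_mult)
  moreover have "FT (\<lambda>x. g x - h x) = (\<lambda>\<xi>. FT g \<xi> - FT h \<xi>)"
    using assms by (intro ext FT_diff)
  ultimately show ?thesis
    unfolding parseval_defect_def using assms by (simp add: FT_L2_bound)
qed

lemma parseval_defect_sum:
  fixes f :: "'a::euclidean_space \<Rightarrow> complex"
  assumes "finite I" "integrable lborel f" "sq_int f" "\<And>i. i \<in> I \<Longrightarrow> integrable lborel (g i)" "\<And>i. i \<in> I \<Longrightarrow> sq_int (g i)"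
  shows "parseval_defect f (\<lambda>x. \<Sum>i\<in>I. c i * g i x) = (\<Sum>i\<in>I. cnj (c i) * parseval_defect f (g i))"
proof -
  have s: "L2inner f (\<lambda>x. \<Sum>i\<in>I. c i * g i x) = (\<Sum>i\<in>I. cnj (c i) * L2inner f (g i))"
    if "sq_int f" "\<And>i. i \<in> I \<Longrightarrow> sq_int (g i)" for f :: "'a \<Rightarrow> complex" and g
  proof -
    have "L2inner f (\<lambda>x. \<Sum>i\<in>I. c i * g i x) = (\<integral>x. (\<Sum>i\<in>I. cnj (c i) * (f x * cnj (g i x))) \<partial>lborel)"
      unfolding L2inner_def by (simp add: sum_distrib_left mult_ac)
    also have "\<dots> = (\<Sum>i\<in>I. (\<integral>x. cnj (c i) * (f x * cnj (g i x)) \<partial>lborel))"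
      using that by (intro Bochner_Integration.integral_sum integrable_mult_right integrable_sq_int_mult) auto
    finally show ?thesis by (simp add: L2inner_def)
  qed
  have "FT (\<lambda>x. \<Sum>i\<in>I. c i * g i x) = (\<lambda>\<xi>. \<Sum>i\<in>I. c i * FT (g i) \<xi>)"
    using assms by (intro ext) (simp add: FT_sum FT_mult)
  then show ?thesis
    unfolding parseval_defect_def using assms
    by (simp add: s FT_L2_bound right_diff_distrib sum_subtractf)
qed

text \<open>Dominated convergence upgrades pointwise convergence to convergence in the square norm,
  where the defect is continuous. The factor 2 is the one that comes with simple approximations of a
  measurable function.\<close>

lemma parseval_defect_limit:
  fixes f g :: "'a::euclidean_space \<Rightarrow> complex"
  assumes f: "integrable lborel f" "sq_int f" and g: "integrable lborel g" "sq_int g"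
    and s: "\<And>i::nat. s i \<in> borel_measurable lborel"
    and b: "\<And>i x. cmod (s i x) \<le> 2 * cmod (g x)" and l: "\<And>x. (\<lambda>i. s i x) \<longlonglongrightarrow> g x"
    and z: "\<And>i. parseval_defect f (s i) = 0"
  shows "parseval_defect f g = 0"
proof -
  have si: "integrable lborel (s i)" for i
    by (rule Bochner_Integration.integrable_bound[OF integrable_mult_right[OF integrable_norm[OF g(1)], of 2]])
       (use s b in auto)
  have ss: "sq_int (s i)" for i
  proof (rule sq_int_bound[OF s])
    show "integrable lborel (\<lambda>x. 2\<^sup>2 * (cmod (g x))\<^sup>2)"
      using g(2) by (auto simp: sq_int_def)
    show "AE x in lborel. (cmod (s i x))\<^sup>2 \<le> 2\<^sup>2 * (cmod (g x))\<^sup>2"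
    proof (rule AE_I2)
      fix x show "(cmod (s i x))\<^sup>2 \<le> 2\<^sup>2 * (cmod (g x))\<^sup>2"
        using power_mono[OF b[of i x] norm_ge_zero, of 2] by (simp add: power_mult_distrib)
    qed
  qed
  have "(\<lambda>i. \<integral>x. (cmod (g x - s i x))\<^sup>2 \<partial>lborel) \<longlonglongrightarrow> (\<integral>x. 0 \<partial>(lborel :: 'a measure))"
  proof (rule integral_dominated_convergence)
    show "integrable lborel (\<lambda>x. 3\<^sup>2 * (cmod (g x))\<^sup>2)"
      using g(2) by (auto simp: sq_int_def)
    show "AE x in lborel. norm ((cmod (g x - s i x))\<^sup>2) \<le> 3\<^sup>2 * (cmod (g x))\<^sup>2" for i
    proof (rule AE_I2)
      fix x
      have "cmod (g x - s i x) \<le> 3 * cmod (g x)"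
        using norm_triangle_ineq4[of "g x" "s i x"] b[of i x] by simp
      then have "(cmod (g x - s i x))\<^sup>2 \<le> (3 * cmod (g x))\<^sup>2" by (rule power_mono) simp
      then show "norm ((cmod (g x - s i x))\<^sup>2) \<le> 3\<^sup>2 * (cmod (g x))\<^sup>2" by (simp add: power_mult_distrib)
    qed
    show "AE x in lborel. (\<lambda>i. (cmod (g x - s i x))\<^sup>2) \<longlonglongrightarrow> 0"
    proof (rule AE_I2)
      fix x
      have "(\<lambda>i. (cmod (g x - s i x))\<^sup>2) \<longlonglongrightarrow> (cmod (g x - g x))\<^sup>2"
        by (intro tendsto_intros l)
      then show "(\<lambda>i. (cmod (g x - s i x))\<^sup>2) \<longlonglongrightarrow> 0" by simp
    qed
  qed (use g s in \<open>auto simp: sq_int_def\<close>)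
  then have "(\<lambda>i. sqrt (\<integral>x. (cmod (g x - s i x))\<^sup>2 \<partial>lborel)) \<longlonglongrightarrow> sqrt 0"
    by (intro tendsto_real_sqrt) simp
  then have lim: "(\<lambda>i. 2 * L2norm f * L2norm (\<lambda>x. g x - s i x)) \<longlonglongrightarrow> 2 * L2norm f * 0"
    unfolding L2norm_def by (intro tendsto_mult tendsto_const) simp
  have "cmod (parseval_defect f g) \<le> 2 * L2norm f * L2norm (\<lambda>x. g x - s i x)" for i
  proof -
    have "parseval_defect f (\<lambda>x. g x - s i x) = parseval_defect f g"
      using parseval_defect_diff[OF f g si ss] z by simp
    moreover have "cmod (parseval_defect f (\<lambda>x. g x - s i x)) \<le> 2 * L2norm f * L2norm (\<lambda>x. g x - s i x)"
      using f g si ss by (intro parseval_defect_bound) auto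
    ultimately show ?thesis by simp
  qed
  then have "cmod (parseval_defect f g) \<le> 2 * L2norm f * 0"
    by (intro tendsto_lowerbound[OF lim] always_eventually) auto
  then show ?thesis by simp
qed

lemma sq_int_indicator:
  assumes "A \<in> sets borel" "emeasure lborel A < \<infinity>"
  shows "integrable lborel (indicator A :: 'a::euclidean_space \<Rightarrow> complex)" "sq_int (indicator A :: 'a \<Rightarrow> complex)"
proof -
  have "(\<lambda>x. (cmod (indicator A x))\<^sup>2) = (indicator A :: 'a \<Rightarrow> real)"
    by (auto simp: fun_eq_iff indicator_def)
  moreover have i: "integrable lborel (indicator A :: 'a \<Rightarrow> real)"
    using assms by (auto intro!: integrable_real_indicator)
  then have "integrable lborel (\<lambda>x. complex_of_real (indicator A (x::'a)))"
    by (rule integrable_of_real)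
  then have c: "integrable lborel (indicator A :: 'a \<Rightarrow> complex)"
    by (rule Bochner_Integration.integrable_cong[THEN iffD1, rotated 2]) (auto simp: indicator_def)
  ultimately show "sq_int (indicator A :: 'a \<Rightarrow> complex)" using assms by (simp add: sq_int_def)
  show "integrable lborel (indicator A :: 'a \<Rightarrow> complex)" by (rule c)
qed

text \<open>Away from the boundary of the box, which is a null set, the Gaussian means of the indicator function converge.\<close>

lemma parseval_defect_box:
  fixes f :: "'a::euclidean_space \<Rightarrow> complex"
  assumes f: "integrable lborel f" "sq_int f"
  shows "parseval_defect f (indicator (box a b)) = 0"
proof -
  note [measurable] = sq_int_measurable[OF f(2)]
  let ?g = "indicator (box a b) :: 'a \<Rightarrow> complex"
  have g: "integrable lborel ?g" "sq_int ?g"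
    by (auto intro!: sq_int_indicator emeasure_lborel_box_finite)
  note F = FT_L2_bound(1)[OF f] FT_L2_bound(1)[OF g]
  note [measurable] = sq_int_measurable[OF F(1)] sq_int_measurable[OF F(2)]
  have "(\<lambda>n. \<integral>\<xi>. FT f \<xi> * cnj (FT ?g \<xi>) * complex_of_real (gauss ((1 / real (Suc n)) *\<^sub>R \<xi>)) \<partial>lborel)
     \<longlonglongrightarrow> (\<integral>\<xi>. FT f \<xi> * cnj (FT ?g \<xi>) \<partial>lborel)"
  proof (rule integral_dominated_convergence)
    show "integrable lborel (\<lambda>\<xi>. cmod (FT f \<xi> * cnj (FT ?g \<xi>)))"
      by (intro integrable_norm integrable_sq_int_mult F)
    show "AE \<xi> in lborel. norm (FT f \<xi> * cnj (FT ?g \<xi>) * complex_of_real (gauss ((1 / real (Suc n)) *\<^sub>R \<xi>)))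
        \<le> cmod (FT f \<xi> * cnj (FT ?g \<xi>))" for n
      by (auto simp: norm_mult gauss_def intro!: mult_left_le)
    show "AE \<xi> in lborel. (\<lambda>n. FT f \<xi> * cnj (FT ?g \<xi>) * complex_of_real (gauss ((1 / real (Suc n)) *\<^sub>R \<xi>)))
      \<longlonglongrightarrow> FT f \<xi> * cnj (FT ?g \<xi>)"
      by (rule AE_I2) (use tendsto_mult[OF tendsto_const tendsto_of_real[OF gauss_scaled_tendsto]] in fastforce)
  qed measurable
  moreover have "(\<lambda>n. \<integral>x. f x * cnj (gauss_mean (real (Suc n)) ?g x) \<partial>lborel) \<longlonglongrightarrow> (\<integral>x. f x * cnj (?g x) \<partial>lborel)"
  proof (rule integral_dominated_convergence)
    show "integrable lborel (\<lambda>x. cmod (f x))" using f(1) by (rule integrable_norm)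
    show "AE x in lborel. norm (f x * cnj (gauss_mean (real (Suc n)) ?g x)) \<le> cmod (f x)" for n
      by (auto simp: norm_mult indicator_def intro!: mult_left_le gauss_mean_bound)
    have "negligible (frontier (box a b))" by (rule negligible_convex_frontier) (rule convex_box)
    then have "frontier (box a b) \<in> null_sets lborel"
      by (auto simp: negligible_iff_null_sets null_sets_completion_iff)
    then have "AE x in lborel. x \<notin> frontier (box a b)" by (rule AE_not_in)
    then show "AE x in lborel. (\<lambda>n. f x * cnj (gauss_mean (real (Suc n)) ?g x)) \<longlonglongrightarrow> f x * cnj (?g x)"
    proof (rule eventually_mono)
      fix x assume x: "x \<notin> frontier (box a b)"
      have "isCont ?g x"
      proof (cases "x \<in> box a b")
        case True
        have "eventually (\<lambda>y. ?g y = 1) (nhds x)"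
          using eventually_nhds_in_open[OF open_box True] by eventually_elim simp
        then show ?thesis by (rule isCont_cong[THEN iffD2]) simp
      next
        case False
        then have "x \<in> - closure (box a b)"
          using x by (auto simp: frontier_def interior_open[OF open_box])
        then have "eventually (\<lambda>y. y \<in> - closure (box a b)) (nhds x)"
          by (intro eventually_nhds_in_open) auto
        then have "eventually (\<lambda>y. ?g y = 0) (nhds x)"
          by eventually_elim (use closure_subset in \<open>auto simp: indicator_def\<close>)
        then show ?thesis by (rule isCont_cong[THEN iffD2]) simp
      qed
      then show "(\<lambda>n. f x * cnj (gauss_mean (real (Suc n)) ?g x)) \<longlonglongrightarrow> f x * cnj (?g x)"
        by (intro tendsto_intros gauss_mean_tendsto) (auto simp: indicator_def)
    qed
  qed (use f(1) in \<open>auto simp: gauss_mean_def\<close>)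
  ultimately show ?thesis
    unfolding parseval_defect_def L2inner_def
    using LIMSEQ_unique by (fastforce simp: FT_gauss_pairing[OF _ f(1) g(1)])
qed


lemma sq_int_indicator_Int_box:
  assumes "A \<in> sets borel"
  shows "integrable lborel (indicator (A \<inter> box a b) :: 'a::euclidean_space \<Rightarrow> complex)"
    "sq_int (indicator (A \<inter> box a b) :: 'a \<Rightarrow> complex)"
proof -
  have "emeasure lborel (A \<inter> box a b) \<le> emeasure lborel (box a b)"
    using assms by (intro emeasure_mono) auto
  also have "\<dots> < \<infinity>" by (rule emeasure_lborel_box_finite)
  finally show "integrable lborel (indicator (A \<inter> box a b) :: 'a \<Rightarrow> complex)"
    "sq_int (indicator (A \<inter> box a b) :: 'a \<Rightarrow> complex)"
    using assms by (auto intro!: sq_int_indicator)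
qed

text \<open>Dynkin induction over the intersection-stable boxes. Intersecting with a fixed box keeps
  all indicators integrable, in particular in the complement step, where the complement alone may
  have infinite measure.\<close>

lemma parseval_defect_Int_box:
  fixes f :: "'a::euclidean_space \<Rightarrow> complex"
  assumes f: "integrable lborel f" "sq_int f" and A: "A \<in> sets borel"
  shows "parseval_defect f (indicator (A \<inter> box a b)) = 0"
proof -
  let ?G = "range (\<lambda>(a, b). box a b :: 'a set)"
  have sets: "sets (borel :: 'a measure) = sigma_sets UNIV ?G"
    by (subst borel_eq_box) simp
  have "Int_stable ?G" by (auto simp: Int_stable_def box_Int_box)
  moreover have "?G \<subseteq> Pow UNIV" by simp
  moreover have "A \<in> sigma_sets UNIV ?G" using A by (simp add: sets)
  ultimately show ?thesis
  proof (induction rule: sigma_sets_induct_disjoint)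
    case (basic A)
    then show ?case by (auto simp: box_Int_box parseval_defect_box[OF f])
  next
    case empty
    have "box 0 0 = ({} :: 'a set)" by simp
    then show ?case using parseval_defect_box[OF f, of 0 0] by (simp only: Int_empty_left)
  next
    case (compl A)
    then have A: "A \<in> sets borel" by (simp add: sets)
    have "(indicator ((UNIV - A) \<inter> box a b) :: 'a \<Rightarrow> complex) =
      (\<lambda>x. indicator (box a b) x - indicator (A \<inter> box a b) x)"
      by (auto simp: indicator_def)
    then show ?case
      using parseval_defect_diff[OF f sq_int_indicator_Int_box[of UNIV a b] sq_int_indicator_Int_box[OF A, of a b]]
        compl(2) parseval_defect_box[OF f, of a b] by simp
  next
    case (union A)
    then have A: "A i \<in> sets borel" for i by (auto simp: sets)
    have U: "(\<Union>i. A i) \<in> sets borel" using A by auto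
    let ?s = "\<lambda>n x. \<Sum>i<n. 1 * indicator (A i \<inter> box a b) x :: complex"
    have s: "?s n = indicator ((\<Union>i<n. A i) \<inter> box a b)" for n
    proof
      fix x
      have "disjoint_family_on (\<lambda>i. A i \<inter> box a b) {..<n}"
        using union(1) by (auto simp: disjoint_family_on_def)
      then have "indicator (\<Union>i<n. A i \<inter> box a b) x = (\<Sum>i<n. indicator (A i \<inter> box a b) x :: complex)"
        by (intro indicator_UN_disjoint) auto
      then show "?s n x = indicator ((\<Union>i<n. A i) \<inter> box a b) x" by simp
    qed
    note s' = fun_cong[OF s]
    show ?case
    proof (rule parseval_defect_limit[OF f sq_int_indicator_Int_box[OF U]])
      show "parseval_defect f (?s n) = 0" for n
        by (subst parseval_defect_sum[OF _ f]) (use sq_int_indicator_Int_box[OF A] union(3) in auto)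
      show "?s n \<in> borel_measurable lborel" for n
        unfolding s using A by (intro borel_measurable_indicator) auto
      show "cmod (?s n x) \<le> 2 * cmod (indicator ((\<Union>i. A i) \<inter> box a b) x)" for n x
        unfolding s' by (auto simp: indicator_def)
      show "(\<lambda>n. ?s n x) \<longlonglongrightarrow> indicator ((\<Union>i. A i) \<inter> box a b) x" for x
      proof -
        have "(\<lambda>n. indicator (\<Union>i<n. A i \<inter> box a b) x :: complex) \<longlonglongrightarrow> indicator (\<Union>i. A i \<inter> box a b) x"
          by (rule LIMSEQ_indicator_UN)
        then show ?thesis unfolding s' by simp
      qed
    qed
  qed
qed

text \<open>The auxiliary box is removed by exhausting the space with growing boxes.\<close>

lemma parseval_defect_indicator:
  fixes f :: "'a::euclidean_space \<Rightarrow> complex"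
  assumes f: "integrable lborel f" "sq_int f" and A: "A \<in> sets borel" "emeasure lborel A < \<infinity>"
  shows "parseval_defect f (indicator A) = 0"
proof (rule parseval_defect_limit[OF f sq_int_indicator[OF A]])
  let ?B = "\<lambda>n::nat. box (- (real n *\<^sub>R One)) (real n *\<^sub>R One) :: 'a set"
  show "parseval_defect f (indicator (A \<inter> ?B n)) = 0" for n
    by (rule parseval_defect_Int_box[OF f A(1)])
  show "indicator (A \<inter> ?B n) \<in> borel_measurable lborel" for n
    using A by (intro borel_measurable_indicator) auto
  show "cmod (indicator (A \<inter> ?B n) x) \<le> 2 * cmod (indicator A x)" for n x
    by (auto simp: indicator_def)
  show "(\<lambda>n. indicator (A \<inter> ?B n) x) \<longlonglongrightarrow> (indicator A x :: complex)" for x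
  proof -
    have "incseq (\<lambda>n. A \<inter> ?B n)"
      by (auto simp: incseq_def mem_box) (smt (verit) of_nat_le_iff)+
    then have "(\<lambda>n. indicator (A \<inter> ?B n) x :: complex) \<longlonglongrightarrow> indicator (\<Union>n. A \<inter> ?B n) x"
      by (rule LIMSEQ_indicator_incseq)
    moreover have "(\<Union>n. A \<inter> ?B n) = A" using UN_box_eq_UNIV[where 'a='a] by blast
    ultimately show ?thesis by simp
  qed
qed

theorem Parseval:
  fixes f g :: "'a::euclidean_space \<Rightarrow> complex"
  assumes f: "integrable lborel f" "sq_int f" and g: "integrable lborel g" "sq_int g"
  shows "L2inner (FT f) (FT g) = L2inner f g"
proof -
  obtain s where s: "\<And>i. simple_function lborel (s i)" "\<And>x. (\<lambda>i. s i x) \<longlonglongrightarrow> g x"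
    "\<And>i x. cmod (s i x) \<le> 2 * cmod (g x)"
    using borel_measurable_implies_sequence_metric[OF sq_int_measurable[OF g(2)], of 0] by auto
  have "parseval_defect f g = 0"
  proof (rule parseval_defect_limit[OF f g _ s(3) s(2)])
    fix i
    show m: "s i \<in> borel_measurable lborel" using s(1) by (rule borel_measurable_simple_function)
    \<comment> \<open>The value 0 is left out because its level set may have infinite measure. On
      the level set of y \<noteq> 0 the modulus of \<open>g\<close> is at least half that of y, so
      integrability of \<open>g\<close> makes the set finite in measure.\<close>
    define R where "R = s i ` UNIV - {0}"
    define P where "P y = s i -` {y}" for y
    have fin: "finite R" using s(1)[of i] by (auto simp: R_def simple_function_def)
    have P: "P y \<in> sets borel" "emeasure lborel (P y) < \<infinity>" if "y \<in> R" for y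
    proof -
      show "P y \<in> sets borel" using measurable_sets[OF m, of "{y}"] by (simp add: P_def)
      have y: "y \<noteq> 0" using that by (simp add: R_def)
      have "emeasure lborel (P y) = (\<integral>\<^sup>+x. indicator (P y) x \<partial>lborel)"
        using \<open>P y \<in> sets borel\<close> by simp
      also have "\<dots> \<le> (\<integral>\<^sup>+x. ennreal (norm (complex_of_real (2 / cmod y) * g x)) \<partial>lborel)"
      proof (rule nn_integral_mono)
        fix x
        show "indicator (P y) x \<le> ennreal (norm (complex_of_real (2 / cmod y) * g x))"
        proof (cases "s i x = y")
          case True
          then have "1 \<le> 2 / cmod y * cmod (g x)" using s(3)[of i x] y by (simp add: field_simps)
          then show ?thesis using True
            by (simp add: P_def norm_mult norm_divide ennreal_ge_1)
        qed (simp add: P_def)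
      qed
      also have "\<dots> < \<infinity>"
        using integrable_mult_right[OF g(1), of "complex_of_real (2 / cmod y)"]
        unfolding integrable_iff_bounded by blast
      finally show "emeasure lborel (P y) < \<infinity>" .
    qed
    have "s i = (\<lambda>x. \<Sum>y\<in>R. y * indicator (P y) x)"
    proof
      fix x
      have "(\<Sum>y\<in>R. y * indicator (P y) x) = (\<Sum>y\<in>R. if y = s i x then s i x else 0)"
        by (intro sum.cong) (auto simp: P_def indicator_def)
      also have "\<dots> = s i x" using fin by (simp add: R_def)
      finally show "s i x = (\<Sum>y\<in>R. y * indicator (P y) x)" by simp
    qed
    then have "parseval_defect f (s i) = parseval_defect f (\<lambda>x. \<Sum>y\<in>R. y * indicator (P y) x)"
      by (rule arg_cong)
    also have "\<dots> = (\<Sum>y\<in>R. cnj y * parseval_defect f (indicator (P y)))"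
      using sq_int_indicator P by (intro parseval_defect_sum f fin) auto
    also have "\<dots> = 0" using parseval_defect_indicator[OF f P] by simp
    finally show "parseval_defect f (s i) = 0" .
  qed
  then show ?thesis by (simp add: parseval_defect_def)
qed

subsection \<open>Weighted norms\<close>

lemma L2norm_nonneg [simp]: "0 \<le> L2norm f"
  by (simp add: L2norm_def)

lemma L2norm_sq: "(L2norm f)\<^sup>2 = (\<integral>x. (cmod (f x))\<^sup>2 \<partial>lborel)"
  by (simp add: L2norm_def)

lemma L2norm_FT:
  fixes f :: "'a::euclidean_space \<Rightarrow> complex"
  assumes "integrable lborel f" "sq_int f"
  shows "L2norm (FT f) = L2norm f"
proof -
  have "complex_of_real (\<integral>x. (cmod (FT f x))\<^sup>2 \<partial>lborel) = complex_of_real (\<integral>x. (cmod (f x))\<^sup>2 \<partial>lborel)"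
    using Parseval[OF assms assms]
    by (simp only: L2inner_def complex_norm_square[symmetric] integral_complex_of_real)
  then show ?thesis unfolding L2norm_def by (simp only: of_real_eq_iff)
qed

text \<open>Square integrability stands explicitly on the left because \<open>L2norm\<close> is 0 by
  convention when the integral diverges, so a bound on it alone would say nothing.\<close>

lemma L2norm_le_iff_nn_integral:
  assumes "0 \<le> m" and [measurable]: "f \<in> borel_measurable lborel"
  shows "(sq_int f \<and> L2norm f \<le> m) \<longleftrightarrow> (\<integral>\<^sup>+x. ennreal ((cmod (f x))\<^sup>2) \<partial>lborel) \<le> ennreal (m\<^sup>2)"
proof
  assume *: "sq_int f \<and> L2norm f \<le> m"
  have "(\<integral>\<^sup>+x. ennreal ((cmod (f x))\<^sup>2) \<partial>lborel) = ennreal ((L2norm f)\<^sup>2)"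
    unfolding L2norm_sq using * by (intro nn_integral_eq_integral) (auto simp: sq_int_def)
  also have "\<dots> \<le> ennreal (m\<^sup>2)" using * by (intro ennreal_leI power_mono) auto
  finally show "(\<integral>\<^sup>+x. ennreal ((cmod (f x))\<^sup>2) \<partial>lborel) \<le> ennreal (m\<^sup>2)" .
next
  assume *: "(\<integral>\<^sup>+x. ennreal ((cmod (f x))\<^sup>2) \<partial>lborel) \<le> ennreal (m\<^sup>2)"
  have i: "integrable lborel (\<lambda>x. (cmod (f x))\<^sup>2)"
    by (rule integrableI_nonneg) (use * in \<open>auto simp: less_top intro: le_less_trans\<close>)
  have "ennreal ((L2norm f)\<^sup>2) \<le> ennreal (m\<^sup>2)"
    using * nn_integral_eq_integral[OF i] unfolding L2norm_sq by simp
  then have "L2norm f \<le> m" using assms(1) by (auto intro: power2_le_imp_le)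
  with i show "sq_int f \<and> L2norm f \<le> m" by (simp add: sq_int_def)
qed

lemma L2norm_mono:
  fixes f g :: "'a::euclidean_space \<Rightarrow> complex"
  assumes [measurable]: "f \<in> borel_measurable lborel" and "sq_int g" and "\<And>x. cmod (f x) \<le> cmod (g x)"
  shows "sq_int f" "L2norm f \<le> L2norm g"
proof -
  have "(\<integral>\<^sup>+x. ennreal ((cmod (f x))\<^sup>2) \<partial>lborel) \<le> (\<integral>\<^sup>+x. ennreal ((cmod (g x))\<^sup>2) \<partial>lborel)"
    using assms by (intro nn_integral_mono ennreal_leI power_mono) auto
  also have "\<dots> \<le> ennreal ((L2norm g)\<^sup>2)"
    using L2norm_le_iff_nn_integral[of "L2norm g" g] assms(2) sq_int_measurable by auto
  finally show "sq_int f" "L2norm f \<le> L2norm g"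
    using L2norm_le_iff_nn_integral[of "L2norm g" f] by auto
qed

lemma L2norm_triangle:
  assumes "sq_int f" "sq_int g"
  shows "L2norm (\<lambda>x. f x + g x) \<le> L2norm f + L2norm g"
  using norm_triangle_ineq[of "l2_of f" "l2_of g"] assms by (simp add: l2_of_norm sq_int_add flip: l2_of_add)

lemma L2norm_mult: "L2norm (\<lambda>x. c * f x) = cmod c * L2norm f"
  by (simp add: L2norm_def norm_mult power_mult_distrib real_sqrt_mult)

section \<open>Agreement of the L2 Fourier transform with the integral\<close>

lemma fourier_trunc_eq_FT: "fourier_trunc f R = FT (\<lambda>x. indicator (ball 0 R) x * f x)"
  by (auto simp: fourier_trunc_def FT_def fun_eq_iff)

lemma indicator_mult_props:
  fixes f :: "'a::euclidean_space \<Rightarrow> complex"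
  assumes f: "integrable lborel f" "sq_int f" and A: "A \<in> sets borel"
  shows "integrable lborel (\<lambda>x. indicator A x * f x)" "sq_int (\<lambda>x. indicator A x * f x)"
proof -
  note [measurable] = sq_int_measurable[OF f(2)] A
  show "sq_int (\<lambda>x. indicator A x * f x)"
    by (rule L2norm_mono(1)[OF _ f(2)]) (auto simp: indicator_def)
  show "integrable lborel (\<lambda>x. indicator A x * f x)"
    by (rule Bochner_Integration.integrable_bound[OF f(1)]) (auto simp: indicator_def)
qed

text \<open>The transform is isometric, so the truncation error equals the norm of \<open>f\<close>
  outside the ball.\<close>

lemma is_fourier_L2_FT:
  fixes f :: "'a::euclidean_space \<Rightarrow> complex"
  assumes f: "integrable lborel f" "sq_int f"
  shows "is_fourier_L2 f (FT f)"
  unfolding is_fourier_L2_def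
proof
  show "sq_int (FT f)" by (rule FT_L2_bound(1)[OF f])
  note [measurable] = sq_int_measurable[OF f(2)]
  let ?g = "\<lambda>R x. indicator (ball 0 R) x * f x :: complex"
  have eq: "L2norm (\<lambda>\<xi>. FT f \<xi> - fourier_trunc f R \<xi>) = L2norm (\<lambda>x. f x - ?g R x)" for R
  proof -
    have g: "integrable lborel (?g R)" "sq_int (?g R)" by (rule indicator_mult_props[OF f]; simp)+
    have "(\<lambda>\<xi>. FT f \<xi> - fourier_trunc f R \<xi>) = FT (\<lambda>x. f x - ?g R x)"
      unfolding fourier_trunc_eq_FT by (intro ext FT_diff[symmetric] f g)
    then show ?thesis using f g by (simp add: L2norm_FT sq_int_diff)
  qed
  have "((\<lambda>R. \<integral>x. (cmod (f x - ?g R x))\<^sup>2 \<partial>lborel) \<longlongrightarrow> (\<integral>x. 0 \<partial>(lborel :: 'a measure))) at_top"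
  proof (rule integral_dominated_convergence_at_top)
    show "integrable lborel (\<lambda>x. (cmod (f x))\<^sup>2)" using f by (simp add: sq_int_def)
    show "\<forall>\<^sub>F R in at_top. AE x in lborel. norm ((cmod (f x - ?g R x))\<^sup>2) \<le> (cmod (f x))\<^sup>2"
      by (auto simp: indicator_def intro!: always_eventually)
    show "AE x in lborel. ((\<lambda>R. (cmod (f x - ?g R x))\<^sup>2) \<longlongrightarrow> 0) at_top"
    proof (rule AE_I2)
      fix x
      have "eventually (\<lambda>R. (cmod (f x - ?g R x))\<^sup>2 = 0) at_top"
        using eventually_gt_at_top[of "norm x"] by eventually_elim simp
      then show "((\<lambda>R. (cmod (f x - ?g R x))\<^sup>2) \<longlongrightarrow> 0) at_top"
        by (rule tendsto_eventually)
    qed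
    show "(\<lambda>x. (cmod (f x - ?g R x))\<^sup>2) \<in> borel_measurable lborel" for R
      by (intro borel_measurable_integrable sq_int_integrable sq_int_diff f indicator_mult_props) simp
  qed simp
  then have "((\<lambda>R. sqrt (\<integral>x. (cmod (f x - ?g R x))\<^sup>2 \<partial>lborel)) \<longlongrightarrow> sqrt 0) at_top"
    by (intro tendsto_real_sqrt) simp
  then show "((\<lambda>R. L2norm (\<lambda>\<xi>. FT f \<xi> - fourier_trunc f R \<xi>)) \<longlongrightarrow> 0) at_top"
    unfolding eq by (simp add: L2norm_def)
qed

text \<open>The truncations have only one limit in the square norm, so whichever representative
  \<open>fourier_L2\<close> selects agrees with \<open>FT f\<close> almost everywhere.\<close>

lemma fourier_L2_AE_eq_FT:
  fixes f :: "'a::euclidean_space \<Rightarrow> complex"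
  assumes f: "integrable lborel f" "sq_int f"
  shows "sq_int (fourier_L2 f)" "AE \<xi> in lborel. fourier_L2 f \<xi> = FT f \<xi>"
proof -
  have F: "is_fourier_L2 f (fourier_L2 f)"
    using someI[of "is_fourier_L2 f", OF is_fourier_L2_FT[OF f]] by (simp only: fourier_L2_def)
  then show s: "sq_int (fourier_L2 f)" by (simp add: is_fourier_L2_def)
  let ?t = "\<lambda>R. l2_of (fourier_trunc f R)"
  have t: "sq_int (fourier_trunc f R)" for R
    unfolding fourier_trunc_eq_FT by (intro FT_L2_bound indicator_mult_props f) simp_all
  have nt: "((\<lambda>R. norm (l2_of g - ?t R)) \<longlongrightarrow> 0) at_top" if "is_fourier_L2 f g" for g
    using that t by (simp add: is_fourier_L2_def l2_of_norm sq_int_diff flip: l2_of_diff)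
  have "((\<lambda>R. ?t R) \<longlongrightarrow> l2_of g) at_top" if "is_fourier_L2 f g" for g
  proof -
    have "((\<lambda>R. l2_of g - ?t R) \<longlongrightarrow> 0) at_top"
      using nt[OF that] by (rule tendsto_norm_zero_cancel)
    from tendsto_diff[OF tendsto_const[of "l2_of g"] this] show ?thesis by simp
  qed
  then have "l2_of (fourier_L2 f) = l2_of (FT f)"
    using F is_fourier_L2_FT[OF f] tendsto_unique[OF trivial_limit_at_top_linorder] by blast
  then show "AE \<xi> in lborel. fourier_L2 f \<xi> = FT f \<xi>"
    using s FT_L2_bound(1)[OF f] by (simp add: l2_of_eq_iff)
qed

section \<open>Power weights: integrability and decay of inner products\<close>

lemma integrable_inverse_weight:
  assumes s: "real DIM('a::euclidean_space) < 2 * s"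
  shows "integrable lborel (\<lambda>x::'a. 1 / (1 + norm (x - a) powr (2 * s)))"
proof -
  define d where "d = real DIM('a)"
  let ?w = "\<lambda>x::'a. 1 / (1 + norm (x - a) powr (2 * s))"
  \<comment> \<open>The value of the weight \<open>1 / r^(2 s)\<close> at the inner radius of shell
    k. Multiplied by the volume of the ball of radius \<open>2 ^ Suc k\<close>, it gives a geometric
    series with ratio \<open>2 powr (d - 2 * s)\<close>.\<close>
  define c where "c k = 2 powr (- (2 * s) * real k)" for k :: nat
  have s0: "0 < s" using s by (smt (verit) of_nat_0_le_iff)
  have pw: "ennreal (?w x) \<le> indicator (cball a 1) x + (\<Sum>k. ennreal (c k) * indicator (cball a (2 ^ Suc k)) x)" for x
  proof (cases "norm (x - a) \<le> 1")
    case True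
    have "ennreal (?w x) \<le> 1" by (simp add: ennreal_le_1 add_pos_nonneg field_simps)
    also have "\<dots> \<le> indicator (cball a 1) x + (\<Sum>k. ennreal (c k) * indicator (cball a (2 ^ Suc k)) x)"
      using True by (simp add: dist_norm norm_minus_commute indicator_def)
    finally show ?thesis .
  next
    case False
    then obtain k where k: "2 ^ k < norm (x - a)" "norm (x - a) \<le> 2 ^ Suc k"
      using dyadic_interval[of "norm (x - a)"] by auto
    have "(2 ^ k) powr (2 * s) \<le> norm (x - a) powr (2 * s)" using k(1) s0 by (intro powr_mono2) auto
    then have "?w x \<le> 1 / (2 ^ k) powr (2 * s)" by (intro divide_left_mono mult_pos_pos add_pos_nonneg) auto
    also have "\<dots> = c k" 
    proof -
      have "(2 ^ k) powr (2 * s) = (2 powr real k) powr (2 * s)" by (simp add: powr_realpow)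
      also have "\<dots> = 2 powr (2 * s * real k)" by (simp add: powr_powr mult.commute)
      finally show ?thesis by (simp add: c_def powr_minus_divide)
    qed
    finally have "ennreal (?w x) \<le> ennreal (c k) * indicator (cball a (2 ^ Suc k)) x"
      using k(2) by (auto simp: dist_norm norm_minus_commute indicator_def intro!: ennreal_leI)
    also have "\<dots> \<le> (\<Sum>k. ennreal (c k) * indicator (cball a (2 ^ Suc k)) x)"
    proof -
      have "t k \<le> suminf t" for t :: "nat \<Rightarrow> ennreal"
        using sum_le_suminf[of t "{k}"] by simp
      then show ?thesis .
    qed
    also have "\<dots> \<le> indicator (cball a 1) x + \<dots>" by simp
    finally show ?thesis .
  qed
  define v where "v = unit_ball_vol d"
  have v: "0 \<le> v" by (simp add: v_def d_def)
  have "(\<integral>\<^sup>+x. ennreal (?w x) \<partial>lborel) \<le> (\<integral>\<^sup>+x. indicator (cball a 1) x + (\<Sum>k. ennreal (c k) * indicator (cball a (2 ^ Suc k)) x) \<partial>lborel)"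
    by (intro nn_integral_mono pw)
  also have "\<dots> = emeasure lborel (cball a 1) + (\<Sum>k. ennreal (c k) * emeasure lborel (cball a (2 ^ Suc k)))"
  proof -
    have [measurable]: "cball a r \<in> sets borel" for r :: real by simp
    have "(\<lambda>x. \<Sum>k. ennreal (c k) * indicator (cball a (2 ^ Suc k)) x) \<in> borel_measurable lborel"
      by measurable
    then show ?thesis
      by (subst nn_integral_add) (auto simp: nn_integral_suminf nn_integral_cmult simp del: power_Suc)
  qed
  finally have le: "(\<integral>\<^sup>+x. ennreal (?w x) \<partial>lborel) \<le> emeasure lborel (cball a 1) + (\<Sum>k. ennreal (c k) * emeasure lborel (cball a (2 ^ Suc k)))" .
  have "(\<Sum>k. ennreal (c k) * emeasure lborel (cball a (2 ^ Suc k))) = (\<Sum>k. ennreal (v * 2 ^ DIM('a) * (2 powr (d - 2 * s)) ^ k))"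
  proof (intro suminf_cong)
    fix k
    have "emeasure lborel (cball a (2 ^ Suc k)) = ennreal (v * (2 ^ Suc k) ^ DIM('a))"
      by (subst emeasure_cball) (auto simp: v_def d_def)
    moreover have "c k * (v * (2 ^ Suc k) ^ DIM('a)) = v * 2 ^ DIM('a) * (2 powr (d - 2 * s)) ^ k"
    proof -
      have "2 powr (d * real k) = 2 powr real (k * DIM('a))" by (simp add: d_def mult.commute)
      also have "\<dots> = ((2::real) ^ k) ^ DIM('a)" by (simp add: powr_realpow power_mult del: of_nat_mult)
      finally have "c k * ((2::real) ^ k) ^ DIM('a) = 2 powr (- (2 * s) * real k + d * real k)"
        by (simp only: c_def powr_add)
      also have "\<dots> = 2 powr ((d - 2 * s) * real k)" by (simp add: algebra_simps)
      also have "\<dots> = (2 powr (d - 2 * s)) powr real k" by (rule powr_powr[symmetric])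
      also have "\<dots> = (2 powr (d - 2 * s)) ^ k" by (rule powr_realpow) simp
      finally have "c k * ((2::real) ^ k) ^ DIM('a) = (2 powr (d - 2 * s)) ^ k" .
      then show ?thesis by (simp add: power_mult_distrib)
    qed
    ultimately show "ennreal (c k) * emeasure lborel (cball a (2 ^ Suc k)) = ennreal (v * 2 ^ DIM('a) * (2 powr (d - 2 * s)) ^ k)"
      using v by (simp add: c_def flip: ennreal_mult)
  qed
  also have "\<dots> < \<infinity>"
  proof -
    have "2 powr (d - 2 * s) < 2 powr 0" using s by (intro powr_less_mono) (auto simp: d_def)
    then have "summable (\<lambda>k. v * 2 ^ DIM('a) * (2 powr (d - 2 * s)) ^ k)"
      by (intro summable_mult summable_geometric) auto
    then have "(\<Sum>k. ennreal (v * 2 ^ DIM('a) * (2 powr (d - 2 * s)) ^ k)) = ennreal (\<Sum>k. v * 2 ^ DIM('a) * (2 powr (d - 2 * s)) ^ k)"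
      using v by (intro suminf_ennreal2) auto
    then show ?thesis by simp
  qed
  finally have *: "(\<Sum>k. ennreal (c k) * emeasure lborel (cball a (2 ^ Suc k))) < \<infinity>" .
  have "(\<integral>\<^sup>+x. ennreal (?w x) \<partial>lborel) < \<infinity>"
    by (rule le_less_trans[OF le]) (use * in \<open>simp add: less_top[symmetric] emeasure_cball\<close>)
  then show ?thesis by (intro integrableI_nonneg) auto
qed

text \<open>The exponent is \<open>s\<close>, so that the squared norm of the weighted function is
  the moment of order \<open>2 s\<close> in the theorem.\<close>

definition weighted :: "real \<Rightarrow> 'a::euclidean_space \<Rightarrow> ('a \<Rightarrow> complex) \<Rightarrow> 'a \<Rightarrow> complex" where
  "weighted s a f = (\<lambda>x. complex_of_real (norm (x - a) powr s) * f x)"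

lemma cmod_weighted: "cmod (weighted s a f x) = norm (x - a) powr s * cmod (f x)"
  by (simp add: weighted_def norm_mult)

lemma cmod_weighted_sq: "(cmod (weighted s a f x))\<^sup>2 = norm (x - a) powr (2 * s) * (cmod (f x))\<^sup>2"
  by (simp add: cmod_weighted power_mult_distrib powr_sq)

lemma weighted_measurable [measurable]:
  assumes [measurable]: "f \<in> borel_measurable lborel"
  shows "weighted s a f \<in> borel_measurable lborel"
  unfolding weighted_def by measurable

text \<open>With W = 1 + |x - a|^(2 s), the elementary bound r \<le> r^2 W + 1 / W splits |f| into
  two integrable pieces. Integrability is what allows the transform to be handled as an
  integral.\<close>

lemma integrable_of_weighted:
  fixes f :: "'a::euclidean_space \<Rightarrow> complex"
  assumes s: "real DIM('a) < 2 * s" and f: "sq_int f" and w: "sq_int (weighted s a f)"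
  shows "integrable lborel f"
proof (rule Bochner_Integration.integrable_bound)
  let ?w = "\<lambda>x. norm (x - a) powr (2 * s)"
  show "integrable lborel (\<lambda>x. ((cmod (f x))\<^sup>2 + (cmod (weighted s a f x))\<^sup>2) + 1 / (1 + ?w x))"
    using f w by (intro Bochner_Integration.integrable_add integrable_inverse_weight[OF s]) (auto simp: sq_int_def)
  show "f \<in> borel_measurable lborel" by (rule sq_int_measurable[OF f])
  show "AE x in lborel. norm (f x) \<le> norm (((cmod (f x))\<^sup>2 + (cmod (weighted s a f x))\<^sup>2) + 1 / (1 + ?w x))"
  proof (rule AE_I2)
    fix x
    have "r \<le> r\<^sup>2 * W + 1 / W" if "0 < W" "0 \<le> r" for r W :: real
    proof -
      have "2 * (r * W) * 1 \<le> (r * W)\<^sup>2 + 1\<^sup>2" by (rule sum_squares_bound)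
      moreover have "0 \<le> r * W" using that by simp
      ultimately have "r * W \<le> (r * W)\<^sup>2 + 1" by simp
      moreover have "(r\<^sup>2 * W + 1 / W) * W = (r * W)\<^sup>2 + 1"
        using that by (simp add: power2_eq_square distrib_right)
      ultimately have "r * W \<le> (r\<^sup>2 * W + 1 / W) * W" by simp
      then show ?thesis using that(1) by (rule mult_right_le_imp_le)
    qed
    from this[of "1 + ?w x" "cmod (f x)"]
    have "cmod (f x) \<le> ((cmod (f x))\<^sup>2 + (cmod (weighted s a f x))\<^sup>2) + 1 / (1 + ?w x)"
      by (simp add: cmod_weighted_sq add_pos_nonneg algebra_simps)
    then show "norm (f x) \<le> norm (((cmod (f x))\<^sup>2 + (cmod (weighted s a f x))\<^sup>2) + 1 / (1 + ?w x))"
      by simp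
  qed
qed

lemma norm_triangle_powr:
  assumes "0 \<le> s"
  shows "norm (a - b) powr s \<le> 2 powr s * (norm (x - a) powr s + norm (x - b) powr s)"
proof -
  let ?m = "max (norm (x - a)) (norm (x - b))"
  have "norm (a - b) \<le> norm (x - a) + norm (x - b)"
    using norm_triangle_ineq4[of "x - b" "x - a"] by simp
  then have "norm (a - b) powr s \<le> (2 * ?m) powr s" using assms by (intro powr_mono2) auto
  also have "\<dots> = 2 powr s * ?m powr s" by (simp add: powr_mult)
  also have "?m powr s \<le> norm (x - a) powr s + norm (x - b) powr s" by (simp add: max_def)
  finally show ?thesis by simp
qed

text \<open>The triangle inequality distributes the distance of the centres over the weights of
  \<open>f\<close> and \<open>g\<close>; Cauchy-Schwarz handles each part.\<close>

lemma L2inner_decay: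
  fixes f g :: "'a::euclidean_space \<Rightarrow> complex"
  assumes s: "0 \<le> s" and f: "sq_int f" "sq_int (weighted s a f)" and g: "sq_int g" "sq_int (weighted s b g)"
  shows "norm (a - b) powr s * cmod (L2inner f g) \<le> 2 powr s * (L2norm (weighted s a f) * L2norm g + L2norm f * L2norm (weighted s b g))"
proof -
  have prod: "integrable lborel (\<lambda>x. cmod (f x) * cmod (g x))" if "sq_int f" "sq_int g" for f g :: "'a \<Rightarrow> complex"
    using integrable_norm[OF integrable_sq_int_mult[OF that]] by (simp add: norm_mult)
  have "norm (a - b) powr s * cmod (L2inner f g) \<le> norm (a - b) powr s * (\<integral>x. cmod (f x) * cmod (g x) \<partial>lborel)"
    using integral_norm_bound[of lborel "\<lambda>x. f x * cnj (g x)"]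
    by (intro mult_left_mono) (auto simp: L2inner_def norm_mult)
  also have "\<dots> = (\<integral>x. norm (a - b) powr s * (cmod (f x) * cmod (g x)) \<partial>lborel)" by simp
  also have "\<dots> \<le> (\<integral>x. 2 powr s * (cmod (weighted s a f x) * cmod (g x) + cmod (f x) * cmod (weighted s b g x)) \<partial>lborel)"
  proof (rule integral_mono)
    fix x
    have "norm (a - b) powr s * (cmod (f x) * cmod (g x)) \<le>
      2 powr s * (norm (x - a) powr s + norm (x - b) powr s) * (cmod (f x) * cmod (g x))"
      by (intro mult_right_mono norm_triangle_powr s) simp
    then show "norm (a - b) powr s * (cmod (f x) * cmod (g x)) \<le>
      2 powr s * (cmod (weighted s a f x) * cmod (g x) + cmod (f x) * cmod (weighted s b g x))"
      by (simp add: cmod_weighted algebra_simps)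
  qed (intro integrable_mult_right Bochner_Integration.integrable_add prod f g)+
  also have "\<dots> = 2 powr s * ((\<integral>x. cmod (weighted s a f x) * cmod (g x) \<partial>lborel) + (\<integral>x. cmod (f x) * cmod (weighted s b g x) \<partial>lborel))"
    by (simp add: prod f g)
  also have "\<dots> \<le> 2 powr s * (L2norm (weighted s a f) * L2norm g + L2norm f * L2norm (weighted s b g))"
    by (intro mult_left_mono add_mono Cauchy_Schwarz_integral_cmod f g) simp
  finally show ?thesis .
qed

subsection \<open>Riesz bases as real Riesz families\<close>

lemma L2norm_cong_AE:
  assumes "sq_int f" "sq_int g" "AE x in lborel. f x = g x"
  shows "L2norm f = L2norm g"
  using assms l2_of_eq_iff[of f g] l2_of_norm[of f] l2_of_norm[of g] by simp

lemma L2inner_sum_left: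
  assumes "\<And>i. i \<in> I \<Longrightarrow> sq_int (f i)" "sq_int g"
  shows "L2inner (\<lambda>x. \<Sum>i\<in>I. z i * f i x) g = (\<Sum>i\<in>I. z i * L2inner (f i) g)"
proof -
  have "L2inner (\<lambda>x. \<Sum>i\<in>I. z i * f i x) g = (\<integral>x. (\<Sum>i\<in>I. z i * (f i x * cnj (g x))) \<partial>lborel)"
    unfolding L2inner_def by (simp only: sum_distrib_right mult.assoc)
  also have "\<dots> = (\<Sum>i\<in>I. (\<integral>x. z i * (f i x * cnj (g x)) \<partial>lborel))"
    using assms by (intro Bochner_Integration.integral_sum integrable_mult_right integrable_sq_int_mult) auto
  finally show ?thesis by (simp add: L2inner_def)
qed

lemma L2inner_cnj: "L2inner g f = cnj (L2inner f g)"
  unfolding L2inner_def Bochner_Integration.integral_cnj[symmetric] by (simp add: mult.commute)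

lemma L2inner_self: "L2inner f f = complex_of_real ((L2norm f)\<^sup>2)"
  unfolding L2norm_sq L2inner_def by (simp only: complex_norm_square[symmetric] integral_complex_of_real)

lemma L2norm_orthonormal_sum:
  assumes e: "\<And>n. sq_int (e n)" and o: "\<And>m n. L2inner (e m) (e n) = (if m = n then 1 else 0)"
    and H: "finite H"
  shows "(L2norm (\<lambda>x. \<Sum>n\<in>H. z n * e n x))\<^sup>2 = (\<Sum>n\<in>H. (cmod (z n))\<^sup>2)"
proof -
  let ?\<phi> = "\<lambda>x. \<Sum>n\<in>H. z n * e n x"
  have \<phi>: "sq_int ?\<phi>" by (intro sq_int_sum sq_int_mult e)
  have "L2inner (e m) ?\<phi> = (if m \<in> H then cnj (z m) else 0)" for m
  proof -
    have "L2inner ?\<phi> (e m) = (\<Sum>n\<in>H. if n = m then z m else 0)"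
      by (subst L2inner_sum_left) (auto simp: e o intro!: sum.cong)
    then have "L2inner ?\<phi> (e m) = (if m \<in> H then z m else 0)" using H by simp
    then show ?thesis by (subst L2inner_cnj) simp
  qed
  then have "L2inner ?\<phi> ?\<phi> = (\<Sum>n\<in>H. z n * cnj (z n))"
    by (subst L2inner_sum_left) (auto intro: e \<phi>)
  also have "\<dots> = complex_of_real (\<Sum>n\<in>H. (cmod (z n))\<^sup>2)"
    by (simp only: of_real_sum complex_norm_square)
  finally show ?thesis unfolding L2inner_self by (simp only: of_real_eq_iff)
qed

lemma L2_bounded_op_sum:
  assumes T: "L2_bounded_op T" and e: "\<And>n. sq_int (e n)" and f: "\<And>n. AE x in lborel. f n x = T (e n) x"
    and H: "finite H"
  shows "AE x in lborel. T (\<lambda>x. \<Sum>n\<in>H. z n * e n x) x = (\<Sum>n\<in>H. z n * f n x)"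
  using H
proof (induction H rule: finite_induct)
  case empty
  \<comment> \<open>Linearity at zero arguments gives T 0 = T 0 + T 0, hence T 0 = 0 almost
    everywhere.\<close>
  have "AE x in lborel. T (\<lambda>y. 0 + 1 * 0) x = T (\<lambda>y. 0) x + 1 * T (\<lambda>y. 0) x"
    using T sq_int_zero unfolding L2_bounded_op_def by blast
  then show ?case by simp
next
  case (insert m H)
  have s: "sq_int (\<lambda>x. \<Sum>n\<in>H. z n * e n x)" by (intro sq_int_sum sq_int_mult e)
  have "AE x in lborel. T (\<lambda>y. (\<Sum>n\<in>H. z n * e n y) + z m * e m y) x = T (\<lambda>x. \<Sum>n\<in>H. z n * e n x) x + z m * T (e m) x"
    using T s e[of m] unfolding L2_bounded_op_def by blast
  with insert.IH f[of m] show ?case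
    by eventually_elim (simp add: insert.hyps add.commute)
qed

lemma L2_bounded_op_bound:
  assumes "L2_bounded_op T"
  obtains C where "1 \<le> C" "\<And>f. sq_int f \<Longrightarrow> L2norm (T f) \<le> C * L2norm f"
proof -
  have "\<exists>C. \<forall>f. sq_int f \<longrightarrow> L2norm (T f) \<le> C * L2norm f"
    using assms unfolding L2_bounded_op_def by simp
  then obtain C where "\<forall>f. sq_int f \<longrightarrow> L2norm (T f) \<le> C * L2norm f" ..
  then have C: "L2norm (T f) \<le> C * L2norm f" if "sq_int f" for f using that by simp
  have "L2norm (T f) \<le> max 1 C * L2norm f" if "sq_int f" for f
    using C[OF that] mult_right_mono[OF max.cobounded2[of C 1], of "L2norm f"] by simp
  then show ?thesis by (intro that[OF max.cobounded1])
qed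

lemma L2_bounded_op_diff:
  assumes T: "L2_bounded_op T" and "sq_int f" "sq_int g"
  shows "AE x in lborel. T (\<lambda>y. f y - g y) x = T f x - T g x"
proof -
  have "AE x in lborel. T (\<lambda>y. f y + (-1) * g y) x = T f x + (-1) * T g x"
    using assms unfolding L2_bounded_op_def by blast
  then show ?thesis by simp
qed

text \<open>A common bound \<open>C\<close> for \<open>T\<close> and its inverse \<open>S\<close>
  transfers the orthonormal identities. For density, \<open>S g\<close> is approximated in the
  orthonormal basis and mapped back by \<open>T\<close>; the last clause also controls the
  coefficients, which the lower frame bound will need.\<close>

lemma riesz_basis_bounds:
  fixes f :: "nat \<Rightarrow> 'a::euclidean_space \<Rightarrow> complex"
  assumes "L2_riesz_basis f"
  obtains C where "1 \<le> C"
    and "\<And>H z. finite H \<Longrightarrow> L2norm (\<lambda>x. \<Sum>n\<in>H. z n * f n x) \<le> C * sqrt (\<Sum>n\<in>H. (cmod (z n))\<^sup>2)"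
    and "\<And>H z. finite H \<Longrightarrow> sqrt (\<Sum>n\<in>H. (cmod (z n))\<^sup>2) \<le> C * L2norm (\<lambda>x. \<Sum>n\<in>H. z n * f n x)"
    and "\<And>g \<epsilon>. sq_int g \<Longrightarrow> 0 < \<epsilon> \<Longrightarrow> \<exists>(N::nat) z. L2norm (\<lambda>x. g x - (\<Sum>n<N. z n * f n x)) \<le> \<epsilon> \<and>
      sqrt (\<Sum>n<N. (cmod (z n))\<^sup>2) \<le> C * L2norm g + \<epsilon>"
proof -
  obtain e T S where f: "\<And>n. sq_int (f n)" and oe: "L2_orthonormal_basis e" and T: "L2_bounded_op T" and S: "L2_bounded_op S"
    and ST: "\<And>g. sq_int g \<Longrightarrow> AE x in lborel. S (T g) x = g x"
    and TS: "\<And>g. sq_int g \<Longrightarrow> AE x in lborel. T (S g) x = g x"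
    and fT: "\<And>n. AE x in lborel. f n x = T (e n) x"
    using assms unfolding L2_riesz_basis_def by auto
  have e: "\<And>n. sq_int (e n)" and o: "\<And>m n. L2inner (e m) (e n) = (if m = n then 1 else 0)"
    and dense: "\<And>g \<epsilon>. sq_int g \<Longrightarrow> 0 < \<epsilon> \<Longrightarrow> \<exists>N c. L2norm (\<lambda>x. g x - (\<Sum>n<N. c n * e n x)) < \<epsilon>"
    using oe unfolding L2_orthonormal_basis_def by auto
  have sT: "sq_int (T g)" and sS: "sq_int (S g)" if "sq_int g" for g
    using T S that unfolding L2_bounded_op_def by auto
  obtain CT where CT: "1 \<le> CT" "\<And>g. sq_int g \<Longrightarrow> L2norm (T g) \<le> CT * L2norm g"
    using L2_bounded_op_bound[OF T] by metis
  obtain CS where CS: "1 \<le> CS" "\<And>g. sq_int g \<Longrightarrow> L2norm (S g) \<le> CS * L2norm g"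
    using L2_bounded_op_bound[OF S] by metis
  define C where "C = max CT CS"
  have C1: "1 \<le> C" using CT by (simp add: C_def)
  have CTb: "L2norm (T g) \<le> C * L2norm g" if "sq_int g" for g
    using CT(2)[OF that] mult_right_mono[of CT C "L2norm g"] by (simp add: C_def)
  have CSb: "L2norm (S g) \<le> C * L2norm g" if "sq_int g" for g
    using CS(2)[OF that] mult_right_mono[of CS C "L2norm g"] by (simp add: C_def)
  let ?e = "\<lambda>H z x. \<Sum>n\<in>H. z n * e n x" and ?f = "\<lambda>H z x. \<Sum>n\<in>H. z n * f n x"
  have se: "sq_int (?e H z)" and sf: "sq_int (?f H z)" for H z
    by (intro sq_int_sum sq_int_mult e f)+
  have ne: "sqrt (\<Sum>n\<in>H. (cmod (z n))\<^sup>2) = L2norm (?e H z)" if "finite H" for H z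
    by (simp add: L2norm_orthonormal_sum[OF e o that, symmetric])
  have Tef: "AE x in lborel. T (?e H z) x = ?f H z x" if "finite H" for H z
    by (rule L2_bounded_op_sum[OF T e fT that])
  have nf: "L2norm (T (?e H z)) = L2norm (?f H z)" if "finite H" for H z
    by (rule L2norm_cong_AE[OF sT[OF se] sf Tef[OF that]])
  show thesis
  proof (rule that[OF C1])
    fix H :: "nat set" and z assume H: "finite H"
    show "L2norm (?f H z) \<le> C * sqrt (\<Sum>n\<in>H. (cmod (z n))\<^sup>2)"
      using CTb[OF se[where H=H and z=z]] by (simp add: ne[OF H] nf[OF H])
    have "L2norm (?e H z) = L2norm (S (T (?e H z)))"
      by (rule L2norm_cong_AE[OF se sS[OF sT[OF se]]]) (rule eventually_mono[OF ST[OF se[where H=H and z=z]]], simp)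
    also have "\<dots> \<le> C * L2norm (T (?e H z))" by (rule CSb[OF sT[OF se]])
    finally show "sqrt (\<Sum>n\<in>H. (cmod (z n))\<^sup>2) \<le> C * L2norm (?f H z)"
      by (simp add: ne[OF H] nf[OF H])
  next
    fix g :: "'a \<Rightarrow> complex" and \<epsilon> :: real assume g: "sq_int g" and \<epsilon>: "0 < \<epsilon>"
    obtain N z where Nz: "L2norm (\<lambda>x. S g x - ?e {..<N} z x) < \<epsilon> / C"
      using dense[OF sS[OF g], of "\<epsilon> / C"] \<epsilon> C1 by auto
    let ?d = "\<lambda>x. S g x - ?e {..<N} z x"
    have d: "sq_int ?d" by (intro sq_int_diff sS g se)
    have "AE x in lborel. T ?d x = g x - ?f {..<N} z x"
      using L2_bounded_op_diff[OF T sS[OF g] se[where H="{..<N}" and z=z]] TS[OF g] Tef[where H="{..<N}" and z=z, simplified]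
      by eventually_elim simp
    then have "L2norm (T ?d) = L2norm (\<lambda>x. g x - ?f {..<N} z x)"
      by (intro L2norm_cong_AE sT d sq_int_diff g sf)
    moreover have "L2norm (T ?d) \<le> C * L2norm ?d" by (rule CTb[OF d])
    moreover have "C * L2norm ?d \<le> \<epsilon>" using Nz C1 by (simp add: field_simps)
    ultimately have 1: "L2norm (\<lambda>x. g x - ?f {..<N} z x) \<le> \<epsilon>" by simp
    have "L2norm (?e {..<N} z) = L2norm (\<lambda>x. S g x + (- 1) * ?d x)" by simp
    also have "\<dots> \<le> L2norm (S g) + L2norm (\<lambda>x. (- 1) * ?d x)"
      by (intro L2norm_triangle sS g sq_int_mult d)
    also have "L2norm (\<lambda>x. (- 1) * ?d x) = L2norm ?d"
      unfolding L2norm_mult by simp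
    also have "L2norm ?d \<le> \<epsilon>" 
      using mult_right_mono[OF C1, of "L2norm ?d"] \<open>C * L2norm ?d \<le> \<epsilon>\<close> by simp
    finally have "L2norm (?e {..<N} z) \<le> C * L2norm g + \<epsilon>" using CSb[OF g] by simp
    with 1 show "\<exists>(N::nat) z. L2norm (\<lambda>x. g x - ?f {..<N} z x) \<le> \<epsilon> \<and> sqrt (\<Sum>n<N. (cmod (z n))\<^sup>2) \<le> C * L2norm g + \<epsilon>"
      by (intro exI[of _ N] exI[of _ z]) (simp add: ne)
  qed
qed

definition phase :: "bool \<Rightarrow> complex" where "phase b = (if b then \<i> else 1)"

lemma cmod_phase [simp]: "cmod (phase b) = 1" by (simp add: phase_def)

text \<open>The complex span of the \<open>f n\<close> is the real span of the \<open>f n\<close> and \<open>\<i> f n\<close>.\<close>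

definition realify :: "(nat \<Rightarrow> 'a::euclidean_space \<Rightarrow> complex) \<Rightarrow> nat \<times> bool \<Rightarrow> 'a l2" where
  "realify f i = l2_of (\<lambda>x. phase (snd i) * f (fst i) x)"

lemma realify_pair:
  assumes "\<And>n. sq_int (f n)"
  shows "c *\<^sub>R realify f (n, False) + d *\<^sub>R realify f (n, True) = l2_of (\<lambda>x. Complex c d * f n x)"
proof -
  have "l2_of (\<lambda>x. Complex c d * f n x) = l2_of (\<lambda>x. c *\<^sub>R (phase False * f n x) + d *\<^sub>R (phase True * f n x))"
    by (simp add: phase_def scaleR_conv_of_real complex_eq_iff[of "Complex c d * _"] algebra_simps Complex_eq)
  then show ?thesis
    using assms by (simp add: realify_def l2_of_add l2_of_scaleR sq_int_mult sq_int_scaleR)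
qed

text \<open>The index set may contain only one of the two copies of some \<open>f n\<close>; the
  missing real or imaginary part of the complex coefficient is then 0.\<close>

lemma realify_sum:
  assumes f: "\<And>n. sq_int (f n)" and G: "finite G"
  defines "z \<equiv> \<lambda>c n. Complex (if (n, False) \<in> G then c (n, False) else 0) (if (n, True) \<in> G then c (n, True) else 0)"
  shows "(\<Sum>i\<in>G. c i *\<^sub>R realify f i) = l2_of (\<lambda>x. \<Sum>n\<in>fst ` G. z c n * f n x)"
    and "(\<Sum>i\<in>G. (c i)\<^sup>2) = (\<Sum>n\<in>fst ` G. (cmod (z c n))\<^sup>2)"
proof -
  let ?H = "fst ` G" and ?c = "\<lambda>i. if i \<in> G then c i else (0::real)"
  have sub: "G \<subseteq> ?H \<times> UNIV" by force
  have fin: "finite (?H \<times> (UNIV :: bool set))" using G by simp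
  have "(\<Sum>i\<in>G. c i *\<^sub>R realify f i) = (\<Sum>i\<in>?H \<times> UNIV. ?c i *\<^sub>R realify f i)"
    by (rule sum.mono_neutral_cong_left[OF fin sub]) auto
  also have "\<dots> = (\<Sum>n\<in>?H. \<Sum>b\<in>UNIV. ?c (n, b) *\<^sub>R realify f (n, b))"
    by (simp add: sum.cartesian_product case_prod_beta) (intro sum.cong refl, auto)
  also have "\<dots> = (\<Sum>n\<in>?H. l2_of (\<lambda>x. z c n * f n x))"
    unfolding z_def by (intro sum.cong refl, subst realify_pair[OF f, symmetric]) (simp add: UNIV_bool add.commute)
  also have "\<dots> = l2_of (\<lambda>x. \<Sum>n\<in>?H. z c n * f n x)"
    by (intro l2_of_sum[symmetric] sq_int_mult f)
  finally show "(\<Sum>i\<in>G. c i *\<^sub>R realify f i) = l2_of (\<lambda>x. \<Sum>n\<in>fst ` G. z c n * f n x)" .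
  have "(\<Sum>i\<in>G. (c i)\<^sup>2) = (\<Sum>i\<in>?H \<times> UNIV. (?c i)\<^sup>2)"
    by (rule sum.mono_neutral_cong_left[OF fin sub]) auto
  also have "\<dots> = (\<Sum>n\<in>?H. \<Sum>b\<in>UNIV. (?c (n, b))\<^sup>2)"
    by (simp add: sum.cartesian_product case_prod_beta) (intro sum.cong refl, auto)
  also have "\<dots> = (\<Sum>n\<in>?H. (cmod (z c n))\<^sup>2)"
    by (intro sum.cong refl) (simp add: UNIV_bool z_def cmod_power2 add.commute)
  finally show "(\<Sum>i\<in>G. (c i)\<^sup>2) = (\<Sum>n\<in>fst ` G. (cmod (z c n))\<^sup>2)" .
qed

lemma realify_complex_sum:
  assumes f: "\<And>n. sq_int (f n)" and H: "finite H"
  shows "l2_of (\<lambda>x. \<Sum>n\<in>H. z n * f n x) = (\<Sum>i\<in>H \<times> UNIV. (if snd i then Im (z (fst i)) else Re (z (fst i))) *\<^sub>R realify f i)"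
    and "(\<Sum>n\<in>H. (cmod (z n))\<^sup>2) = (\<Sum>i\<in>H \<times> UNIV. (if snd i then Im (z (fst i)) else Re (z (fst i)))\<^sup>2)"
proof -
  have "l2_of (\<lambda>x. \<Sum>n\<in>H. z n * f n x) = (\<Sum>n\<in>H. l2_of (\<lambda>x. Complex (Re (z n)) (Im (z n)) * f n x))"
    by (simp add: l2_of_sum sq_int_mult f)
  also have "\<dots> = (\<Sum>n\<in>H. \<Sum>b\<in>UNIV. (if b then Im (z n) else Re (z n)) *\<^sub>R realify f (n, b))"
    by (intro sum.cong refl, subst realify_pair[OF f, symmetric]) (simp add: UNIV_bool add.commute)
  finally show "l2_of (\<lambda>x. \<Sum>n\<in>H. z n * f n x) = (\<Sum>i\<in>H \<times> UNIV. (if snd i then Im (z (fst i)) else Re (z (fst i))) *\<^sub>R realify f i)"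
    by (simp add: sum.cartesian_product case_prod_beta)
  have "(\<Sum>n\<in>H. (cmod (z n))\<^sup>2) = (\<Sum>n\<in>H. \<Sum>b\<in>UNIV. (if b then Im (z n) else Re (z n))\<^sup>2)"
    by (simp add: UNIV_bool cmod_power2 add.commute)
  then show "(\<Sum>n\<in>H. (cmod (z n))\<^sup>2) = (\<Sum>i\<in>H \<times> UNIV. (if snd i then Im (z (fst i)) else Re (z (fst i)))\<^sup>2)"
    by (simp add: sum.cartesian_product case_prod_beta)
qed

text \<open>The two Riesz bounds are those of the complex family. The frame bound follows by
  duality: if all finite coefficient sums of \<open>h\<close> stayed too small, pairing
  \<open>h\<close> with approximations of itself with controlled coefficients would make its norm
  smaller than it is.\<close>

theorem riesz_basis_realify:
  fixes f :: "nat \<Rightarrow> 'a::euclidean_space \<Rightarrow> complex"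
  assumes rb: "L2_riesz_basis f"
  obtains A B where "riesz_family (realify f) A B"
proof -
  obtain C where C: "1 \<le> C"
    and up: "\<And>H z. finite H \<Longrightarrow> L2norm (\<lambda>x. \<Sum>n\<in>H. z n * f n x) \<le> C * sqrt (\<Sum>n\<in>H. (cmod (z n))\<^sup>2)"
    and lo: "\<And>H z. finite H \<Longrightarrow> sqrt (\<Sum>n\<in>H. (cmod (z n))\<^sup>2) \<le> C * L2norm (\<lambda>x. \<Sum>n\<in>H. z n * f n x)"
    and dense: "\<And>g \<epsilon>. sq_int g \<Longrightarrow> 0 < \<epsilon> \<Longrightarrow> \<exists>(N::nat) z. L2norm (\<lambda>x. g x - (\<Sum>n<N. z n * f n x)) \<le> \<epsilon> \<and>
      sqrt (\<Sum>n<N. (cmod (z n))\<^sup>2) \<le> C * L2norm g + \<epsilon>"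
    using riesz_basis_bounds[OF rb] by blast
  have f: "sq_int (f n)" for n using rb by (simp add: L2_riesz_basis_def)
  have sf: "sq_int (\<lambda>x. \<Sum>n\<in>H. z n * f n x)" for H z by (intro sq_int_sum sq_int_mult f)
  have "riesz_family (realify f) (1 / C\<^sup>2) (C\<^sup>2)"
  proof
    show "0 < 1 / C\<^sup>2" using C by simp
    fix G :: "(nat \<times> bool) set" and c assume G: "finite G"
    have H: "finite (fst ` G)" using G by simp
    have s: "0 \<le> (\<Sum>n\<in>H. (cmod (z n))\<^sup>2)" for H and z :: "nat \<Rightarrow> complex" by (intro sum_nonneg) simp
    show "(norm (\<Sum>i\<in>G. c i *\<^sub>R realify f i))\<^sup>2 \<le> C\<^sup>2 * (\<Sum>i\<in>G. (c i)\<^sup>2)"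
      unfolding realify_sum[OF f G] l2_of_norm[OF sf]
      using power_mono[OF up[OF H], of _ 2] s by (simp add: power_mult_distrib)
    have aux: "1 / C\<^sup>2 * S \<le> Q\<^sup>2" if "sqrt S \<le> C * Q" "0 \<le> S" for S Q
      using power_mono[OF that(1), of 2] that(2) C by (simp add: power_mult_distrib field_simps)
    show "1 / C\<^sup>2 * (\<Sum>i\<in>G. (c i)\<^sup>2) \<le> (norm (\<Sum>i\<in>G. c i *\<^sub>R realify f i))\<^sup>2"
      unfolding realify_sum[OF f G] l2_of_norm[OF sf] by (rule aux[OF lo[OF H] s])
  next
    fix e :: real and h :: "'a l2" assume e: "0 < e"
    have "\<exists>g. sq_int g \<and> h = l2_of g" by (rule l2_of_surj)
    then obtain g where "sq_int g \<and> h = l2_of g" ..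
    then have g: "sq_int g" "h = l2_of g" by simp_all
    show "\<exists>G. finite G \<and> 1 / C\<^sup>2 * (norm h)\<^sup>2 - e \<le> (\<Sum>i\<in>G. (h \<bullet> realify f i)\<^sup>2)"
    proof (rule ccontr)
      assume "\<not> ?thesis"
      then have small: "\<And>G. finite G \<Longrightarrow> (\<Sum>i\<in>G. (h \<bullet> realify f i)\<^sup>2) < (norm h)\<^sup>2 / C\<^sup>2 - e"
        by (auto simp: not_le)
      define t where "t = sqrt ((norm h)\<^sup>2 / C\<^sup>2 - e)"
      have t0: "0 < (norm h)\<^sup>2 / C\<^sup>2 - e" using small[of "{}"] by simp
      have t: "0 < t" "t < norm h / C"
      proof -
        show "0 < t" using t0 by (simp add: t_def)
        have "t < sqrt ((norm h / C)\<^sup>2)" unfolding t_def using e by (simp add: power_divide)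
        then show "t < norm h / C" using C by simp
      qed
      \<comment> \<open>The approximation error \<open>\<epsilon>\<close> is kept free, so that in
        the limit only \<open>C * norm h * t\<close> remains, which is less than the squared
        norm.\<close>
      have key: "(norm h)\<^sup>2 \<le> norm h * \<epsilon> + (C * norm h + \<epsilon>) * t" if \<epsilon>: "0 < \<epsilon>" for \<epsilon>
      proof -
        obtain N z where Nz: "L2norm (\<lambda>x. g x - (\<Sum>n<N. z n * f n x)) \<le> \<epsilon>"
            "sqrt (\<Sum>n<N. (cmod (z n))\<^sup>2) \<le> C * L2norm g + \<epsilon>"
          using dense[OF g(1) \<epsilon>] by blast
        let ?\<psi> = "l2_of (\<lambda>x. \<Sum>n<N. z n * f n x)" and ?G = "{..<N} \<times> (UNIV :: bool set)"
        let ?c = "\<lambda>i. if snd i then Im (z (fst i)) else Re (z (fst i))"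
        have fin: "finite {..<N}" by simp
        have n1: "norm (h - ?\<psi>) \<le> \<epsilon>"
          using Nz(1) g sf[of z "{..<N}"] by (simp add: l2_of_norm sq_int_diff flip: l2_of_diff)
        have "h \<bullet> ?\<psi> = (\<Sum>i\<in>?G. ?c i * (h \<bullet> realify f i))"
          unfolding realify_complex_sum(1)[OF f fin] by (simp add: inner_sum_right)
        also have "\<dots> \<le> sqrt (\<Sum>i\<in>?G. (?c i)\<^sup>2) * sqrt (\<Sum>i\<in>?G. (h \<bullet> realify f i)\<^sup>2)"
          by (rule sum_mult_le_sqrt)
        also have "\<dots> \<le> (C * norm h + \<epsilon>) * t"
        proof (intro mult_mono)
          show "sqrt (\<Sum>i\<in>?G. (?c i)\<^sup>2) \<le> C * norm h + \<epsilon>"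
            using Nz(2) realify_complex_sum(2)[OF f fin, of z] g by (simp add: l2_of_norm)
          show "sqrt (\<Sum>i\<in>?G. (h \<bullet> realify f i)\<^sup>2) \<le> t"
            unfolding t_def using small[of ?G] by (intro real_sqrt_le_mono) simp
          show "0 \<le> C * norm h + \<epsilon>" using C \<epsilon> by simp
          show "0 \<le> sqrt (\<Sum>i\<in>?G. (h \<bullet> realify f i)\<^sup>2)" by (simp add: sum_nonneg)
        qed
        finally have "h \<bullet> ?\<psi> \<le> (C * norm h + \<epsilon>) * t" .
        moreover have "h \<bullet> (h - ?\<psi>) \<le> norm h * \<epsilon>"
          by (rule order.trans[OF norm_cauchy_schwarz mult_left_mono[OF n1]]) simp
        ultimately show ?thesis by (simp add: power2_norm_eq_inner inner_diff_right)
      qed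
      have "(norm h)\<^sup>2 \<le> C * norm h * t + \<epsilon>" if "0 < \<epsilon>" for \<epsilon>
      proof -
        have p: "0 < norm h + t" using t(1) by (simp add: add_nonneg_pos)
        have "norm h * (\<epsilon> / (norm h + t)) + (C * norm h + \<epsilon> / (norm h + t)) * t =
            C * norm h * t + (norm h + t) * (\<epsilon> / (norm h + t))" by (simp only: algebra_simps)
        also have "\<dots> = C * norm h * t + \<epsilon>" using p by simp
        finally show ?thesis using key[of "\<epsilon> / (norm h + t)"] that p by simp
      qed
      then have "(norm h)\<^sup>2 \<le> C * norm h * t" by (rule field_le_epsilon)
      moreover have "C * norm h * t < C * norm h * (norm h / C)"
      proof -
        have "0 < norm h / C" using t by linarith
        then have "0 < C * norm h" using C by (simp add: zero_less_divide_iff)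
        then show ?thesis using t(2) by (intro mult_strict_left_mono)
      qed
      ultimately show False using C by (simp add: power2_eq_square)
    qed
  qed
  then show ?thesis by (rule that)
qed

subsection \<open>Counting localized functions\<close>

text \<open>Concentration at the point \<open>(a, b)\<close> of phase space. Integrability is
  included so that \<open>FT f\<close> is the actual transform; one constant \<open>m\<close> serves
  all three norms.\<close>

definition localized :: "real \<Rightarrow> real \<Rightarrow> 'a::euclidean_space \<Rightarrow> 'a \<Rightarrow> ('a \<Rightarrow> complex) \<Rightarrow> bool" where
  "localized s m a b f \<longleftrightarrow> integrable lborel f \<and> sq_int f \<and> sq_int (weighted s a f) \<and> sq_int (weighted s b (FT f)) \<and>
     L2norm f \<le> m \<and> L2norm (weighted s a f) \<le> m \<and> L2norm (weighted s b (FT f)) \<le> m"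

lemma localizedD:
  assumes "localized s m a b f"
  shows "integrable lborel f" "sq_int f" "sq_int (weighted s a f)" "sq_int (weighted s b (FT f))"
     "L2norm f \<le> m" "L2norm (weighted s a f) \<le> m" "L2norm (weighted s b (FT f)) \<le> m" "sq_int (FT f)" "0 \<le> m"
  using assms FT_L2_bound(1)[of f] order.trans[OF L2norm_nonneg[of f], of m] by (auto simp: localized_def)

lemma weighted_mult: "weighted s a (\<lambda>x. c * f x) = (\<lambda>x. c * weighted s a f x)"
  by (auto simp: weighted_def)

lemma FT_mult_fun: "FT (\<lambda>x. c * f x) = (\<lambda>\<xi>. c * FT f \<xi>)"
  by (intro ext FT_mult)

lemma localized_mult:
  assumes "localized s m a b f" "cmod c = 1"
  shows "localized s m a b (\<lambda>x. c * f x)"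
  using assms unfolding localized_def weighted_mult FT_mult_fun L2norm_mult by (auto simp: weighted_mult L2norm_mult)

text \<open>Decay in the distance of positions comes from the weights on \<open>f\<close> and
  \<open>g\<close>, decay in the distance of frequencies from those on the transforms via Parseval.
  Whichever distance is larger is used.\<close>

lemma localized_pairing:
  assumes s: "0 \<le> s" and f: "localized s m a b f" and g: "localized s m' a' b' g"
  shows "max (norm (a - a')) (norm (b - b')) powr s * cmod (L2inner f g) \<le> 2 powr s * (2 * m * m')"
proof -
  note F = localizedD[OF f] and G = localizedD[OF g]
  have le: "2 powr s * (x * y + x' * y') \<le> 2 powr s * (2 * m * m')"
    if "0 \<le> y" "0 \<le> y'" "x \<le> m" "y \<le> m'" "x' \<le> m" "y' \<le> m'" for x y x' y'
  proof -
    have "x * y \<le> m * m'" "x' * y' \<le> m * m'"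
      using that F(9) by (auto intro!: mult_mono)
    then show ?thesis by simp
  qed
  have "norm (a - a') powr s * cmod (L2inner f g) \<le> 2 powr s * (L2norm (weighted s a f) * L2norm g + L2norm f * L2norm (weighted s a' g))"
    by (rule L2inner_decay) (use s F G in auto)
  also have "\<dots> \<le> 2 powr s * (2 * m * m')" by (rule le) (use F G in auto)
  finally have 1: "norm (a - a') powr s * cmod (L2inner f g) \<le> 2 powr s * (2 * m * m')" .
  have "norm (b - b') powr s * cmod (L2inner (FT f) (FT g)) \<le> 2 powr s * (L2norm (weighted s b (FT f)) * L2norm (FT g) + L2norm (FT f) * L2norm (weighted s b' (FT g)))"
    by (rule L2inner_decay) (use s F G in auto)
  also have "\<dots> \<le> 2 powr s * (2 * m * m')" by (rule le) (use F G in \<open>auto simp: L2norm_FT\<close>)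
  finally have 2: "norm (b - b') powr s * cmod (L2inner f g) \<le> 2 powr s * (2 * m * m')"
    using F G by (simp add: Parseval)
  show ?thesis using 1 2 by (simp add: max_def)
qed

text \<open>Chebyshev's argument: outside the larger ball every point has distance at least
  \<open>r\<close> from the centre \<open>a\<close>.\<close>

lemma L2norm_outside_ball:
  fixes f :: "'a::euclidean_space \<Rightarrow> complex"
  assumes f: "sq_int f" and w: "sq_int (weighted s a f)" and s: "0 \<le> s" and r: "0 \<le> r" and R: "norm (a - c) \<le> R"
  shows "r powr s * L2norm (\<lambda>x. f x - indicator (ball c (R + r)) x * f x) \<le> L2norm (weighted s a f)"
proof -
  note [measurable] = sq_int_measurable[OF f]
  let ?g = "\<lambda>x. f x - indicator (ball c (R + r)) x * f x"
  have [measurable]: "ball c (R + r) \<in> sets borel" by simp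
  have "L2norm (\<lambda>x. complex_of_real (r powr s) * ?g x) \<le> L2norm (weighted s a f)"
  proof (rule L2norm_mono(2)[OF _ w])
    fix x
    show "cmod (complex_of_real (r powr s) * ?g x) \<le> cmod (weighted s a f x)"
    proof (cases "x \<in> ball c (R + r)")
      case False
      then have "R + r \<le> norm (x - c)" by (simp add: dist_norm norm_minus_commute)
      also have "norm (x - c) \<le> norm (x - a) + norm (a - c)" using norm_triangle_ineq[of "x - a" "a - c"] by simp
      finally have "r \<le> norm (x - a)" using R by simp
      then have "r powr s \<le> norm (x - a) powr s" using r s by (intro powr_mono2) auto
      then show ?thesis using False by (simp add: cmod_weighted norm_mult mult_right_mono)
    qed simp
  qed measurable
  then show ?thesis by (simp add: L2norm_mult)
qed

lemma realify_inner_sq: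
  assumes "\<And>n. sq_int (f n)" "sq_int \<phi>"
  shows "(cmod (L2inner (f n) \<phi>))\<^sup>2 = (\<Sum>b\<in>UNIV. (l2_of \<phi> \<bullet> realify f (n, b))\<^sup>2)"
proof -
  have "l2_of \<phi> \<bullet> realify f (n, b) = Re (phase b * L2inner (f n) \<phi>)" for b
  proof -
    have "l2_of \<phi> \<bullet> realify f (n, b) = realify f (n, b) \<bullet> l2_of \<phi>" by (rule inner_commute)
    also have "\<dots> = Re (\<integral>x. phase b * f n x * cnj (\<phi> x) \<partial>lborel)"
      unfolding realify_def using assms by (subst l2_of_inner) (auto intro: sq_int_mult)
    also have "(\<integral>x. phase b * f n x * cnj (\<phi> x) \<partial>lborel) = phase b * L2inner (f n) \<phi>"
      by (simp add: L2inner_def mult.assoc)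
    finally show ?thesis .
  qed
  then show ?thesis by (simp add: UNIV_bool phase_def cmod_power2 add.commute)
qed

text \<open>The Fourier transform of \<open>f\<^sub>n\<close> cut off to a ball pairs \<open>f\<^sub>n\<close> with a truncated exponential.  Bessel's inequality bounds
  the sum over \<open>n\<close> of these pairings by the volume of the ball, and integration over a ball of
  frequencies captures a fixed part of each \<open>f\<^sub>n\<close>.\<close>

lemma card_localized_bound:
  fixes f :: "nat \<Rightarrow> 'a::euclidean_space \<Rightarrow> complex"
  assumes rf: "riesz_family (realify f) A B" and s: "0 < s"
    and f: "\<And>n. localized s m (a n) (b n) (f n)"
  obtains C where "0 \<le> C" "\<And>a0 b0 R. 0 \<le> R \<Longrightarrow> finite {n. norm (a n - a0) \<le> R \<and> norm (b n - b0) \<le> R} \<and>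
    real (card {n. norm (a n - a0) \<le> R \<and> norm (b n - b0) \<le> R}) \<le> C * (1 + R) ^ (2 * DIM('a))"
proof -
  interpret riesz_family "realify f" A B by (rule rf)
  note F = localizedD[OF f]
  have m: "0 \<le> m" by (rule F(9))
  have B: "0 < B" using A A_le_B by simp
  \<comment> \<open>This margin makes the part of a localized function outside the enlarged ball
    have norm at most \<open>sqrt A / 4\<close>, in position as well as in frequency.\<close>
  define r where "r = (4 * (m + 1) / sqrt A) powr (1 / s)"
  have r: "0 < r" "r powr s = 4 * (m + 1) / sqrt A"
    using A m s by (auto simp: r_def powr_powr add_nonneg_pos)
  define \<omega> where "\<omega> = unit_ball_vol (real DIM('a))"
  have w: "0 \<le> \<omega>" by (simp add: \<omega>_def)
  define C where "C = 4 * B / A * \<omega>\<^sup>2 * (1 + r) ^ (2 * DIM('a))"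
  have fn: "sqrt A \<le> L2norm (f n)" for n
  proof -
    have "A \<le> (norm (realify f (n, False)))\<^sup>2" by (rule norm_bounds)
    also have "norm (realify f (n, False)) = L2norm (f n)"
      using F(2)[of n] by (simp add: realify_def phase_def l2_of_norm)
    finally show ?thesis by (simp add: real_le_lsqrt)
  qed
  have bound: "real (card S) \<le> C * (1 + R) ^ (2 * DIM('a))"
    if R: "0 \<le> R" and S: "finite S" "S \<subseteq> {n. norm (a n - a0) \<le> R \<and> norm (b n - b0) \<le> R}" for a0 b0 R S
  proof -
    let ?U = "ball a0 (R + r)" and ?V = "ball b0 (R + r)"
    let ?g = "\<lambda>n x. indicator ?U x * f n x :: complex"
    let ?k = "\<lambda>n \<xi>. indicator ?V \<xi> * FT (?g n) \<xi> :: complex"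
    define v where "v = \<omega> * (R + r) ^ DIM('a)"
    have v: "0 \<le> v" using w R r by (simp add: v_def)
    have vol: "measure lborel ?U = v" "measure lborel ?V = v"
      using R r(1) content_ball[of "R + r" a0] content_ball[of "R + r" b0] by (simp_all add: v_def \<omega>_def)
    have finV: "emeasure lborel ?V < \<infinity>" "emeasure lborel ?U < \<infinity>"
      using R r(1) by (auto simp: emeasure_ball)
    have g: "integrable lborel (?g n)" "sq_int (?g n)" for n
      by (rule indicator_mult_props[OF F(1,2)]; simp)+
    have Fg: "sq_int (FT (?g n))" for n by (rule FT_L2_bound(1)[OF g])
    have sk: "sq_int (?k n)" for n
      by (rule sq_int_mult_bounded[OF Fg borel_measurable_indicator, where C = 1]) (simp_all add: indicator_def)
    \<comment> \<open>The cut in position and the cut in frequency each lose at most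
      \<open>sqrt A / 4\<close> from a norm of at least \<open>sqrt A\<close>.\<close>
    have low: "sqrt A / 2 \<le> L2norm (?k n)" if n: "n \<in> S" for n
    proof -
      have an: "norm (a n - a0) \<le> R" "norm (b n - b0) \<le> R" using n S by auto
      have d: "L2norm (\<lambda>x. h x - indicator (ball c (R + r)) x * h x) \<le> sqrt A / 4"
        if "sq_int h" "sq_int (weighted s a' h)" "norm (a' - c) \<le> R" "L2norm (weighted s a' h) \<le> m" for h :: "'a \<Rightarrow> complex" and a' c
      proof -
        have "r powr s * L2norm (\<lambda>x. h x - indicator (ball c (R + r)) x * h x) \<le> m"
          using L2norm_outside_ball[OF that(1,2) _ _ that(3), of r] s r(1) that(4) by simp
        then have "4 * (m + 1) * L2norm (\<lambda>x. h x - indicator (ball c (R + r)) x * h x) \<le> m * sqrt A"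
          using A by (simp add: r(2) pos_divide_le_eq)
        also have "\<dots> \<le> (m + 1) * sqrt A" using A by (intro mult_right_mono) auto
        finally have "(m + 1) * (4 * L2norm (\<lambda>x. h x - indicator (ball c (R + r)) x * h x)) \<le> (m + 1) * sqrt A"
          by (simp only: mult.assoc mult.left_commute)
        then show ?thesis using m by (subst (asm) mult_le_cancel_left_pos) auto
      qed
      have d1: "L2norm (\<lambda>x. f n x - ?g n x) \<le> sqrt A / 4"
        by (rule d[OF F(2,3) an(1) F(6)])
      have d2: "L2norm (\<lambda>\<xi>. FT (f n) \<xi> - indicator ?V \<xi> * FT (f n) \<xi>) \<le> sqrt A / 4"
        by (rule d[OF F(8,4) an(2) F(7)])
      let ?h = "\<lambda>\<xi>. FT (f n) \<xi> - FT (?g n) \<xi>"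
      have h: "sq_int ?h" by (intro sq_int_diff F Fg)
      have "?h = FT (\<lambda>x. f n x - ?g n x)" by (intro ext FT_diff[symmetric] F g)
      then have nh: "L2norm ?h \<le> sqrt A / 4"
        using d1 F(1,2)[of n] g[of n] by (simp add: L2norm_FT sq_int_diff)
      have VF: "sq_int (\<lambda>\<xi>. indicator ?V \<xi> * FT (f n) \<xi>)"
        by (rule sq_int_mult_bounded[OF F(8) borel_measurable_indicator, where C = 1]) (simp_all add: indicator_def)
      have Vh: "sq_int (\<lambda>\<xi>. indicator ?V \<xi> * ?h \<xi>)" "L2norm (\<lambda>\<xi>. indicator ?V \<xi> * ?h \<xi>) \<le> L2norm ?h"
      proof -
        show *: "sq_int (\<lambda>\<xi>. indicator ?V \<xi> * ?h \<xi>)"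
          by (rule sq_int_mult_bounded[OF h borel_measurable_indicator, where C = 1]) (simp_all add: indicator_def)
        show "L2norm (\<lambda>\<xi>. indicator ?V \<xi> * ?h \<xi>) \<le> L2norm ?h"
          by (rule L2norm_mono(2)[OF sq_int_measurable[OF *] h]) (simp add: indicator_def)
      qed
      have "L2norm (f n) = L2norm (\<lambda>\<xi>. (FT (f n) \<xi> - indicator ?V \<xi> * FT (f n) \<xi>) + (indicator ?V \<xi> * ?h \<xi> + ?k n \<xi>))"
        using F(1,2)[of n] by (simp add: L2norm_FT right_diff_distrib)
      also have "\<dots> \<le> L2norm (\<lambda>\<xi>. FT (f n) \<xi> - indicator ?V \<xi> * FT (f n) \<xi>) + L2norm (\<lambda>\<xi>. indicator ?V \<xi> * ?h \<xi> + ?k n \<xi>)"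
        by (intro L2norm_triangle sq_int_diff sq_int_add F VF Vh sk)
      also have "L2norm (\<lambda>\<xi>. indicator ?V \<xi> * ?h \<xi> + ?k n \<xi>) \<le> L2norm (\<lambda>\<xi>. indicator ?V \<xi> * ?h \<xi>) + L2norm (?k n)"
        by (intro L2norm_triangle Vh sk)
      finally show ?thesis using d2 nh Vh(2) fn[of n] by linarith
    qed
    \<comment> \<open>For fixed \<open>\<xi>\<close> the values pair \<open>f n\<close> with the
      truncated exponential \<open>\<phi>\<close>, whose squared norm is the volume
      \<open>v\<close>, so \<open>bessel\<close> applies.\<close>
    have up: "(\<Sum>n\<in>S. (cmod (FT (?g n) \<xi>))\<^sup>2) \<le> B * v" for \<xi>
    proof -
      define \<phi> where "\<phi> x = indicator ?U x * cis (2 * pi * (x \<bullet> \<xi>))" for x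
      have [measurable]: "?U \<in> sets borel" by simp
      have ncm: "cmod (\<phi> x) = cmod (indicator ?U x)" for x by (simp add: \<phi>_def norm_mult)
      have \<phi>: "sq_int \<phi>"
      proof -
        have "(\<lambda>x. cis (2 * pi * (x \<bullet> \<xi>))) \<in> borel_measurable lborel" by measurable
        then have "sq_int (\<lambda>x. cis (2 * pi * (x \<bullet> \<xi>)) * indicator ?U x)"
          by (intro sq_int_mult_bounded[where C = 1] sq_int_indicator finV) simp_all
        then show ?thesis by (simp add: \<phi>_def[abs_def] mult.commute)
      qed
      have n\<phi>: "(norm (l2_of \<phi>))\<^sup>2 = v"
      proof -
        have "(\<lambda>x. (cmod (\<phi> x))\<^sup>2) = indicator ?U" by (auto simp: ncm indicator_def fun_eq_iff)
        then show ?thesis unfolding l2_of_norm_sq[OF \<phi>] using vol(1) by simp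
      qed
      have "FT (?g n) \<xi> = L2inner (f n) \<phi>" for n
        unfolding FT_def L2inner_def \<phi>_def by (intro Bochner_Integration.integral_cong refl) (auto simp: cis_cnj indicator_def)
      then have "(\<Sum>n\<in>S. (cmod (FT (?g n) \<xi>))\<^sup>2) = (\<Sum>n\<in>S. \<Sum>b\<in>UNIV. (l2_of \<phi> \<bullet> realify f (n, b))\<^sup>2)"
        using realify_inner_sq[of f, OF F(2) \<phi>] by simp
      also have "\<dots> = (\<Sum>i\<in>S \<times> UNIV. (l2_of \<phi> \<bullet> realify f i)\<^sup>2)"
        by (simp add: sum.cartesian_product case_prod_beta)
      also have "\<dots> \<le> B * (norm (l2_of \<phi>))\<^sup>2" by (rule bessel) (use S in simp)
      finally show ?thesis by (simp add: n\<phi>)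
    qed
    have "real (card S) * (sqrt A / 2)\<^sup>2 = (\<Sum>n\<in>S. (sqrt A / 2)\<^sup>2)" by simp
    also have "\<dots> \<le> (\<Sum>n\<in>S. (L2norm (?k n))\<^sup>2)"
      using A by (intro sum_mono power_mono low) auto
    also have "\<dots> = (\<integral>\<xi>. (\<Sum>n\<in>S. (cmod (?k n \<xi>))\<^sup>2) \<partial>lborel)"
      unfolding L2norm_sq using sk by (intro Bochner_Integration.integral_sum[symmetric] sq_int_integrable)
    also have "\<dots> \<le> (\<integral>\<xi>. B * v * indicator ?V \<xi> \<partial>lborel)"
    proof (rule integral_mono)
      show "integrable lborel (\<lambda>\<xi>. \<Sum>n\<in>S. (cmod (?k n \<xi>))\<^sup>2)"
        using sk by (intro Bochner_Integration.integrable_sum sq_int_integrable)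
      show "integrable lborel (\<lambda>\<xi>. B * v * indicator ?V \<xi>)"
        using finV by (intro integrable_mult_right integrable_real_indicator) auto
      show "(\<Sum>n\<in>S. (cmod (?k n \<xi>))\<^sup>2) \<le> B * v * indicator ?V \<xi>" for \<xi>
        using up[of \<xi>] by (auto simp: indicator_def)
    qed
    also have "\<dots> = B * v * v" using vol(2) finV by simp
    finally have "real (card S) * (A / 4) \<le> B * v * v" using A by (simp add: power_divide)
    then have "real (card S) \<le> 4 * B / A * v\<^sup>2" using A by (simp add: field_simps power2_eq_square)
    also have "\<dots> \<le> 4 * B / A * (\<omega>\<^sup>2 * ((1 + r) * (1 + R)) ^ (2 * DIM('a)))"
    proof (rule mult_left_mono)
      show "v\<^sup>2 \<le> \<omega>\<^sup>2 * ((1 + r) * (1 + R)) ^ (2 * DIM('a))"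
      proof -
      have "R + r \<le> (1 + r) * (1 + R)" using R r(1) by (simp add: algebra_simps)
      then have "(R + r) ^ (2 * DIM('a)) \<le> ((1 + r) * (1 + R)) ^ (2 * DIM('a))"
        using R r(1) by (intro power_mono) auto
      moreover have "v\<^sup>2 = \<omega>\<^sup>2 * (R + r) ^ (2 * DIM('a))"
        by (simp add: v_def power_mult_distrib mult.commute flip: power_mult)
      ultimately show ?thesis by (simp add: mult_left_mono)
    qed
    qed (use A B in simp)
    finally show ?thesis by (simp add: C_def power_mult_distrib mult.assoc)
  qed
  show thesis
  proof (rule that)
    show "0 \<le> C" using A B r(1) by (simp add: C_def)
    fix a0 b0 R assume R: "0 \<le> (R::real)"
    let ?X = "{n. norm (a n - a0) \<le> R \<and> norm (b n - b0) \<le> R}"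
    \<comment> \<open>\<open>bound\<close> speaks of finite subsets only; a common integer bound on
      their sizes forces the whole set to be finite.\<close>
    have nat: "card S \<le> nat \<lfloor>C * (1 + R) ^ (2 * DIM('a))\<rfloor>" if "S \<subseteq> ?X" "finite S" for S
      using bound[OF R that(2,1)] by (simp add: le_nat_floor)
    have "finite ?X \<and> card ?X \<le> nat \<lfloor>C * (1 + R) ^ (2 * DIM('a))\<rfloor>"
      by (rule finite_if_finite_subsets_card_bdd) (rule nat)
    then show "finite ?X \<and> real (card ?X) \<le> C * (1 + R) ^ (2 * DIM('a))"
      using bound[OF R, of ?X] by blast
  qed
qed

subsection \<open>Position, modulation and translation\<close>

definition translation :: "'a::euclidean_space \<Rightarrow> ('a \<Rightarrow> complex) \<Rightarrow> 'a \<Rightarrow> complex" where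
  "translation v f = (\<lambda>x. f (v + x))"

lemma translation_measurable:
  assumes [measurable]: "f \<in> borel_measurable lborel"
  shows "translation v f \<in> borel_measurable lborel"
  unfolding translation_def by measurable

lemma sq_int_norm_sq_measurable: "sq_int f \<Longrightarrow> (\<lambda>x. (cmod (f x))\<^sup>2) \<in> borel_measurable borel"
  using borel_measurable_integrable[OF sq_int_integrable] by simp

lemma sq_int_translation: "sq_int f \<Longrightarrow> sq_int (translation v f)"
  using integrable_translate[OF sq_int_norm_sq_measurable, of f v] translation_measurable[of f v]
  by (simp add: sq_int_def translation_def)

lemma L2norm_translation: "sq_int f \<Longrightarrow> L2norm (translation v f) = L2norm f"
  using integral_translate[OF sq_int_norm_sq_measurable, of f v]
  by (simp add: L2norm_def translation_def sq_int_def)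

lemma integrable_translation: "sq_int f \<Longrightarrow> integrable lborel f \<Longrightarrow> integrable lborel (translation v f)"
  using integrable_translate[of f v] by (simp add: translation_def sq_int_def)

lemma L2inner_translation:
  fixes f g :: "'a::euclidean_space \<Rightarrow> complex"
  assumes "sq_int f" "sq_int g"
  shows "L2inner (translation v f) g = L2inner f (translation (- v) g)"
proof -
  have "(\<lambda>x. f x * cnj (g (- v + x))) \<in> borel_measurable borel"
    using sq_int_measurable[OF assms(1)] sq_int_measurable[OF sq_int_translation[OF assms(2), of "- v"]]
    by (simp add: translation_def borel_measurable_times borel_measurable_cnj)
  from integral_translate[OF this, of v] show ?thesis
    by (simp add: L2inner_def translation_def algebra_simps)
qed

lemma FT_translation:
  fixes f :: "'a::euclidean_space \<Rightarrow> complex"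
  assumes "sq_int f"
  shows "FT (translation v f) \<xi> = cis (2 * pi * (v \<bullet> \<xi>)) * FT f \<xi>"
proof -
  have [measurable]: "f \<in> borel_measurable borel" using assms by (simp add: sq_int_def)
  have "FT (translation v f) \<xi> = (\<integral>x. (\<lambda>y. f y * cis (- 2 * pi * ((y - v) \<bullet> \<xi>))) (v + x) \<partial>lborel)"
    by (simp add: FT_def translation_def)
  also have "\<dots> = (\<integral>y. f y * cis (- 2 * pi * ((y - v) \<bullet> \<xi>)) \<partial>lborel)"
    by (rule integral_translate) measurable
  also have "\<dots> = (\<integral>y. cis (2 * pi * (v \<bullet> \<xi>)) * (f y * cis (- 2 * pi * (y \<bullet> \<xi>))) \<partial>lborel)"
  proof (intro Bochner_Integration.integral_cong refl)
    fix y
    have "cis (- 2 * pi * ((y - v) \<bullet> \<xi>)) = cis (2 * pi * (v \<bullet> \<xi>)) * cis (- 2 * pi * (y \<bullet> \<xi>))"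
      unfolding cis_mult by (simp add: inner_diff_left algebra_simps)
    then show "f y * cis (- 2 * pi * ((y - v) \<bullet> \<xi>)) = cis (2 * pi * (v \<bullet> \<xi>)) * (f y * cis (- 2 * pi * (y \<bullet> \<xi>)))"
      by (simp only: mult_ac)
  qed
  finally show ?thesis by (simp add: FT_def)
qed

text \<open>Centring the modulation at \<open>a\<close> contributes only a unimodular constant, so
  the norms below do not depend on \<open>a\<close>.\<close>

lemma FT_modulate:
  "FT (\<lambda>x. cis (\<eta> * ((x - a) \<bullet> e)) * f x) \<xi> = cis (- \<eta> * (a \<bullet> e)) * translation (- (\<eta> / (2 * pi)) *\<^sub>R e) (FT f) \<xi>"
proof -
  have "cis (\<eta> * ((x - a) \<bullet> e)) * f x * cis (- 2 * pi * (x \<bullet> \<xi>)) =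
    cis (- \<eta> * (a \<bullet> e)) * (f x * cis (- 2 * pi * (x \<bullet> (- (\<eta> / (2 * pi)) *\<^sub>R e + \<xi>))))" for x
  proof -
    have "\<eta> * ((x - a) \<bullet> e) + (- 2 * pi * (x \<bullet> \<xi>)) =
      (- \<eta> * (a \<bullet> e)) + (- 2 * pi * (x \<bullet> (- (\<eta> / (2 * pi)) *\<^sub>R e + \<xi>)))"
      by (simp add: inner_diff_left inner_add_right algebra_simps)
    then have "cis (\<eta> * ((x - a) \<bullet> e)) * cis (- 2 * pi * (x \<bullet> \<xi>)) =
      cis (- \<eta> * (a \<bullet> e)) * cis (- 2 * pi * (x \<bullet> (- (\<eta> / (2 * pi)) *\<^sub>R e + \<xi>)))"
      by (simp only: cis_mult)
    then show ?thesis by (simp only: mult_ac)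
  qed
  then show ?thesis unfolding FT_def translation_def by (simp only: integral_mult_right_zero)
qed

lemma sq_int_cmod:
  assumes "sq_int f"
  shows "sq_int (\<lambda>x. complex_of_real (cmod (f x)))" "L2norm (\<lambda>x. complex_of_real (cmod (f x))) = L2norm f"
  using assms by (auto simp: sq_int_def L2norm_def)

lemma L2norm_dominated:
  fixes f g h :: "'a::euclidean_space \<Rightarrow> complex"
  assumes f: "f \<in> borel_measurable lborel" and g: "sq_int g" and h: "sq_int h" and c: "0 \<le> c" "0 \<le> d"
    and le: "\<And>x. cmod (f x) \<le> c * cmod (g x) + d * cmod (h x)"
  shows "sq_int f" "L2norm f \<le> c * L2norm g + d * L2norm h"
proof -
  let ?g = "\<lambda>x. complex_of_real c * complex_of_real (cmod (g x))"
  let ?h = "\<lambda>x. complex_of_real d * complex_of_real (cmod (h x))"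
  let ?G = "\<lambda>x. ?g x + ?h x"
  have s: "sq_int ?g" "sq_int ?h" by (intro sq_int_mult sq_int_cmod g h)+
  then have G: "sq_int ?G" by (rule sq_int_add)
  have le': "cmod (f x) \<le> cmod (?G x)" for x
  proof -
    have "?G x = complex_of_real (c * cmod (g x) + d * cmod (h x))" by simp
    then show ?thesis using le[of x] c by (simp only: norm_of_real)
  qed
  show "sq_int f" by (rule L2norm_mono(1)[OF f G le'])
  have "L2norm f \<le> L2norm ?G" by (rule L2norm_mono(2)[OF f G le'])
  also have "\<dots> \<le> L2norm ?g + L2norm ?h" by (rule L2norm_triangle[OF s])
  also have "\<dots> = c * L2norm g + d * L2norm h"
    unfolding L2norm_mult using c by (simp add: sq_int_cmod g h)
  finally show "L2norm f \<le> c * L2norm g + d * L2norm h" .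
qed

text \<open>The weight stays centred at \<open>b\<close> although the function moves; the triangle
  inequality charges the shift \<open>v\<close> to the unweighted norm.\<close>

lemma weighted_translation:
  fixes g :: "'a::euclidean_space \<Rightarrow> complex"
  assumes s: "0 \<le> s" and g: "sq_int g" "sq_int (weighted s b g)"
  shows "sq_int (weighted s b (translation v g))"
    "L2norm (weighted s b (translation v g)) \<le> 2 powr s * L2norm (weighted s b g) + 2 powr s * norm v powr s * L2norm g"
proof -
  have le: "cmod (weighted s b (translation v g) x) \<le> 2 powr s * cmod (translation v (weighted s b g) x) + 2 powr s * norm v powr s * cmod (translation v g x)" for x
  proof -
    have "norm (x - b) powr s \<le> 2 powr s * (norm ((v + x) - x) powr s + norm ((v + x) - b) powr s)"
      by (rule norm_triangle_powr[OF s])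
    then have "norm (x - b) powr s * cmod (g (v + x)) \<le> 2 powr s * (norm v powr s + norm (v + x - b) powr s) * cmod (g (v + x))"
      by (intro mult_right_mono) auto
    then show ?thesis by (simp add: cmod_weighted translation_def algebra_simps)
  qed
  note D = L2norm_dominated[OF weighted_measurable[OF translation_measurable[OF sq_int_measurable[OF g(1)]]]
      sq_int_translation[OF g(2)] sq_int_translation[OF g(1)] _ _ le]
  show "sq_int (weighted s b (translation v g))" by (rule D(1)) auto
  show "L2norm (weighted s b (translation v g)) \<le> 2 powr s * L2norm (weighted s b g) + 2 powr s * norm v powr s * L2norm g"
    using D(2) by (simp add: L2norm_translation g)
qed

lemma weighted_diff: "weighted s b (\<lambda>x. f x - g x) = (\<lambda>x. weighted s b f x - weighted s b g x)"
  by (auto simp: weighted_def algebra_simps)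

text \<open>The bounded substitute \<open>sin (\<eta> t) / \<eta>\<close> for the coordinate \<open>t\<close> is a combination of two modulations,
  which only shift the Fourier transform.\<close>

lemma localized_sin:
  fixes f :: "'a::euclidean_space \<Rightarrow> complex"
  assumes s: "0 \<le> s" and f: "localized s m a b f" and \<eta>: "0 < \<eta>" and e: "norm e = 1"
  shows "localized s (m / \<eta> + m * (2 powr s + 2 powr s * (\<eta> / (2 * pi)) powr s) / \<eta>) a b
     (\<lambda>x. complex_of_real (sin (\<eta> * ((x - a) \<bullet> e)) / \<eta>) * f x)"
    (is "localized s ?M a b ?g")
proof -
  note F = localizedD[OF f]
  let ?u = "\<lambda>x. complex_of_real (sin (\<eta> * ((x - a) \<bullet> e)) / \<eta>)"
  have u: "cmod (?u x) \<le> 1 / \<eta>" for x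
    using \<eta> abs_sin_le_one[of "\<eta> * ((x - a) \<bullet> e)"] by (simp add: norm_divide divide_right_mono)
  have um: "?u \<in> borel_measurable lborel" by measurable
  have b: "sq_int (\<lambda>x. ?u x * h x)" "L2norm (\<lambda>x. ?u x * h x) \<le> L2norm h / \<eta>" if "sq_int h" for h
  proof -
    have le: "cmod (?u x * h x) \<le> 1 / \<eta> * cmod (h x) + 0 * cmod (h x)" for x
      unfolding norm_mult using mult_right_mono[OF u norm_ge_zero, of x "h x"] by simp
    note D = L2norm_dominated[OF borel_measurable_times[OF um sq_int_measurable[OF that]] that that _ _ le]
    show "sq_int (\<lambda>x. ?u x * h x)" using D(1) \<eta> by simp
    show "L2norm (\<lambda>x. ?u x * h x) \<le> L2norm h / \<eta>" using D(2) \<eta> by simp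
  qed
  have wu: "weighted s a ?g = (\<lambda>x. ?u x * weighted s a f x)" by (auto simp: weighted_def)
  \<comment> \<open>The factor that \<open>weighted_translation\<close> charges for a frequency
    shift of length \<open>\<eta> / (2 pi)\<close>.\<close>
  define K where "K = 2 powr s + 2 powr s * (\<eta> / (2 * pi)) powr s"
  have K: "0 \<le> K" by (simp add: K_def)
  have M: "m / \<eta> \<le> ?M" "m * K / \<eta> \<le> ?M" using F(9) \<eta> K unfolding K_def[symmetric] by simp_all
  \<comment> \<open>From Euler's formula for the sine, with the extra division by
    \<open>\<eta>\<close>.\<close>
  define c where "c = 1 / (2 * \<i> * complex_of_real \<eta>)"
  have cc: "cmod c = 1 / (2 * \<eta>)" using \<eta> by (simp add: c_def norm_divide norm_mult)
  let ?c1 = "c * cis (- \<eta> * (a \<bullet> e))" and ?c2 = "c * cis (\<eta> * (a \<bullet> e))"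
  let ?v = "(\<eta> / (2 * pi)) *\<^sub>R e"
  have int: "integrable lborel (\<lambda>x. cis (\<zeta> * ((x - a) \<bullet> e)) * f x)" for \<zeta>
  proof -
    have "integrable lborel (\<lambda>x. f x * cis (\<zeta> * ((x - a) \<bullet> e)))" by (intro integrable_mult_cis F) measurable
    then show ?thesis by (simp add: mult.commute)
  qed
  have gf: "?g = (\<lambda>x. c * (cis (\<eta> * ((x - a) \<bullet> e)) * f x) - c * (cis (- \<eta> * ((x - a) \<bullet> e)) * f x))"
  proof
    fix x
    have sc: "complex_of_real (sin t / \<eta>) = c * (cis t - cis (- t))" for t
      using \<eta> by (simp add: c_def complex_eq_iff Re_divide Im_divide power2_eq_square)
    show "?g x = c * (cis (\<eta> * ((x - a) \<bullet> e)) * f x) - c * (cis (- \<eta> * ((x - a) \<bullet> e)) * f x)"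
      unfolding sc minus_mult_left by (simp only: left_diff_distrib right_diff_distrib mult.assoc)
  qed
  have FTg: "FT ?g = (\<lambda>\<xi>. ?c1 * translation (- ?v) (FT f) \<xi> - ?c2 * translation ?v (FT f) \<xi>)"
  proof
    fix \<xi>
    show "FT ?g \<xi> = ?c1 * translation (- ?v) (FT f) \<xi> - ?c2 * translation ?v (FT f) \<xi>"
      unfolding gf using FT_modulate[of \<eta> a e f \<xi>] FT_modulate[of "- \<eta>" a e f \<xi>]
      by (subst FT_diff) (auto simp: FT_mult intro!: integrable_mult_right int[of \<eta>] int[of "- \<eta>", simplified])
  qed
  let ?w = "\<lambda>v. weighted s b (translation v (FT f))"
  have w: "sq_int (?w v)" for v by (rule weighted_translation[OF s F(8,4)])
  have wn: "L2norm (?w v) \<le> m * K" if "norm v = \<eta> / (2 * pi)" for v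
  proof -
    have "L2norm (?w v) \<le> 2 powr s * L2norm (weighted s b (FT f)) + 2 powr s * norm v powr s * L2norm (FT f)"
      by (rule weighted_translation[OF s F(8,4)])
    also have "\<dots> \<le> 2 powr s * m + 2 powr s * norm v powr s * m"
      using F by (intro add_mono mult_left_mono) (auto simp: L2norm_FT)
    finally show ?thesis by (simp add: K_def that algebra_simps)
  qed
  have nv: "norm ?v = \<eta> / (2 * pi)" "norm (- ?v) = \<eta> / (2 * pi)" using e \<eta> by simp_all
  have FTw: "weighted s b (FT ?g) = (\<lambda>\<xi>. ?c1 * ?w (- ?v) \<xi> - ?c2 * ?w ?v \<xi>)"
    unfolding FTg weighted_diff weighted_mult ..
  have sF: "sq_int (weighted s b (FT ?g))"
    unfolding FTw by (intro sq_int_diff sq_int_mult w)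
  have "L2norm (weighted s b (FT ?g)) \<le> cmod c * L2norm (?w (- ?v)) + cmod c * L2norm (?w ?v)"
  proof (rule L2norm_dominated(2)[OF sq_int_measurable[OF sF] w w])
    show "cmod (weighted s b (FT ?g) x) \<le> cmod c * cmod (?w (- ?v) x) + cmod c * cmod (?w ?v x)" for x
      unfolding FTw by (rule order.trans[OF norm_triangle_ineq4]) (simp add: norm_mult)
  qed auto
  also have "\<dots> \<le> cmod c * (m * K) + cmod c * (m * K)"
    by (intro add_mono mult_left_mono wn nv) auto
  also have "\<dots> = m * K / \<eta>" using \<eta> by (simp add: cc)
  finally have FTn: "L2norm (weighted s b (FT ?g)) \<le> m * K / \<eta>" .
  have ig: "integrable lborel ?g"
    unfolding gf by (intro Bochner_Integration.integrable_diff integrable_mult_right int)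
  have "L2norm f / \<eta> \<le> m / \<eta>" "L2norm (weighted s a f) / \<eta> \<le> m / \<eta>"
    using F \<eta> by (auto intro: divide_right_mono)
  then show ?thesis
    unfolding localized_def using ig b[OF F(2)] b[OF F(3)] sF FTn M unfolding wu by linarith
qed

section \<open>The coordinate, its bounded substitute, and difference quotients\<close>

lemma sin_approx:
  fixes t :: real
  shows "\<bar>t - sin t\<bar> \<le> t\<^sup>2"
proof -
  have "\<bar>sin t - (\<Sum>m<2. sin_coeff m * t ^ m)\<bar> \<le> inverse (fact 2) * \<bar>t\<bar> ^ 2"
    by (rule Maclaurin_sin_bound)
  moreover have "(\<Sum>m<2. sin_coeff m * t ^ m) = t" by (simp add: numeral_2_eq_2 sin_coeff_def)
  ultimately have "2 * \<bar>t - sin t\<bar> \<le> t\<^sup>2" by (simp add: abs_minus_commute fact_numeral)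
  moreover have "\<bar>t - sin t\<bar> \<le> 2 * \<bar>t - sin t\<bar>" by simp
  ultimately show ?thesis by (rule order.trans[rotated])
qed

text \<open>A coordinate is at most 1 + |x - a|^s because \<open>s \<ge> 1\<close>.\<close>

lemma coordinate_mult:
  fixes f :: "'a::euclidean_space \<Rightarrow> complex"
  assumes s: "1 \<le> s" and f: "sq_int f" "sq_int (weighted s a f)" and e: "norm e = 1"
  shows "sq_int (\<lambda>x. complex_of_real ((x - a) \<bullet> e) * f x)" 
    "L2norm (\<lambda>x. complex_of_real ((x - a) \<bullet> e) * f x) \<le> L2norm f + L2norm (weighted s a f)"
proof -
  note [measurable] = sq_int_measurable[OF f(1)]
  have le: "cmod (complex_of_real ((x - a) \<bullet> e) * f x) \<le> 1 * cmod (f x) + 1 * cmod (weighted s a f x)" for x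
  proof -
    have "\<bar>(x - a) \<bullet> e\<bar> \<le> norm (x - a)" using Cauchy_Schwarz_ineq2[of "x - a" e] e by simp
    also have "\<dots> \<le> 1 + norm (x - a) powr s"
    proof (cases "norm (x - a) \<le> 1")
      case False
      then have "norm (x - a) powr 1 \<le> norm (x - a) powr s" using s by (intro powr_mono) auto
      then show ?thesis by simp
    qed (simp add: add_increasing2)
    finally have "\<bar>(x - a) \<bullet> e\<bar> * cmod (f x) \<le> (1 + norm (x - a) powr s) * cmod (f x)"
      by (intro mult_right_mono) auto
    then show ?thesis unfolding norm_mult norm_of_real cmod_weighted by (simp add: algebra_simps)
  qed
  have m: "(\<lambda>x. complex_of_real ((x - a) \<bullet> e) * f x) \<in> borel_measurable lborel" by measurable
  note D = L2norm_dominated[OF m f _ _ le]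
  show "sq_int (\<lambda>x. complex_of_real ((x - a) \<bullet> e) * f x)" using D(1) by simp
  show "L2norm (\<lambda>x. complex_of_real ((x - a) \<bullet> e) * f x) \<le> L2norm f + L2norm (weighted s a f)" using D(2) by simp
qed

text \<open>Split at |t| = T. Inside, Taylor's bound gives the factor \<open>\<eta> T^2\<close>;
  outside, both terms are at most r = |x - a|, and r \<le> T^(1 - s) r^s since \<open>s > 1\<close>.
  The free \<open>T\<close> lets both parts be made small uniformly over localized
  functions.\<close>

lemma sin_coordinate_approx:
  fixes f :: "'a::euclidean_space \<Rightarrow> complex"
  assumes s: "1 < s" and f: "sq_int f" "sq_int (weighted s a f)" and e: "norm e = 1" and T: "1 \<le> T" and \<eta>: "0 < \<eta>"
  shows "sq_int (\<lambda>x. complex_of_real ((x - a) \<bullet> e) * f x - complex_of_real (sin (\<eta> * ((x - a) \<bullet> e)) / \<eta>) * f x)"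
    "L2norm (\<lambda>x. complex_of_real ((x - a) \<bullet> e) * f x - complex_of_real (sin (\<eta> * ((x - a) \<bullet> e)) / \<eta>) * f x)
      \<le> (\<eta> * T\<^sup>2) * L2norm f + (2 * T powr (1 - s)) * L2norm (weighted s a f)"
proof -
  note [measurable] = sq_int_measurable[OF f(1)]
  let ?d = "\<lambda>x. complex_of_real ((x - a) \<bullet> e) * f x - complex_of_real (sin (\<eta> * ((x - a) \<bullet> e)) / \<eta>) * f x"
  have pt: "\<bar>t - sin (\<eta> * t) / \<eta>\<bar> \<le> \<eta> * T\<^sup>2 + 2 * T powr (1 - s) * r powr s" if "\<bar>t\<bar> \<le> r" for t r
  proof (cases "\<bar>t\<bar> \<le> T")
    case True
    have "\<bar>\<eta> * t - sin (\<eta> * t)\<bar> \<le> (\<eta> * t)\<^sup>2" by (rule sin_approx)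
    moreover have "t - sin (\<eta> * t) / \<eta> = (\<eta> * t - sin (\<eta> * t)) / \<eta>" using \<eta> by (simp add: field_simps)
    ultimately have "\<bar>t - sin (\<eta> * t) / \<eta>\<bar> \<le> \<eta> * t\<^sup>2"
      using \<eta> by (simp add: abs_divide power2_eq_square field_simps)
    also have "t\<^sup>2 \<le> T\<^sup>2" using True T by (simp add: abs_le_square_iff[symmetric])
    finally show ?thesis using \<eta> by (simp add: add_increasing2)
  next
    case False
    then have r: "T < r" "0 < r" using that T by auto
    have "\<bar>sin (\<eta> * t) / \<eta>\<bar> \<le> \<bar>t\<bar>"
      using abs_sin_x_le_abs_x[of "\<eta> * t"] \<eta> by (simp add: abs_divide abs_mult field_simps)
    then have "\<bar>t - sin (\<eta> * t) / \<eta>\<bar> \<le> 2 * r" using that by linarith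
    also have "r = r powr (1 - s) * r powr s" using r by (simp flip: powr_add)
    also have "r powr (1 - s) \<le> T powr (1 - s)" using r T s by (intro powr_mono2') auto
    finally show ?thesis using \<eta> by (simp add: mult_right_mono add_increasing)
  qed
  have le: "cmod (?d x) \<le> (\<eta> * T\<^sup>2) * cmod (f x) + (2 * T powr (1 - s)) * cmod (weighted s a f x)" for x
  proof -
    have "\<bar>(x - a) \<bullet> e\<bar> \<le> norm (x - a)" using Cauchy_Schwarz_ineq2[of "x - a" e] e by simp
    from mult_right_mono[OF pt[OF this], of "cmod (f x)"]
    have "\<bar>(x - a) \<bullet> e - sin (\<eta> * ((x - a) \<bullet> e)) / \<eta>\<bar> * cmod (f x) \<le>
      (\<eta> * T\<^sup>2 + 2 * T powr (1 - s) * norm (x - a) powr s) * cmod (f x)" by simp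
    moreover have "?d x = complex_of_real ((x - a) \<bullet> e - sin (\<eta> * ((x - a) \<bullet> e)) / \<eta>) * f x"
      by (simp add: algebra_simps)
    then have "cmod (?d x) = \<bar>(x - a) \<bullet> e - sin (\<eta> * ((x - a) \<bullet> e)) / \<eta>\<bar> * cmod (f x)"
      by (simp only: norm_mult norm_of_real)
    ultimately show ?thesis by (simp add: cmod_weighted algebra_simps)
  qed
  have m: "?d \<in> borel_measurable lborel" by measurable
  note D = L2norm_dominated[OF m f _ _ le]
  show "sq_int ?d" using D(1) \<eta> by simp
  show "L2norm ?d \<le> (\<eta> * T\<^sup>2) * L2norm f + (2 * T powr (1 - s)) * L2norm (weighted s a f)" using D(2) \<eta> by simp
qed

lemma cis_diff_bound: "cmod (cis x - cis y) \<le> \<bar>x - y\<bar>"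
proof -
  have "cis x - cis y = cis y * (cis (x - y) - 1)" by (simp add: right_diff_distrib cis_mult)
  then have "cmod (cis x - cis y) = cmod (cis (x - y) - 1)" by (simp add: norm_mult)
  also have "\<dots> \<le> \<bar>x - y\<bar>" using iexp_approx1[of "x - y" 0] by (simp add: cis_conv_exp)
  finally show ?thesis .
qed

text \<open>On the Fourier side the quotient is a multiplier, and \<open>c\<close> is its value at
  \<open>b\<close>. Subtracting it leaves a multiplier bounded by 2 pi |\<xi> - b| for every
  increment, hence an estimate uniform in \<open>t\<close>.\<close>

lemma difference_quotient_bound:
  fixes f :: "'a::euclidean_space \<Rightarrow> complex"
  assumes s: "1 \<le> s" and f: "localized s m a b f" and e: "norm e = 1" and t: "t \<noteq> 0"
  defines "c \<equiv> (cis (- 2 * pi * t * (b \<bullet> e)) - 1) / complex_of_real t"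
  shows "L2norm (\<lambda>x. (translation (- t *\<^sub>R e) f x - f x) / complex_of_real t - c * f x) \<le> 4 * pi * m"
    "cmod c \<le> 2 * pi * norm b"
proof -
  note F = localizedD[OF f]
  let ?d = "\<lambda>x. (translation (- t *\<^sub>R e) f x - f x) / complex_of_real t - c * f x"
  have i: "integrable lborel (translation (- t *\<^sub>R e) f)" "sq_int (translation (- t *\<^sub>R e) f)"
    by (intro integrable_translation sq_int_translation F)+
  have deq: "?d = (\<lambda>x. (1 / complex_of_real t) * (translation (- t *\<^sub>R e) f x - f x) - c * f x)" by auto
  have d: "integrable lborel ?d" "sq_int ?d"
    unfolding deq by (intro Bochner_Integration.integrable_diff integrable_mult_right i F sq_int_diff sq_int_mult)+
  have FTd: "FT ?d \<xi> = (cis (- 2 * pi * t * (\<xi> \<bullet> e)) - cis (- 2 * pi * t * (b \<bullet> e))) / complex_of_real t * FT f \<xi>" for \<xi>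
  proof -
    have "FT ?d \<xi> = (1 / complex_of_real t) * (FT (translation (- t *\<^sub>R e) f) \<xi> - FT f \<xi>) - c * FT f \<xi>"
      unfolding deq by (subst FT_diff FT_mult | intro Bochner_Integration.integrable_diff integrable_mult_right i F)+ simp
    also have "FT (translation (- t *\<^sub>R e) f) \<xi> = cis (- 2 * pi * t * (\<xi> \<bullet> e)) * FT f \<xi>"
      using FT_translation[OF F(2), of "- t *\<^sub>R e" \<xi>] by (simp add: inner_commute mult_ac)
    finally show ?thesis using t by (simp add: c_def field_simps)
  qed
  have "L2norm ?d = L2norm (FT ?d)" by (rule L2norm_FT[OF d, symmetric])
  also have "\<dots> \<le> (2 * pi) * L2norm (FT f) + (2 * pi) * L2norm (weighted s b (FT f))"
  proof (rule L2norm_dominated(2)[OF _ F(8) F(4)])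
    show "FT ?d \<in> borel_measurable lborel" by (intro sq_int_measurable FT_L2_bound d)
    fix \<xi>
    have "cmod (cis (- 2 * pi * t * (\<xi> \<bullet> e)) - cis (- 2 * pi * t * (b \<bullet> e))) \<le> \<bar>- 2 * pi * t * (\<xi> \<bullet> e) - (- 2 * pi * t * (b \<bullet> e))\<bar>"
      by (rule cis_diff_bound)
    also have "- 2 * pi * t * (\<xi> \<bullet> e) - (- 2 * pi * t * (b \<bullet> e)) = - 2 * pi * t * ((\<xi> - b) \<bullet> e)"
      by (simp add: inner_diff_left algebra_simps)
    finally have 1: "cmod (cis (- 2 * pi * t * (\<xi> \<bullet> e)) - cis (- 2 * pi * t * (b \<bullet> e))) \<le> 2 * pi * \<bar>(\<xi> - b) \<bullet> e\<bar> * \<bar>t\<bar>"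
      by (simp add: abs_mult mult_ac)
    have 2: "\<bar>(\<xi> - b) \<bullet> e\<bar> \<le> norm (\<xi> - b)" using Cauchy_Schwarz_ineq2[of "\<xi> - b" e] e by simp
    have 3: "norm (\<xi> - b) \<le> 1 + norm (\<xi> - b) powr s"
    proof (cases "norm (\<xi> - b) \<le> 1")
      case False
      then have "norm (\<xi> - b) powr 1 \<le> norm (\<xi> - b) powr s" using s by (intro powr_mono) auto
      then show ?thesis by simp
    qed (simp add: add_increasing2)
    have "cmod (FT ?d \<xi>) = cmod (cis (- 2 * pi * t * (\<xi> \<bullet> e)) - cis (- 2 * pi * t * (b \<bullet> e))) / \<bar>t\<bar> * cmod (FT f \<xi>)"
      unfolding FTd by (simp only: norm_mult norm_divide norm_of_real)
    also have "\<dots> \<le> 2 * pi * (1 + norm (\<xi> - b) powr s) * cmod (FT f \<xi>)"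
    proof (rule mult_right_mono)
      have "cmod (cis (- 2 * pi * t * (\<xi> \<bullet> e)) - cis (- 2 * pi * t * (b \<bullet> e))) / \<bar>t\<bar> \<le> 2 * pi * \<bar>(\<xi> - b) \<bullet> e\<bar>"
      proof -
        have "0 < \<bar>t\<bar>" using t by simp
        then show ?thesis using 1 by (simp only: pos_divide_le_eq)
      qed
      also have "\<dots> \<le> 2 * pi * (1 + norm (\<xi> - b) powr s)" using 2 3 by (intro mult_left_mono) auto
      finally show "cmod (cis (- 2 * pi * t * (\<xi> \<bullet> e)) - cis (- 2 * pi * t * (b \<bullet> e))) / \<bar>t\<bar> \<le> 2 * pi * (1 + norm (\<xi> - b) powr s)" .
    qed simp
    finally show "cmod (FT ?d \<xi>) \<le> (2 * pi) * cmod (FT f \<xi>) + (2 * pi) * cmod (weighted s b (FT f) \<xi>)"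
      by (simp add: cmod_weighted algebra_simps)
  qed auto
  also have "\<dots> \<le> (2 * pi) * m + (2 * pi) * m"
    using F by (intro add_mono mult_left_mono) (auto simp: L2norm_FT)
  finally show "L2norm ?d \<le> 4 * pi * m" by simp
  have "cmod (cis (- 2 * pi * t * (b \<bullet> e)) - cis 0) \<le> \<bar>- 2 * pi * t * (b \<bullet> e) - 0\<bar>"
    by (rule cis_diff_bound)
  also have "\<dots> = 2 * pi * \<bar>b \<bullet> e\<bar> * \<bar>t\<bar>" by (simp add: abs_mult)
  finally have "cmod c \<le> 2 * pi * \<bar>b \<bullet> e\<bar>"
    using t by (simp add: c_def norm_divide pos_divide_le_eq)
  also have "\<dots> \<le> 2 * pi * norm b" using Cauchy_Schwarz_ineq2[of b e] e by simp
  finally show "cmod c \<le> 2 * pi * norm b" .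
qed

subsection \<open>The uncertainty principle\<close>

lemma l2_of_inner_L2inner: "sq_int f \<Longrightarrow> sq_int g \<Longrightarrow> l2_of f \<bullet> l2_of g = Re (L2inner f g)"
  by (simp add: l2_of_inner L2inner_def)

lemma abs_l2_of_inner_le: "sq_int f \<Longrightarrow> sq_int g \<Longrightarrow> \<bar>l2_of f \<bullet> l2_of g\<bar> \<le> cmod (L2inner f g)"
  by (simp add: l2_of_inner_L2inner abs_Re_le_cmod)

text \<open>Translation changes the coordinate by the constant \<open>t\<close>. After division by
  \<open>t\<close> this is the discrete form of [X,P] = 1, with a translate in place of the
  identity.\<close>

lemma translation_coordinate_commutator:
  fixes f g :: "'a::euclidean_space \<Rightarrow> complex"
  assumes f: "sq_int f" "sq_int (\<lambda>x. complex_of_real (x \<bullet> e) * f x)"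
    and g: "sq_int g" "sq_int (\<lambda>x. complex_of_real (x \<bullet> e) * g x)" and e: "e \<bullet> e = 1"
  shows "L2inner (\<lambda>x. complex_of_real (x \<bullet> e) * f x) (translation (t *\<^sub>R e) g) =
     L2inner (translation (- t *\<^sub>R e) f) (\<lambda>x. complex_of_real (x \<bullet> e) * g x) - t * L2inner (translation (- t *\<^sub>R e) f) g"
proof -
  let ?s = "translation (- t *\<^sub>R e) f"
  have "L2inner (\<lambda>x. complex_of_real (x \<bullet> e) * f x) (translation (- (- t *\<^sub>R e)) g) =
      L2inner (translation (- t *\<^sub>R e) (\<lambda>x. complex_of_real (x \<bullet> e) * f x)) g"
    by (rule L2inner_translation[symmetric]) (rule f g)+
  also have "\<dots> = (\<integral>x. ?s x * cnj (complex_of_real (x \<bullet> e) * g x) - t * (?s x * cnj (g x)) \<partial>lborel)"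
    unfolding L2inner_def
    by (intro Bochner_Integration.integral_cong refl) (simp add: translation_def inner_add_left e algebra_simps)
  also have "\<dots> = L2inner ?s (\<lambda>x. complex_of_real (x \<bullet> e) * g x) - t * L2inner ?s g"
    unfolding L2inner_def
    by (subst Bochner_Integration.integral_diff)
      (auto intro!: integrable_mult_right integrable_sq_int_mult sq_int_translation f g simp del: complex_cnj_mult)
  finally show ?thesis by simp
qed

text \<open>Supplies the data of \<open>no_localized_commutation\<close>: \<open>Y i\<close> and
  \<open>H i\<close> are the plain and the centred coordinate times \<open>u i\<close>, and
  \<open>P t i\<close>, \<open>P (- t) i\<close> are difference quotients in the same direction
  \<open>e\<close>.\<close>

theorem no_localized_riesz_family:
  fixes f :: "nat \<Rightarrow> 'a::euclidean_space \<Rightarrow> complex"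
  assumes rf: "riesz_family (realify f) A B" and s: "real DIM('a) < s"
    and f: "\<And>n. localized s m (a n) (b n) (f n)"
  shows False
proof -
  interpret riesz_family "realify f" A B by (rule rf)
  have s1: "1 < s" using s DIM_positive[where 'a='a] by (metis One_nat_def Suc_leI le_less_trans of_nat_1 of_nat_le_iff)
  have m: "0 \<le> m" by (rule localizedD(9)[OF f])
  define u where "u i = (\<lambda>x. phase (snd i) * f (fst i) x)" for i :: "nat \<times> bool"
  define aa where "aa i = a (fst i)" for i :: "nat \<times> bool"
  define bb where "bb i = b (fst i)" for i :: "nat \<times> bool"
  have U: "localized s m (aa i) (bb i) (u i)" for i
    unfolding u_def aa_def bb_def by (intro localized_mult f) simp
  note UD = localizedD[OF U]
  have F: "realify f i = l2_of (u i)" for i by (simp add: realify_def u_def)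
  have normF: "norm (l2_of (u i)) \<le> m" for i using UD(2,5) by (simp add: l2_of_norm)
  define \<delta> where "\<delta> i j = max (norm (aa i - aa j)) (norm (bb i - bb j))" for i j
  define Ball where "Ball R = {i. norm (aa i) \<le> R \<and> norm (bb i) \<le> R}" for R
  obtain C where C: "0 \<le> C" and card: "\<And>a0 b0 R. 0 \<le> R \<Longrightarrow> finite {n. norm (a n - a0) \<le> R \<and> norm (b n - b0) \<le> R} \<and>
    real (card {n. norm (a n - a0) \<le> R \<and> norm (b n - b0) \<le> R}) \<le> C * (1 + R) ^ (2 * DIM('a))"
    using card_localized_bound[OF rf _ f] s1 by auto
  \<comment> \<open>The factor 2 counts the two copies of each \<open>f n\<close>, which share one
    centre.\<close>
  have card2: "finite {i. norm (aa i - a0) \<le> R \<and> norm (bb i - b0) \<le> R} \<and>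
    (0 \<le> R \<longrightarrow> real (card {i. norm (aa i - a0) \<le> R \<and> norm (bb i - b0) \<le> R}) \<le> (2 * C) * (1 + R) ^ (2 * DIM('a)))" for a0 b0 R
  proof (cases "0 \<le> R")
    case True
    have "{i. norm (aa i - a0) \<le> R \<and> norm (bb i - b0) \<le> R} = {n. norm (a n - a0) \<le> R \<and> norm (b n - b0) \<le> R} \<times> UNIV"
      by (auto simp: aa_def bb_def)
    then show ?thesis using card[OF True, of a0 b0] by (simp add: card_cartesian_product)
  next
    case False
    then have "{i. norm (aa i - a0) \<le> R \<and> norm (bb i - b0) \<le> R} = {}"
      using norm_ge_zero order.trans by blast
    then show ?thesis using False by (simp only: finite.emptyI) simp
  qed
  have near_eq: "{j. \<delta> i j \<le> K} = {j. norm (aa j - aa i) \<le> K \<and> norm (bb j - bb i) \<le> K}" for i K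
    by (auto simp: \<delta>_def norm_minus_commute)
  interpret localized_riesz "realify f" A B \<delta>
  proof
    fix i j k K
    have "norm (aa i - aa k) \<le> norm (aa i - aa j) + norm (aa j - aa k)"
      "norm (bb i - bb k) \<le> norm (bb i - bb j) + norm (bb j - bb k)"
      using norm_triangle_ineq[of "aa i - aa j" "aa j - aa k"] norm_triangle_ineq[of "bb i - bb j" "bb j - bb k"] by simp_all
    then show "\<delta> i k \<le> \<delta> i j + \<delta> j k" by (simp add: \<delta>_def max_def)
    show "\<exists>M. \<forall>i. finite {j. \<delta> i j \<le> K} \<and> card {j. \<delta> i j \<le> K} \<le> M"
    proof (cases "0 \<le> K")
      case True
      have "card {j. \<delta> i j \<le> K} \<le> nat \<lfloor>(2 * C) * (1 + K) ^ (2 * DIM('a))\<rfloor>" for i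
        using card2[of "aa i" K "bb i"] True unfolding near_eq by (simp add: le_nat_floor)
      then show ?thesis using card2 unfolding near_eq by blast
    next
      case False
      then have "{j. \<delta> i j \<le> K} = {}" for i
        unfolding near_eq using norm_ge_zero order.trans by blast
      then show ?thesis by (simp only: finite.emptyI card.empty simp_thms) blast
    qed
  qed
  have card_near': "real (card (near K i)) \<le> (2 * C) * (1 + K) ^ (2 * DIM('a))" if "0 \<le> K" for K i
    unfolding near_def near_eq using card2 that by blast
  have dec: "decaying (\<lambda>i. l2_of (g i))" if g: "\<And>i. localized s M (aa i) (bb i) (g i)" for g M
  proof (rule decaying_powr[where \<sigma> = s, OF card_near'])
    show "0 \<le> 2 * C" using C by simp
    show "real (2 * DIM('a)) < 2 * s" using s by simp
    fix i j
    have "\<delta> i j powr s * \<bar>l2_of (g i) \<bullet> realify f j\<bar> \<le> \<delta> i j powr s * cmod (L2inner (g i) (u j))"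
      unfolding F by (intro mult_left_mono abs_l2_of_inner_le UD localizedD(2)[OF g]) simp
    also have "\<dots> \<le> 2 powr s * (2 * M * m)"
      unfolding \<delta>_def using s1 by (intro localized_pairing g U) simp
    finally show "\<delta> i j powr s * \<bar>l2_of (g i) \<bullet> realify f j\<bar> \<le> 2 powr s * (2 * M * m)" .
  qed
  have decF: "decaying (realify f)" using dec[OF U] by (simp add: F[symmetric])
  obtain e :: 'a where "e \<in> Basis" using nonempty_Basis by blast
  then have e: "norm e = 1" "e \<bullet> e = 1" by simp_all
  define H where "H i = (\<lambda>x. complex_of_real ((x - aa i) \<bullet> e) * u i x)" for i
  define Y where "Y i = (\<lambda>x. complex_of_real (x \<bullet> e) * u i x)" for i
  have H: "sq_int (H i)" "L2norm (H i) \<le> 2 * m" for i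
    using coordinate_mult[of s "u i" "aa i" e] s1 UD(2,3,5,6)[of i] e unfolding H_def by auto
  have Yeq: "Y i = (\<lambda>x. H i x + (aa i \<bullet> e) *\<^sub>R u i x)" for i
    by (auto simp: Y_def H_def inner_diff_left scaleR_conv_of_real algebra_simps)
  have Y: "sq_int (Y i)" for i unfolding Yeq by (intro sq_int_add H sq_int_scaleR UD)
  have decH: "decaying (\<lambda>i. l2_of (H i))"
  proof (rule decaying_limit)
    fix \<epsilon> :: real assume \<epsilon>: "0 < \<epsilon>"
    \<comment> \<open>\<open>T\<close> is large enough that the far error is at most
      \<open>sqrt \<epsilon> / 2\<close>, and then \<open>\<eta>\<close> is small enough for the
      same bound on the near error. \<open>m + 1\<close> avoids division by 0.\<close>
    define X where "X = 4 * (m + 1) / sqrt \<epsilon>"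
    have X: "0 < X" using m \<epsilon> by (simp add: X_def)
    define T where "T = max 1 (X powr (1 / (s - 1)))"
    define \<eta> where "\<eta> = sqrt \<epsilon> / (2 * (m + 1) * T\<^sup>2)"
    have T: "1 \<le> T" by (simp add: T_def)
    have \<eta>: "0 < \<eta>" using \<epsilon> m T by (auto simp: \<eta>_def intro!: divide_pos_pos mult_pos_pos)
    let ?h = "\<lambda>i x. complex_of_real (sin (\<eta> * ((x - aa i) \<bullet> e)) / \<eta>) * u i x"
    have "decaying (\<lambda>i. l2_of (?h i))"
      by (rule dec) (rule localized_sin[OF _ U \<eta> e(1)], use s1 in simp)
    moreover have "(norm (l2_of (H i) - l2_of (?h i)))\<^sup>2 \<le> \<epsilon>" for i
    proof -
      note S = sin_coordinate_approx[OF s1 UD(2,3)[of i] e(1) T \<eta>]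
      have h: "sq_int (?h i)"
        by (rule localizedD(2)[OF localized_sin[OF _ U \<eta> e(1)]]) (use s1 in simp)
      have T2: "T powr (1 - s) \<le> sqrt \<epsilon> / (4 * (m + 1))"
      proof -
        have "T powr (1 - s) \<le> (X powr (1 / (s - 1))) powr (1 - s)"
          using s1 X by (intro powr_mono2') (auto simp: T_def)
        also have "\<dots> = X powr (- 1)"
        proof -
          have "1 / (s - 1) * (1 - s) = - 1" using s1 by (simp add: field_simps)
          then show ?thesis by (simp only: powr_powr)
        qed
        also have "\<dots> = sqrt \<epsilon> / (4 * (m + 1))" using X m \<epsilon> by (simp add: X_def powr_minus_divide)
        finally show ?thesis .
      qed
      have "norm (l2_of (H i) - l2_of (?h i)) = L2norm (\<lambda>x. H i x - ?h i x)"
        using H(1) h by (simp add: l2_of_norm sq_int_diff flip: l2_of_diff)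
      also have "\<dots> \<le> (\<eta> * T\<^sup>2) * L2norm (u i) + (2 * T powr (1 - s)) * L2norm (weighted s (aa i) (u i))"
        unfolding H_def by (rule S(2))
      also have "\<dots> \<le> (\<eta> * T\<^sup>2) * (m + 1) + (2 * (sqrt \<epsilon> / (4 * (m + 1)))) * (m + 1)"
        using UD(5)[of i] UD(6)[of i] \<eta> m T2 \<epsilon> by (intro add_mono mult_mono) auto
      also have "\<dots> = sqrt \<epsilon> / 2 + sqrt \<epsilon> / 2"
      proof -
        have "(r / (2 * q * y)) * y * q + (2 * (r / (4 * q))) * q = r / 2 + r / 2" if "0 < q" "0 < y" for r q y :: real
          using that by simp
        moreover have "0 < m + 1" "0 < T\<^sup>2" using m T by simp_all
        ultimately show ?thesis unfolding \<eta>_def by blast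
      qed
      finally have "norm (l2_of (H i) - l2_of (?h i)) \<le> sqrt \<epsilon>" by simp
      then have "(norm (l2_of (H i) - l2_of (?h i)))\<^sup>2 \<le> (sqrt \<epsilon>)\<^sup>2" by (rule power_mono) simp
      then show ?thesis using \<epsilon> by simp
    qed
    ultimately show "\<exists>h'. decaying h' \<and> (\<forall>i. (norm (l2_of (H i) - h' i))\<^sup>2 \<le> \<epsilon>)" by blast
  qed
  \<comment> \<open>A complex multiple of \<open>u i\<close> is a real combination of the two copies
    of the same \<open>f n\<close>, and both are at distance 0 from \<open>i\<close>.\<close>
  have span_u: "l2_of (\<lambda>x. c * u i x) \<in> span (realify f ` near 0 i)" for c i
  proof -
    obtain n bo where i: "i = (n, bo)" by (cases i)
    have "l2_of (\<lambda>x. c * u i x) = l2_of (\<lambda>x. Complex (Re (c * phase bo)) (Im (c * phase bo)) * f n x)"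
      by (simp only: complex_surj u_def i fst_conv snd_conv mult.assoc)
    also have "\<dots> = Re (c * phase bo) *\<^sub>R realify f (n, False) + Im (c * phase bo) *\<^sub>R realify f (n, True)"
      by (rule realify_pair[symmetric]) (rule localizedD(2)[OF f])
    also have "\<dots> \<in> span (realify f ` near 0 i)"
      by (intro span_add span_scale span_base imageI) (auto simp: near_def \<delta>_def i aa_def bb_def)
    finally show ?thesis .
  qed
  define T where "T t i = translation (- t *\<^sub>R e) (u i)" for t i
  define P where "P t i = (\<lambda>x. (T t i x - u i x) / complex_of_real t)" for t i
  have sT: "sq_int (T t i)" for t i unfolding T_def by (intro sq_int_translation UD)
  have Peq: "P t i = (\<lambda>x. (1 / t) *\<^sub>R (T t i x - u i x))" for t i
    by (auto simp: P_def scaleR_conv_of_real)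
  have sP: "sq_int (P t i)" for t i unfolding Peq by (intro sq_int_scaleR sq_int_diff sT UD)
  have mkP: "l2_of (P t i) = (1 / t) *\<^sub>R (l2_of (T t i) - l2_of (u i))" for t i
    unfolding Peq by (simp add: l2_of_scaleR l2_of_diff sq_int_diff sT UD(2))
  define M where "M = (4 * pi * m)\<^sup>2 + (2 * m)\<^sup>2"
  have M: "(4 * pi * m)\<^sup>2 \<le> M" "(2 * m)\<^sup>2 \<le> M" by (simp_all only: M_def le_add_same_cancel1 le_add_same_cancel2 zero_le_power2)
  have Pspan: "\<exists>v\<in>span (realify f ` near 0 i). (norm (l2_of (P t i) - v))\<^sup>2 \<le> M" if t: "t \<noteq> 0" for t i
  proof (rule bexI)
    define c where "c = (cis (- 2 * pi * t * (bb i \<bullet> e)) - 1) / complex_of_real t"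
    show "l2_of (\<lambda>x. c * u i x) \<in> span (realify f ` near 0 i)" by (rule span_u)
    have "norm (l2_of (P t i) - l2_of (\<lambda>x. c * u i x)) = L2norm (\<lambda>x. P t i x - c * u i x)"
      using sP UD(2) by (simp add: l2_of_norm sq_int_diff sq_int_mult flip: l2_of_diff)
    also have "\<dots> \<le> 4 * pi * m"
      unfolding P_def T_def c_def using s1 by (intro difference_quotient_bound(1)[OF _ U e(1) t]) simp
    finally have "(norm (l2_of (P t i) - l2_of (\<lambda>x. c * u i x)))\<^sup>2 \<le> (4 * pi * m)\<^sup>2" by (rule power_mono) simp
    then show "(norm (l2_of (P t i) - l2_of (\<lambda>x. c * u i x)))\<^sup>2 \<le> M" using M(1) by (rule order.trans)
  qed
  \<comment> \<open>The whole quotient, unlike its distance to the span, grows with the frequency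
    centre. On a ball it is bounded independently of \<open>t\<close>, which is enough to let
    \<open>t\<close> tend to 0.\<close>
  have Pnorm: "norm (l2_of (P t i)) \<le> 4 * pi * m + 2 * pi * R * m" if t: "t \<noteq> 0" and R: "norm (bb i) \<le> R" for t i R
  proof -
    define c where "c = (cis (- 2 * pi * t * (bb i \<bullet> e)) - 1) / complex_of_real t"
    have "norm (l2_of (P t i)) = L2norm (\<lambda>x. (P t i x - c * u i x) + c * u i x)" by (simp add: l2_of_norm sP)
    also have "\<dots> \<le> L2norm (\<lambda>x. P t i x - c * u i x) + L2norm (\<lambda>x. c * u i x)"
      by (intro L2norm_triangle sq_int_diff sq_int_mult sP UD)
    also have "L2norm (\<lambda>x. P t i x - c * u i x) \<le> 4 * pi * m"
      unfolding P_def T_def c_def using s1 by (intro difference_quotient_bound(1)[OF _ U e(1) t]) simp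
    also have "L2norm (\<lambda>x. c * u i x) \<le> 2 * pi * R * m"
      unfolding L2norm_mult
    proof (rule mult_mono)
      have "cmod c \<le> 2 * pi * norm (bb i)"
        unfolding c_def using s1 by (intro difference_quotient_bound(2)[OF _ U e(1) t]) simp
      also have "\<dots> \<le> 2 * pi * R" using R by simp
      finally show "cmod c \<le> 2 * pi * R" .
      show "0 \<le> 2 * pi * R" using order.trans[OF norm_ge_zero R] by simp
    qed (use UD(5) in auto)
    finally show ?thesis by simp
  qed
  have Tadj: "l2_of (T t i) \<bullet> l2_of (u j) = l2_of (u i) \<bullet> l2_of (T (- t) j)" for t i j
    using L2inner_translation[OF UD(2) UD(2), of "- t *\<^sub>R e" i j] sT[of t i] sT[of "- t" j] UD(2)
    by (simp add: l2_of_inner_L2inner T_def)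
  have Ysym: "l2_of (Y i) \<bullet> l2_of (u j) = l2_of (u i) \<bullet> l2_of (Y j)" for i j
    using Y UD(2) by (simp add: l2_of_inner Y_def mult_ac)
  have Tcomm: "l2_of (Y i) \<bullet> l2_of (T (- t) j) = l2_of (T t i) \<bullet> l2_of (Y j) - t * (l2_of (T t i) \<bullet> l2_of (u j))" for t i j
    using translation_coordinate_commutator[of "u i" e "u j" t] UD(2) Y sT[of t i] sT[of "- t" j] e(2)
    by (simp add: l2_of_inner_L2inner T_def Y_def)
  show False
  proof (rule no_localized_commutation[where h = "\<lambda>i. l2_of (H i)" and y = "\<lambda>i. l2_of (Y i)" and Ball = Ball
        and C = "2 * C" and D = "2 * DIM('a)" and M = M
        and ?R0.0 = "max (norm (aa (0, False))) (norm (bb (0, False)))", OF _ _ _ _ _ _ decF decH])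
    show "Ball R \<subseteq> Ball R'" if "R \<le> R'" for R R' using that by (auto simp: Ball_def)
    show "finite (Ball R)" for R using card2[of 0 R 0] by (simp add: Ball_def)
    show "Ball (max (norm (aa (0, False))) (norm (bb (0, False)))) \<noteq> {}"
      unfolding Ball_def by (rule ex_in_conv[THEN iffD1], rule exI[of _ "(0, False)"]) simp
    show "real (card (Ball R)) \<le> 2 * C * (1 + R) ^ (2 * DIM('a))" if "0 \<le> R" for R
      using card2[of 0 R 0] that by (simp add: Ball_def)
    show "0 < 2 * DIM('a)" by simp
    show "near K i \<subseteq> Ball (R + K)" if "i \<in> Ball R" for i R K
    proof
      fix j assume "j \<in> near K i"
      then have "norm (aa j - aa i) \<le> K" "norm (bb j - bb i) \<le> K" unfolding near_def near_eq by auto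
      moreover have "norm (aa j) \<le> norm (aa i) + norm (aa j - aa i)" "norm (bb j) \<le> norm (bb i) + norm (bb j - bb i)"
        using norm_triangle_ineq[of "aa i" "aa j - aa i"] norm_triangle_ineq[of "bb i" "bb j - bb i"] by simp_all
      ultimately show "j \<in> Ball (R + K)" using that by (auto simp: Ball_def)
    qed
    show "(norm (l2_of (H i)))\<^sup>2 \<le> M" for i
    proof -
      have "(norm (l2_of (H i)))\<^sup>2 \<le> (2 * m)\<^sup>2" using H[of i] by (intro power_mono) (auto simp: l2_of_norm)
      then show ?thesis using M(2) by (rule order.trans)
    qed
    show "l2_of (Y i) - l2_of (H i) \<in> span (realify f ` near 0 i)" for i
    proof -
      have "l2_of (Y i) - l2_of (H i) = l2_of (\<lambda>x. complex_of_real (aa i \<bullet> e) * u i x)"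
      proof -
        have "(\<lambda>x. Y i x - H i x) = (\<lambda>x. complex_of_real (aa i \<bullet> e) * u i x)"
          by (simp add: Yeq scaleR_conv_of_real)
        then show ?thesis by (simp only: l2_of_diff[OF Y H(1), symmetric])
      qed
      then show ?thesis using span_u by simp
    qed
    show "l2_of (Y i) \<bullet> realify f j = realify f i \<bullet> l2_of (Y j)" for i j
      unfolding F by (rule Ysym)
    fix \<eta> R :: real assume \<eta>: "0 < \<eta>"
    \<comment> \<open>The commutator differs from the identity by \<open>t\<close> times the pairing
      of \<open>P t i\<close> with \<open>u j\<close>, and \<open>D\<close> bounds that pairing on
      \<open>Ball R\<close> for all \<open>t\<close>. The choice of \<open>t\<close> then makes the
      error at most \<open>\<eta>\<close>.\<close>
    define D where "D = (4 * pi * m + 2 * pi * max 0 R * m) * m"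
    have D: "0 \<le> D" using m by (simp add: D_def)
    define t where "t = \<eta> / (D + 1)"
    have t: "0 < t" "t \<noteq> 0" "- t \<noteq> 0" using \<eta> D by (auto simp: t_def)
    show "\<exists>p p'. (\<forall>i j. p i \<bullet> realify f j = - (realify f i \<bullet> p' j)) \<and>
       (\<forall>i\<in>Ball R. \<forall>j\<in>Ball R. \<bar>p i \<bullet> l2_of (Y j) + l2_of (Y i) \<bullet> p' j - realify f i \<bullet> realify f j\<bar> \<le> \<eta>) \<and>
       (\<forall>i. \<exists>v\<in>span (realify f ` near 0 i). (norm (p i - v))\<^sup>2 \<le> M) \<and>
       (\<forall>i. \<exists>v\<in>span (realify f ` near 0 i). (norm (p' i - v))\<^sup>2 \<le> M)"
    proof (rule exI[of _ "\<lambda>i. l2_of (P t i)"], rule exI[of _ "\<lambda>i. l2_of (P (- t) i)"], intro conjI allI ballI Pspan t)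
      show "l2_of (P t i) \<bullet> realify f j = - (realify f i \<bullet> l2_of (P (- t) j))" for i j
        unfolding F mkP by (simp add: inner_diff_left inner_diff_right Tadj)
      fix i j assume ij: "i \<in> Ball R" "j \<in> Ball R"
      have "l2_of (P t i) \<bullet> l2_of (Y j) + l2_of (Y i) \<bullet> l2_of (P (- t) j) =
         (1 / t) * (l2_of (T t i) \<bullet> l2_of (Y j) - l2_of (Y i) \<bullet> l2_of (T (- t) j)) + (1 / t) * (l2_of (Y i) \<bullet> l2_of (u j) - l2_of (u i) \<bullet> l2_of (Y j))"
        unfolding mkP by (simp add: inner_diff_left inner_diff_right diff_divide_distrib)
      also have "\<dots> = l2_of (T t i) \<bullet> l2_of (u j)"
        unfolding Tcomm Ysym using t by simp
      finally have "l2_of (P t i) \<bullet> l2_of (Y j) + l2_of (Y i) \<bullet> l2_of (P (- t) j) - realify f i \<bullet> realify f j = (t *\<^sub>R l2_of (P t i)) \<bullet> l2_of (u j)"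
        unfolding F mkP using t by (simp add: inner_diff_left)
      also have "\<bar>(t *\<^sub>R l2_of (P t i)) \<bullet> l2_of (u j)\<bar> \<le> norm (t *\<^sub>R l2_of (P t i)) * norm (l2_of (u j))"
        by (rule Cauchy_Schwarz_ineq2)
      also have "\<dots> \<le> (t * (4 * pi * m + 2 * pi * max 0 R * m)) * m"
        using t ij normF[of j] m Pnorm[OF t(2), of i "max 0 R"]
        by (intro mult_mono) (auto simp: Ball_def)
      also have "\<dots> = t * D" by (simp add: D_def)
      also have "\<dots> \<le> \<eta>" using \<eta> D by (simp add: t_def field_simps)
      finally show "\<bar>l2_of (P t i) \<bullet> l2_of (Y j) + l2_of (Y i) \<bullet> l2_of (P (- t) j) - realify f i \<bullet> realify f j\<bar> \<le> \<eta>" .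
    qed
  qed
qed

theorem theorem1:
  fixes f :: "nat \<Rightarrow> 'a::euclidean_space \<Rightarrow> complex" and s :: real
  assumes "s > real DIM('a)"
    and "L2_riesz_basis f"
  shows "(SUP n. (INF a. \<integral>\<^sup>+ x. ennreal (norm (x - a) powr (2 * s) * (cmod (f n x))\<^sup>2) \<partial>lborel)
              + (INF b. \<integral>\<^sup>+ \<xi>. ennreal (norm (\<xi> - b) powr (2 * s) * (cmod (fourier_L2 (f n) \<xi>))\<^sup>2) \<partial>lborel))
         = \<infinity>"
    (is "(SUP n. ?X n + ?Y n) = \<infinity>")
proof (rule ccontr)
  assume fin: "(SUP n. ?X n + ?Y n) \<noteq> \<infinity>"
  obtain S where S: "(SUP n. ?X n + ?Y n) = ennreal S" "0 \<le> S"
    using fin by (cases "SUP n. ?X n + ?Y n") auto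
  have le: "?X n + ?Y n \<le> ennreal S" for n unfolding S(1)[symmetric] by (rule SUP_upper) simp
  \<comment> \<open>The infima need not be attained; the slack 1 allows centres \<open>a n\<close>
    and \<open>b n\<close> to be picked with moments below \<open>S + 1\<close>.\<close>
  have lt: "ennreal S < ennreal (S + 1)" using S(2) by (simp add: ennreal_less_iff)
  have X: "?X n < ennreal (S + 1)" and Y: "?Y n < ennreal (S + 1)" for n
  proof -
    show "?X n < ennreal (S + 1)" by (rule le_less_trans[OF order.trans[OF _ le[of n]] lt]) simp
    show "?Y n < ennreal (S + 1)" by (rule le_less_trans[OF order.trans[OF _ le[of n]] lt]) simp
  qed
  have "\<exists>a. (\<integral>\<^sup>+ x. ennreal (norm (x - a) powr (2 * s) * (cmod (f n x))\<^sup>2) \<partial>lborel) < ennreal (S + 1)" for n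
    using X[of n] by (simp add: INF_less_iff)
  then obtain a where a: "\<And>n. (\<integral>\<^sup>+ x. ennreal (norm (x - a n) powr (2 * s) * (cmod (f n x))\<^sup>2) \<partial>lborel) < ennreal (S + 1)"
    by metis
  have "\<exists>b. (\<integral>\<^sup>+ \<xi>. ennreal (norm (\<xi> - b) powr (2 * s) * (cmod (fourier_L2 (f n) \<xi>))\<^sup>2) \<partial>lborel) < ennreal (S + 1)" for n
    using Y[of n] by (simp add: INF_less_iff)
  then obtain b where b: "\<And>n. (\<integral>\<^sup>+ \<xi>. ennreal (norm (\<xi> - b n) powr (2 * s) * (cmod (fourier_L2 (f n) \<xi>))\<^sup>2) \<partial>lborel) < ennreal (S + 1)"
    by metis
  obtain A B where rf: "riesz_family (realify f) A B" using riesz_basis_realify[OF assms(2)] by blast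
  interpret riesz_family "realify f" A B by (rule rf)
  have f: "sq_int (f n)" for n using assms(2) by (simp add: L2_riesz_basis_def)
  \<comment> \<open>The first entry bounds the weighted norms; the second bounds the plain norms
    through the upper Riesz bound.\<close>
  define m where "m = max (sqrt (S + 1)) (sqrt B)"
  have m: "0 \<le> m" using S(2) by (simp add: m_def max.coboundedI1)
  have m2: "S + 1 \<le> m\<^sup>2"
  proof -
    have "(sqrt (S + 1))\<^sup>2 \<le> m\<^sup>2" using S(2) by (intro power_mono) (auto simp: m_def)
    then show ?thesis using S(2) by simp
  qed
  have "localized s m (a n) (b n) (f n)" for n
  proof -
    have wa: "sq_int (weighted s (a n) (f n)) \<and> L2norm (weighted s (a n) (f n)) \<le> m"
    proof (subst L2norm_le_iff_nn_integral[OF m weighted_measurable[OF sq_int_measurable[OF f]]])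
      show "(\<integral>\<^sup>+ x. ennreal ((cmod (weighted s (a n) (f n) x))\<^sup>2) \<partial>lborel) \<le> ennreal (m\<^sup>2)"
        unfolding cmod_weighted_sq using a[of n] m2 by (meson ennreal_leI less_imp_le order.trans)
    qed
    \<comment> \<open>The position moment alone gives integrability, as \<open>2 s\<close> exceeds
      the dimension. Only then can \<open>fourier_L2\<close> be replaced by \<open>FT\<close> in the
      frequency moment.\<close>
    have int: "integrable lborel (f n)"
      by (rule integrable_of_weighted[OF _ f]) (use assms(1) wa in auto)
    have "(\<integral>\<^sup>+ \<xi>. ennreal (norm (\<xi> - b n) powr (2 * s) * (cmod (fourier_L2 (f n) \<xi>))\<^sup>2) \<partial>lborel) =
      (\<integral>\<^sup>+ \<xi>. ennreal (norm (\<xi> - b n) powr (2 * s) * (cmod (FT (f n) \<xi>))\<^sup>2) \<partial>lborel)"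
      using fourier_L2_AE_eq_FT(2)[OF int f] by (intro nn_integral_cong_AE) (auto elim: eventually_mono)
    then have wb: "sq_int (weighted s (b n) (FT (f n))) \<and> L2norm (weighted s (b n) (FT (f n))) \<le> m"
      using b[of n] m2
      by (subst L2norm_le_iff_nn_integral[OF m weighted_measurable[OF FT_measurable[OF sq_int_measurable[OF f]]]])
        (simp only: cmod_weighted_sq, meson ennreal_leI less_imp_le order.trans)
    have "L2norm (f n) = norm (realify f (n, False))"
      using f by (simp add: realify_def phase_def l2_of_norm)
    also have "\<dots> \<le> sqrt B" by (rule real_le_rsqrt) (rule norm_bounds)
    finally have "L2norm (f n) \<le> m" by (simp add: m_def)
    then show ?thesis using int f wa wb by (simp add: localized_def)
  qed
  from no_localized_riesz_family[OF rf assms(1) this] show False .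
qed

end
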